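(* Let $\mathsf{M}$ be an abelian $t$-motive over $K$, $k\geq 0$ and $\rho_k\mathsf{M}$ the $k$-th prolongation of $\mathsf{M}$. \begin{enumerate} \item If $\mathsf{M}$ is rigid analytically trivial, then $\rho_k\mathsf{M}$ is rigid analytically trivial. \item If $\mathsf{M}$ is pure of weight $w$, then $\rho_k\mathsf{M}$ is pure of weight $w$. \end{enumerate}
   Context: Let $K$ be a finite extension of $\mathbb{F}_q(\theta)$, with an absolute value $|\cdot|_\infty$ extending the one on $\mathbb{F}_q(\theta)$ with $|\theta|_\infty=q$; $K_\infty$ is the completion of $K$ and $\mathbb{C}_\infty$ the completion of an algebraic closure of $K_\infty$. $\mathbb{T}\subset\mathbb{C}_\infty[[t]]$ is the Tate algebra of power series converging for $|t|_\infty\le1$. For a Laurent series $f=\sum x_it^i$ put $f^\tau=\sum x_i^qt^i$ (entry-wise on matrices). $K[t]\{\tau\}$ is the skew polynomial ring with $\tau a=a^\tau\tau$ for $a\in K[t]$, and $K\{\tau\}$ the corresponding subring over $K$. A $t$-motive $\mathsf{M}$ is a left $K[t]\{\tau\}$-module which is free and finitely generated as a $K\{\tau\}$-module and such that $(t-\theta)^\ell \mathsf{M}\subseteq K[t]\cdot\tau(\mathsf{M})$ for some $\ell\in\mathbb{N}$. It is abelian if it is also finitely generated (hence free) as a $K[t]$-module. Rigid analytic triviality: let $\boldsymbol{e}=(e_1,\dots,e_r)$ be a $K[t]$-basis of the abelian $t$-motive $\mathsf{M}$, and $\Theta\in\mathrm{Mat}_{r\times r}(K[t])$ the matrix with $\tau(\boldsymbol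 e)=\boldsymbol e\cdot\Theta$, i.e. $\tau(e_j)=\sum_h\Theta_{hj}e_h$. A rigid analytic trivialization is a matrix $\Upsilon\in\mathrm{GL}_r(\mathbb{T})$ with $\Theta\cdot\Upsilon^\tau=\Upsilon$; $\mathsf{M}$ is rigid analytically trivial if such $\Upsilon$ exists. Purity: an abelian $t$-motive $\mathsf{M}$ is pure if there exist a $K[[1/t]]$-lattice $H$ inside $\mathsf{M}\otimes_{K[t]}K((1/t))$ and $u,v\ge1$ such that $t^uH=K[[1/t]]\cdot\tau^vH$ (with $\tau$ extended semilinearly, acting on coefficients of $K((1/t))$ by $x\mapsto x^q$ and fixing $t$); its weight is $w=u/v$. Prolongation: for a left $K[t]\{\tau\}$-module $\mathsf{M}$ and $k\ge0$, $\rho_k\mathsf{M}$ is the $K[t]$-module generated by symbols $D_im$ ($i=0,\dots,k$, $m\in\mathsf{M}$) subject to $D_i(m_1+m_2)=D_im_1+D_im_2$ and $D_i(a m)=\sum_{i_1+i_2=i}\partial_t^{(i_1)}(a)\cdot D_{i_2}m$ for all $m,m_1,m_2\in\mathsf{M}$, $a\in K[t]$, where $\partial_t^{(n)}$ is the $K$-linear map with $\partial_t^{(n)}(t^i)=\binom{i}{n}t^{i-n}$. It is a $K[t]\{\tau\}$-module via $\tau(a\cdot D_im)=a^\tau\cdot D_i(\tau(m))$. (If $\mathsf{M}$ is an abelian $t$-motive, so is $\rho_k\mathsf{M}$.) *)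

theory Defs
  imports
    "HOL-Algebra.Algebraic_Closure_Type"
    "HOL-Algebra.AbelCoset"
    "HOL-Analysis.Abstract_Metric_Spaces"
    "HOL-Library.Poly_Mapping"
    "HOL-Library.FuncSet"
    "Jordan_Normal_Form.Matrix"
    "HOL-Computational_Algebra.Computational_Algebra"
begin

section \<open>Valued fields\<close>

definition absolute_value :: "('a::field \<Rightarrow> real) \<Rightarrow> bool" where
  "absolute_value v \<longleftrightarrow>
     (\<forall>x. v x \<ge> 0) \<and> (\<forall>x. v x = 0 \<longleftrightarrow> x = 0) \<and>
     (\<forall>x y. v (x * y) = v x * v y) \<and> (\<forall>x y. v (x + y) \<le> v x + v y)"

abbreviation dist_of :: "('a::field \<Rightarrow> real) \<Rightarrow> 'a \<Rightarrow> 'a \<Rightarrow> real" where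
  "dist_of v \<equiv> \<lambda>x y. v (x - y)"

abbreviation valuation_topology :: "('a::field \<Rightarrow> real) \<Rightarrow> 'a topology" where
  "valuation_topology v \<equiv> Metric_space.mtopology UNIV (dist_of v)"

definition is_completion ::
    "('a::field \<Rightarrow> real) \<Rightarrow> ('b::field \<Rightarrow> real) \<Rightarrow> ('a \<Rightarrow> 'b) \<Rightarrow> bool" where
  "is_completion v w i \<longleftrightarrow>
     absolute_value w \<and> field_hom i \<and> (\<forall>x. w (i x) = v x) \<and>
     Metric_space.mcomplete UNIV (dist_of w) \<and>
     valuation_topology w closure_of range i = UNIV"

definition is_valued_algebraic_closure ::
    "('a::field \<Rightarrow> real) \<Rightarrow> ('b::alg_closed_field \<Rightarrow> real) \<Rightarrow> ('a \<Rightarrow> 'b) \<Rightarrow> bool" where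
  "is_valued_algebraic_closure v w i \<longleftrightarrow>
     absolute_value w \<and> field_hom i \<and> (\<forall>x. w (i x) = v x) \<and>
     (\<forall>y. \<exists>p. p \<noteq> 0 \<and> poly (map_poly i p) y = 0)"

text \<open>
  The field \<open>F\<^sub>q(\<theta>)\<close> is the type \<open>'f poly fract\<close> with \<open>'f\<close> a finite field and \<open>\<theta>\<close> the class
  of \<open>[:0, 1:]\<close>.
\<close>

definition finite_extension :: "('f::finite_field poly fract \<Rightarrow> 'k::field) \<Rightarrow> bool" where
  "finite_extension \<iota> \<longleftrightarrow>
     field_hom \<iota> \<and> (\<exists>B. finite_dimensional_vector_space (\<lambda>c x. \<iota> c * x) B)"

text \<open>
  By multiplicativity the values on nonzero polynomials determine \<open>v\<close> on all of \<open>F\<^sub>q(\<theta>)\<close>.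
\<close>

definition extends_infinite_place ::
    "('f::finite_field poly fract \<Rightarrow> 'k::field) \<Rightarrow> ('k \<Rightarrow> real) \<Rightarrow> bool" where
  "extends_infinite_place \<iota> v \<longleftrightarrow>
     absolute_value v \<and> (\<forall>p. p \<noteq> 0 \<longrightarrow> v (\<iota> (Fract p 1)) = real CARD('f) ^ degree p)"

definition tate_algebra :: "('c::field \<Rightarrow> real) \<Rightarrow> 'c fps set" where
  "tate_algebra v =
     {f. \<forall>z. v z \<le> 1 \<longrightarrow>
        (\<exists>s. limitin (valuation_topology v) (\<lambda>n. \<Sum>i<n. fps_nth f i * z ^ i) s sequentially)}"


section \<open>Coefficientwise Frobenius twists and hyperderivatives\<close>

definition poly_twist :: "nat \<Rightarrow> 'a::field poly \<Rightarrow> 'a poly" where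
  "poly_twist q a = map_poly (\<lambda>x. x ^ q) a"

definition fps_twist :: "nat \<Rightarrow> 'a::field fps \<Rightarrow> 'a fps" where
  "fps_twist q f = Abs_fps (\<lambda>i. fps_nth f i ^ q)"

definition fls_twist :: "nat \<Rightarrow> 'a::field fls \<Rightarrow> 'a fls" where
  "fls_twist q f = Abs_fls (\<lambda>i. fls_nth f i ^ q)"

text \<open>For \<open>i < n\<close> the truncated exponent \<open>i - n\<close> is harmless, as the binomial coefficient is 0.\<close>

definition hyperderiv :: "nat \<Rightarrow> 'a::field poly \<Rightarrow> 'a poly" where
  "hyperderiv n a = (\<Sum>i\<le>degree a. monom (of_nat (i choose n) * coeff a i) (i - n))"

text \<open>
  \<open>K((1/t))\<close> is \<open>'k fls\<close>, with \<open>fls_X\<close> in the role of \<open>1/t\<close> and \<open>fls_X_inv\<close> in the role of \<open>t\<close>.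
\<close>

definition poly_at_infinity :: "'a::field poly \<Rightarrow> 'a fls" where
  "poly_at_infinity a = poly (map_poly fls_const a) fls_X_inv"


section \<open>Modules\<close>

abbreviation type_ring :: "'a::comm_ring_1 ring" where
  "type_ring \<equiv> ring_of_type_algebra"

definition inverse_t_series :: "'k::field fls ring" where
  "inverse_t_series = type_ring\<lparr>carrier := range fps_to_fls\<rparr>"

definition module_span ::
    "('a, 'r) ring_scheme \<Rightarrow> ('a, 'm, 's) module_scheme \<Rightarrow> 'm set \<Rightarrow> 'm set" where
  "module_span R M S = \<Inter>{N. submodule N R M \<and> S \<subseteq> N}"

definition finitely_generated ::
    "('a, 'r) ring_scheme \<Rightarrow> ('a, 'm, 's) module_scheme \<Rightarrow> 'm set \<Rightarrow> bool" where
  "finitely_generated R M N \<longleftrightarrow> (\<exists>S. finite S \<and> S \<subseteq> N \<and> module_span R M S = N)"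

definition module_basis ::
    "('a, 'r) ring_scheme \<Rightarrow> ('a, 'm, 's) module_scheme \<Rightarrow> nat \<Rightarrow> (nat \<Rightarrow> 'm) \<Rightarrow> bool" where
  "module_basis R M r e \<longleftrightarrow>
     e \<in> {..<r} \<rightarrow> carrier M \<and>
     (\<forall>m\<in>carrier M. \<exists>!c. c \<in> {..<r} \<rightarrow>\<^sub>E carrier R \<and>
        m = (\<Oplus>\<^bsub>M\<^esub>j\<in>{..<r}. c j \<odot>\<^bsub>M\<^esub> e j))"

record ('a, 'm) tau_module = "('a, 'm) module" +
  tau :: "'m \<Rightarrow> 'm"

text \<open>
  Since \<open>K[t]{\<tau>}\<close> is generated over \<open>K[t]\<close> by \<open>\<tau>\<close> with the relations \<open>\<tau> a = a\<^sup>\<tau> \<tau>\<close>, a left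
  \<open>K[t]{\<tau>}\<close>-module is a \<open>K[t]\<close>-module with an additive \<open>\<tau>\<close> that is semilinear for the twist.
\<close>

definition skew_module :: "nat \<Rightarrow> ('k::field poly, 'm) tau_module \<Rightarrow> bool" where
  "skew_module q M \<longleftrightarrow>
     module type_ring M \<and>
     tau M \<in> carrier M \<rightarrow> carrier M \<and>
     (\<forall>x\<in>carrier M. \<forall>y\<in>carrier M. tau M (x \<oplus>\<^bsub>M\<^esub> y) = tau M x \<oplus>\<^bsub>M\<^esub> tau M y) \<and>
     (\<forall>a. \<forall>x\<in>carrier M. tau M (a \<odot>\<^bsub>M\<^esub> x) = poly_twist q a \<odot>\<^bsub>M\<^esub> tau M x)"

text \<open>
  An element \<open>\<Sum>\<^sub>i c\<^sub>i \<tau>\<^sup>i\<close> of \<open>K{\<tau>}\<close> is encoded by the polynomial with coefficients \<open>c\<^sub>i\<close>; only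
  its action on \<open>M\<close> is needed, so the skew multiplication of \<open>K{\<tau>}\<close> does not appear.
\<close>

definition skew_act :: "('k::field poly, 'm) tau_module \<Rightarrow> 'k poly \<Rightarrow> 'm \<Rightarrow> 'm" where
  "skew_act M P m =
     (\<Oplus>\<^bsub>M\<^esub>i\<in>{..degree P}. [:coeff P i:] \<odot>\<^bsub>M\<^esub> (tau M ^^ i) m)"

definition skew_basis ::
    "('k::field poly, 'm) tau_module \<Rightarrow> nat \<Rightarrow> (nat \<Rightarrow> 'm) \<Rightarrow> bool" where
  "skew_basis M d b \<longleftrightarrow>
     b \<in> {..<d} \<rightarrow> carrier M \<and>
     (\<forall>m\<in>carrier M. \<exists>!P. P \<in> {..<d} \<rightarrow>\<^sub>E UNIV \<and>
        m = (\<Oplus>\<^bsub>M\<^esub>j\<in>{..<d}. skew_act M (P j) (b j)))"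

definition t_motive :: "nat \<Rightarrow> 'k::field \<Rightarrow> ('k poly, 'm) tau_module \<Rightarrow> bool" where
  "t_motive q \<theta> M \<longleftrightarrow>
     skew_module q M \<and> (\<exists>d b. skew_basis M d b) \<and>
     (\<exists>l. \<forall>m\<in>carrier M.
        [:- \<theta>, 1:] ^ l \<odot>\<^bsub>M\<^esub> m \<in> module_span type_ring M (tau M ` carrier M))"

definition abelian_t_motive :: "nat \<Rightarrow> 'k::field \<Rightarrow> ('k poly, 'm) tau_module \<Rightarrow> bool" where
  "abelian_t_motive q \<theta> M \<longleftrightarrow>
     t_motive q \<theta> M \<and> finitely_generated type_ring M (carrier M)"


section \<open>Modules given by generators and relations\<close>

definition free_module :: "'g set \<Rightarrow> ('a::comm_ring_1, 'g \<Rightarrow>\<^sub>0 'a) module" where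
  "free_module G =
     \<lparr>carrier = {f. Poly_Mapping.keys f \<subseteq> G}, monoid.mult = undefined, monoid.one = undefined,
      ring.zero = 0, ring.add = (+), module.smult = (\<lambda>a f. Poly_Mapping.map (\<lambda>x. a * x) f)\<rparr>"

text \<open>The additive map \<open>\<Sum>\<^sub>g a\<^sub>g g \<mapsto> \<Sum>\<^sub>g \<sigma>(a\<^sub>g) s(g)\<close> between free modules.\<close>

definition free_semilinear ::
    "('a \<Rightarrow> 'a) \<Rightarrow> ('g \<Rightarrow> 'g) \<Rightarrow> ('g \<Rightarrow>\<^sub>0 'a::comm_ring_1) \<Rightarrow> ('g \<Rightarrow>\<^sub>0 'a)" where
  "free_semilinear \<sigma> s f =
     (\<Sum>g\<in>Poly_Mapping.keys f. Poly_Mapping.single (s g) (\<sigma> (Poly_Mapping.lookup f g)))"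

text \<open>
  The module generated by \<open>G\<close> subject to \<open>Rel\<close>, as the set of cosets of the submodule spanned by
  \<open>Rel\<close>, with scalar multiplication and \<open>\<tau>(\<Sum>\<^sub>g a\<^sub>g g) = \<Sum>\<^sub>g \<sigma>(a\<^sub>g) s(g)\<close> computed on representatives.
\<close>

definition presented_module ::
    "'g set \<Rightarrow> ('g \<Rightarrow>\<^sub>0 'a::comm_ring_1) set \<Rightarrow> ('a \<Rightarrow> 'a) \<Rightarrow> ('g \<Rightarrow> 'g) \<Rightarrow>
      ('a, ('g \<Rightarrow>\<^sub>0 'a) set) tau_module" where
  "presented_module G Rel \<sigma> s =
     (let F = free_module G; N = module_span type_ring F Rel in
      \<lparr>carrier = a_rcosets\<^bsub>F\<^esub> N, monoid.mult = undefined, monoid.one = undefined,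
       ring.zero = N, ring.add = (\<lambda>A B. A <+>\<^bsub>F\<^esub> B),
       module.smult = (\<lambda>a C. \<Union>x\<in>C. N +>\<^bsub>F\<^esub> (a \<odot>\<^bsub>F\<^esub> x)),
       tau = (\<lambda>C. \<Union>x\<in>C. N +>\<^bsub>F\<^esub> free_semilinear \<sigma> s x)\<rparr>)"


section \<open>Prolongations\<close>

text \<open>The generator \<open>(i, m)\<close> stands for the symbol \<open>D\<^sub>i m\<close>.\<close>

definition prolongation_relations ::
    "nat \<Rightarrow> ('k::field poly, 'm) tau_module \<Rightarrow> ((nat \<times> 'm) \<Rightarrow>\<^sub>0 'k poly) set" where
  "prolongation_relations k M =
     {Poly_Mapping.single (i, m1 \<oplus>\<^bsub>M\<^esub> m2) 1
        - (Poly_Mapping.single (i, m1) 1 + Poly_Mapping.single (i, m2) 1)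
      | i m1 m2. i \<le> k \<and> m1 \<in> carrier M \<and> m2 \<in> carrier M} \<union>
     {Poly_Mapping.single (i, a \<odot>\<^bsub>M\<^esub> m) 1
        - (\<Sum>(i1, i2)\<in>{(i1, i2). i1 + i2 = i}. Poly_Mapping.single (i2, m) (hyperderiv i1 a))
      | i a m. i \<le> k \<and> m \<in> carrier M}"

definition prolongation ::
    "nat \<Rightarrow> nat \<Rightarrow> ('k::field poly, 'm) tau_module \<Rightarrow>
      ('k poly, ((nat \<times> 'm) \<Rightarrow>\<^sub>0 'k poly) set) tau_module" where
  "prolongation q k M =
     presented_module ({..k} \<times> carrier M) (prolongation_relations k M)
       (poly_twist q) (\<lambda>(i, m). (i, tau M m))"


section \<open>Rigid analytic triviality and purity\<close>

definition GL_tate :: "('c::field \<Rightarrow> real) \<Rightarrow> nat \<Rightarrow> 'c fps mat set" where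
  "GL_tate v r =
     {U \<in> carrier_mat r r. elements_mat U \<subseteq> tate_algebra v \<and>
        (\<exists>W\<in>carrier_mat r r. elements_mat W \<subseteq> tate_algebra v \<and>
           U * W = 1\<^sub>m r \<and> W * U = 1\<^sub>m r)}"

text \<open>
  \<open>j\<close> is the embedding of \<open>K\<close> into \<open>C\<^sub>\<infinity>\<close> and \<open>v\<close> the absolute value on \<open>C\<^sub>\<infinity>\<close>. Existence of
  \<open>\<Upsilon>\<close> does not depend on the choice of the \<open>K[t]\<close>-basis \<open>e\<close>.
\<close>

definition rigid_analytically_trivial ::
    "nat \<Rightarrow> ('k::field \<Rightarrow> 'c::field) \<Rightarrow> ('c \<Rightarrow> real) \<Rightarrow> ('k poly, 'm) tau_module \<Rightarrow> bool" where
  "rigid_analytically_trivial q j v M \<longleftrightarrow>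
     (\<exists>r e \<Theta> \<Upsilon>. module_basis type_ring M r e \<and> \<Theta> \<in> carrier_mat r r \<and>
        (\<forall>l<r. tau M (e l) = (\<Oplus>\<^bsub>M\<^esub>h\<in>{..<r}. (\<Theta> $$ (h, l)) \<odot>\<^bsub>M\<^esub> e h)) \<and>
        \<Upsilon> \<in> GL_tate v r \<and>
        map_mat (\<lambda>a. fps_of_poly (map_poly j a)) \<Theta> * map_mat (fps_twist q) \<Upsilon> = \<Upsilon>)"

text \<open>
  \<open>M \<otimes> K((1/t))\<close> as the \<open>K((1/t))\<close>-module generated by the symbols \<open>m \<otimes> 1\<close> for \<open>m\<close> in \<open>M\<close>;
  \<open>m \<otimes> f\<close> is the multiple \<open>f \<cdot> (m \<otimes> 1)\<close>.
\<close>

definition base_change_relations ::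
    "('k::field poly, 'm) tau_module \<Rightarrow> ('m \<Rightarrow>\<^sub>0 'k fls) set" where
  "base_change_relations M =
     {Poly_Mapping.single (m1 \<oplus>\<^bsub>M\<^esub> m2) 1
        - (Poly_Mapping.single m1 1 + Poly_Mapping.single m2 1)
      | m1 m2. m1 \<in> carrier M \<and> m2 \<in> carrier M} \<union>
     {Poly_Mapping.single (a \<odot>\<^bsub>M\<^esub> m) 1 - Poly_Mapping.single m (poly_at_infinity a)
      | a m. m \<in> carrier M}"

definition base_change ::
    "nat \<Rightarrow> ('k::field poly, 'm) tau_module \<Rightarrow> ('k fls, ('m \<Rightarrow>\<^sub>0 'k fls) set) tau_module" where
  "base_change q M =
     presented_module (carrier M) (base_change_relations M) (fls_twist q) (tau M)"

text \<open>
  A \<open>K[[1/t]]\<close>-lattice is a finitely generated \<open>K[[1/t]]\<close>-submodule spanning the vector space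
  over \<open>K((1/t))\<close>; it is then free of full rank, \<open>K[[1/t]]\<close> being a discrete valuation ring.
\<close>

definition is_lattice :: "('k::field fls, 'v) tau_module \<Rightarrow> 'v set \<Rightarrow> bool" where
  "is_lattice V H \<longleftrightarrow>
     submodule H inverse_t_series V \<and> finitely_generated inverse_t_series V H \<and>
     module_span type_ring V H = carrier V"

definition pure_of_weight :: "nat \<Rightarrow> ('k::field poly, 'm) tau_module \<Rightarrow> rat \<Rightarrow> bool" where
  "pure_of_weight q M w \<longleftrightarrow>
     (let V = base_change q M in
      \<exists>H u v. is_lattice V H \<and> u \<ge> 1 \<and> v \<ge> 1 \<and>
        (\<lambda>h. fls_X_inv ^ u \<odot>\<^bsub>V\<^esub> h) ` H = module_span inverse_t_series V ((tau V ^^ v) ` H) \<and>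
        w = of_nat u / of_nat v)"

end

theory Submission
  imports Defs
begin

text \<open>
  The hyperderivatives \<open>\<partial>\<^sup>(\<^sup>n\<^sup>)\<close> are the coefficients of the Taylor homomorphism
  \<open>a(t) \<mapsto> a(t + \<epsilon>) = \<Sum>\<^sub>n \<partial>\<^sup>(\<^sup>n\<^sup>)(a) \<epsilon>\<^sup>n\<close>, and \<open>\<rho>\<^sub>k M\<close> carries the universal additive maps \<open>D\<^sub>0, \<dots>, D\<^sub>k\<close>
  satisfying the Leibniz rule over it. Both assertions hold because \<open>\<partial>\<^sup>(\<^sup>n\<^sup>)\<close> obeys the Leibniz rule on
  every ring that occurs, namely \<open>K[t]\<close>, the Tate algebra and \<open>K((1/t))\<close>, and because it commutes with
  the \<open>q\<close>-th power twist: up to a shift of degrees it multiplies coefficients by elements of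
  the prime field, which the Frobenius fixes.

  For rigid analytic triviality, let \<open>e\<close> be a basis of \<open>M\<close> and \<open>\<Theta>\<close> its matrix. The elements
  \<open>D\<^sub>i e\<^sub>j\<close> form a basis of \<open>\<rho>\<^sub>k M\<close> (\<open>prolonged_e_basis\<close>): they generate by the Leibniz rule, and
  independence is read off from the functionals \<open>D\<^sub>i m \<mapsto> \<partial>\<^sup>(\<^sup>i\<^sup>-\<^sup>s\<^sup>)(j-th coordinate of m)\<close>, which respect the
  relations. In this basis \<open>\<tau>\<close> is given by the block upper triangular Toeplitz matrix of
  hyperderivatives of \<open>\<Theta>\<close>. Forming such matrices (\<open>prolong_mat\<close>) is multiplicative, since it is the Taylor
  homomorphism with \<open>\<epsilon>\<close> represented by a nilpotent shift; so it turns \<open>\<Theta> \<Upsilon>\<^sup>\<tau> = \<Upsilon>\<close> and the inverse of \<open>\<Upsilon>\<close> into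
  the corresponding data for \<open>\<rho>\<^sub>k M\<close>. The entries stay in the Tate algebra because that algebra
  consists of the series whose coefficients tend to zero, and integers have absolute value at most 1.

  For purity no basis is needed. The maps \<open>D\<^sub>i\<close> extend to \<open>D\<^sub>i : M \<otimes> K((1/t)) \<rightarrow> \<rho>\<^sub>k M \<otimes> K((1/t))\<close>,
  commuting with \<open>\<tau>\<close>. Given a lattice \<open>H\<close> with \<open>t\<^sup>u H = \<langle>\<tau>\<^sup>v H\<rangle>\<close>, the lattice \<open>H' = \<langle>D\<^sub>i H\<rangle>\<close> works with the
  same \<open>u\<close> and \<open>v\<close> (\<open>prolong_pure\<close>): as \<open>\<partial>\<^sup>(\<^sup>n\<^sup>)(t\<^sup>u)\<close> is an integral multiple of \<open>t\<^sup>u\<close>, the two families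
  \<open>D\<^sub>i (t\<^sup>u h)\<close> and \<open>t\<^sup>u D\<^sub>i h\<close> differ by a unitriangular integral matrix.
\<close>


section \<open>Coefficientwise powers\<close>

(* In this part the infix $$ denotes coefficients of Laurent series. *)
no_notation index_mat (infixl "$$" 100)
unbundle fps_syntax

text \<open>
  This hypothesis on a field says that \<open>x \<mapsto> x\<^sup>q\<close> is a ring endomorphism. It is all that the twists need,
  and it avoids writing \<open>q\<close> as a power of the characteristic.
\<close>

locale frobenius_power =
  fixes q :: nat and K :: "'a::field itself"
  assumes q_pos: "0 < q"
    and add_power: "\<And>x y :: 'a. (x + y) ^ q = x ^ q + y ^ q"
begin

lemma minus_power: "(- x :: 'a) ^ q = - (x ^ q)"
proof -
  have "(x + - x) ^ q = x ^ q + (- x) ^ q" by (rule add_power)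
  hence "(- x) ^ q + x ^ q = 0" using q_pos by (metis add.commute add.right_inverse power_0_left less_irrefl)
  thus ?thesis by (simp only: eq_neg_iff_add_eq_0)
qed

lemma sum_power: "(\<Sum>i\<in>A. f i :: 'a) ^ q = (\<Sum>i\<in>A. f i ^ q)"
  by (induction A rule: infinite_finite_induct) (use q_pos in \<open>auto simp: add_power\<close>)

text \<open>
  The Frobenius fixes the prime field. This is why the twists commute with hyperderivatives.
\<close>

lemma of_int_power: "(of_int n :: 'a) ^ q = of_int n"
  by (induction n rule: int_induct[where k = 0])
     (use q_pos in \<open>auto simp: add_power diff_conv_add_uminus minus_power simp del: add_uminus_conv_diff\<close>)

lemma of_nat_power: "(of_nat n :: 'a) ^ q = of_nat n"
  using of_int_power[of "int n"] by simp

lemma poly_twist_coeff: "coeff (poly_twist q a) i = (coeff a i :: 'a) ^ q"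
  using q_pos by (simp add: poly_twist_def coeff_map_poly)

lemma poly_twist_add: "poly_twist q (a + b) = poly_twist q a + poly_twist q (b :: 'a poly)"
  by (rule poly_eqI) (simp add: poly_twist_coeff add_power)

lemma poly_twist_mult: "poly_twist q (a * b) = poly_twist q a * poly_twist q (b :: 'a poly)"
  by (rule poly_eqI) (simp add: poly_twist_coeff coeff_mult sum_power power_mult_distrib)

lemma poly_twist_1: "poly_twist q (1 :: 'a poly) = 1"
  by (rule poly_eqI) (use q_pos in \<open>auto simp: poly_twist_coeff\<close>)

lemma fls_twist_nth: "fls_twist q f $$ i = (f $$ i :: 'a) ^ q"
  unfolding fls_twist_def
  by (rule nth_Abs_fls_lower_bound[of "fls_subdegree f"]) (use q_pos in auto)

end

text \<open>
  The polynomial \<open>(X + 1)\<^sup>q - X\<^sup>q - 1\<close> has degree below \<open>q\<close> and vanishes on the field with \<open>q\<close> elements,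
  since \<open>x\<^sup>q = x\<close> there. So it is zero, and its coefficients are these binomial coefficients.
\<close>

lemma binomial_CARD_eq_0:
  assumes "0 < i" "i < CARD('f)"
  shows "(of_nat (CARD('f) choose i) :: 'f::finite_field) = 0"
proof -
  define q where "q = CARD('f)"
  define P :: "'f poly" where "P = (\<Sum>i\<in>{0<..<q}. monom (of_nat (q choose i)) i)"
  have coeff_P: "coeff P i = (if 0 < i \<and> i < q then of_nat (q choose i) else 0)" for i
    by (auto simp: P_def coeff_sum)
  have q2: "0 < q" by (simp add: q_def)
  have "poly P x = 0" for x
  proof -
    have "(x + 1) ^ q = (\<Sum>i\<le>q. of_nat (q choose i) * x ^ i)"
      by (subst binomial_ring) simp
    also have "{..q} = insert 0 (insert q {0<..<q})" using q2 by auto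
    also have "(\<Sum>i\<in>insert 0 (insert q {0<..<q}). of_nat (q choose i) * x ^ i) = 1 + (x ^ q + poly P x)"
      using q2 by (simp add: P_def poly_sum poly_monom)
    finally have "x + 1 = 1 + (x + poly P x)"
      by (simp add: q_def finite_field_power_card_eq_same)
    thus ?thesis by simp
  qed
  hence roots: "{x. poly P x = 0} = UNIV" by auto
  have "P = 0"
  proof (rule ccontr)
    assume P: "P \<noteq> 0"
    \<comment> \<open>All \<open>q\<close> elements of the field are roots.\<close>
    have "q \<le> degree P"
      using card_poly_roots_bound[OF P] by (simp add: roots q_def)
    moreover have "degree P < q"
      by (rule degree_lessI) (use P coeff_P q2 in auto)
    ultimately show False by simp
  qed
  thus ?thesis using coeff_P[of i] assms by (simp add: q_def)
qed

lemma frobenius_power_CARD: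
  assumes "field_hom (\<iota> :: 'f::finite_field poly fract \<Rightarrow> 'a::field)"
  shows "frobenius_power TYPE('a) CARD('f)"
proof
  interpret \<iota>: field_hom \<iota> by fact
  show "0 < CARD('f)" by simp
  fix x y :: 'a
  have 0: "(of_nat (CARD('f) choose i) :: 'a) = 0" if "0 < i" "i < CARD('f)" for i
  proof -
    have "(of_nat (CARD('f) choose i) :: 'a) = \<iota> (Fract (of_nat (CARD('f) choose i)) 1)"
      by (simp add: of_nat_fract [symmetric] \<iota>.hom_of_nat)
    also have "(of_nat (CARD('f) choose i) :: 'f poly) = [:of_nat (CARD('f) choose i):]"
      by (simp add: of_nat_poly)
    also have "\<dots> = 0" using binomial_CARD_eq_0[OF that] by simp
    finally show ?thesis by (simp add: Zero_fract_def [symmetric])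
  qed
  have "(x + y) ^ CARD('f) = (\<Sum>i\<le>CARD('f). of_nat (CARD('f) choose i) * x ^ i * y ^ (CARD('f) - i))"
    by (rule binomial_ring)
  also have "\<dots> = (\<Sum>i\<in>{0, CARD('f)}. of_nat (CARD('f) choose i) * x ^ i * y ^ (CARD('f) - i))"
    by (rule sum.mono_neutral_right) (auto intro!: 0)
  also have "\<dots> = x ^ CARD('f) + y ^ CARD('f)" by simp
  finally show "(x + y) ^ CARD('f) = x ^ CARD('f) + y ^ CARD('f)" .
qed


section \<open>Hyperderivatives of Laurent series, power series and polynomials\<close>

text \<open>
  The Cauchy product over a freely chosen index set; bounds in terms of the subdegrees would not
  transform well under operators that shift the degree and may kill leading terms.
\<close>

lemma fls_times_nth_support:
  fixes f g :: "'a::semiring_0 fls"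
  assumes "finite S" "{i. f $$ i \<noteq> 0 \<and> g $$ (N - i) \<noteq> 0} \<subseteq> S"
  shows "(f * g) $$ N = (\<Sum>i\<in>S. f $$ i * g $$ (N - i))"
proof -
  have sub: "{i. f $$ i \<noteq> 0 \<and> g $$ (N - i) \<noteq> 0} \<subseteq> {fls_subdegree f..N - fls_subdegree g}"
    by (force simp: not_less[symmetric])
  have "(f * g) $$ N = (\<Sum>i\<in>{fls_subdegree f..N - fls_subdegree g}. f $$ i * g $$ (N - i))"
    by (rule fls_times_nth(2))
  also have "\<dots> = (\<Sum>i\<in>{i. f $$ i \<noteq> 0 \<and> g $$ (N - i) \<noteq> 0}. f $$ i * g $$ (N - i))"
    by (rule sum.mono_neutral_right) (use sub in auto)
  also have "\<dots> = (\<Sum>i\<in>S. f $$ i * g $$ (N - i))"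
    by (rule sum.mono_neutral_left) (use assms in auto)
  finally show ?thesis .
qed

text \<open>
  The binomial coefficient with an integer upper argument, for the exponents of Laurent series. Its value
  has to be an integer in order to be mapped into a field of positive characteristic, where the
  generalised binomial coefficient, a quotient by \<open>n!\<close>, makes no sense.
\<close>

definition int_choose :: "int \<Rightarrow> nat \<Rightarrow> int" where
  "int_choose m n =
     (if 0 \<le> m then int (nat m choose n) else (- 1) ^ n * int ((nat (- m) + n - 1) choose n))"

lemma int_choose_of_nat: "int_choose (int m) n = int (m choose n)"
  by (simp add: int_choose_def)

lemma of_int_int_choose: "(of_int (int_choose m n) :: rat) = of_int m gchoose n"
proof (cases "0 \<le> m")
  case True
  then obtain i where "m = int i" by (metis nonneg_int_cases)
  thus ?thesis by (simp add: int_choose_of_nat binomial_gbinomial)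
next
  case False
  then obtain i where i: "m = - int (Suc i)" by (metis neg_int_cases not_le gr0_implies_Suc)
  have "(of_int m gchoose n :: rat) = (- 1) ^ n * ((of_nat n - of_int m - 1) gchoose n)"
    by (rule gbinomial_negated_upper)
  also have "(of_nat n - of_int m - 1 :: rat) = of_nat (i + n)"
    by (simp add: i)
  also have "(of_nat (i + n) gchoose n :: rat) = of_nat ((i + n) choose n)"
    by (rule binomial_gbinomial [symmetric])
  finally show ?thesis
    by (simp add: i int_choose_def nat_add_distrib)
qed

lemma int_choose_0 [simp]: "int_choose m 0 = 1"
  by (simp add: int_choose_def)

text \<open>
  The Vandermonde identity of rational generalised binomial coefficients, as both sides are integers.
\<close>

lemma int_choose_Vandermonde:
  "(\<Sum>k\<le>n. int_choose a k * int_choose b (n - k)) = int_choose (a + b) n"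
proof -
  have "(of_int (\<Sum>k\<le>n. int_choose a k * int_choose b (n - k)) :: rat) = of_int (int_choose (a + b) n)"
    using gbinomial_Vandermonde[of "of_int a :: rat" "of_int b" n]
    by (simp add: of_int_int_choose atMost_atLeast0)
  thus ?thesis by (simp only: of_int_eq_iff)
qed

text \<open>
  The hyperderivative with respect to \<open>X\<^sup>e\<close>, for \<open>e = \<plusminus>1\<close>: it sends \<open>X\<^sup>m\<close>, which is \<open>(X\<^sup>e)\<^bsup>em\<^esup>\<close>, to
  \<open>(em choose n) X\<^bsup>m - en\<^esup>\<close>. For \<open>e = 1\<close> it acts on power series in \<open>t = X\<close>, and for \<open>e = -1\<close> on
  \<open>K((1/t))\<close> with \<open>t = X\<^sup>-\<^sup>1\<close>. Treating both signs at once gives a single Leibniz rule.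
\<close>

definition fls_hyperderiv :: "int \<Rightarrow> nat \<Rightarrow> 'a::field fls \<Rightarrow> 'a fls" where
  "fls_hyperderiv e n f =
     Abs_fls (\<lambda>N. of_int (int_choose (e * (N + e * int n)) n) * f $$ (N + e * int n))"

lemma fls_hyperderiv_nth:
  "fls_hyperderiv e n f $$ N = of_int (int_choose (e * (N + e * int n)) n) * f $$ (N + e * int n)"
  unfolding fls_hyperderiv_def
  by (rule nth_Abs_fls_lower_bound[of "fls_subdegree f - e * int n"]) auto

lemma fls_hyperderiv_0 [simp]: "fls_hyperderiv e 0 f = f"
  by (rule fls_eqI) (simp add: fls_hyperderiv_nth)

lemma fls_hyperderiv_add: "fls_hyperderiv e n (f + g) = fls_hyperderiv e n f + fls_hyperderiv e n g"
  by (rule fls_eqI) (simp add: fls_hyperderiv_nth algebra_simps)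

text \<open>
  The coefficients of \<open>f\<close> at \<open>i\<close> and of \<open>g\<close> at \<open>T - i\<close> meet on the right with the total factor
  \<open>\<Sum>\<^sub>a (ei choose a) (e(T - i) choose n - a)\<close>, which is \<open>(eT choose n)\<close> by Vandermonde.
\<close>

lemma fls_hyperderiv_mult:
  "fls_hyperderiv e n (f * g) = (\<Sum>a\<le>n. fls_hyperderiv e a f * fls_hyperderiv e (n - a) g)"
proof (rule fls_eqI)
  fix N
  define T where "T = N + e * int n"
  define S where "S = {fls_subdegree f..T - fls_subdegree g}"
  have "(\<Sum>a\<le>n. fls_hyperderiv e a f * fls_hyperderiv e (n - a) g) $$ N =
      (\<Sum>a\<le>n. (fls_hyperderiv e a f * fls_hyperderiv e (n - a) g) $$ N)"
    by (rule fls_nth_sum)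
  also have "\<dots> = (\<Sum>a\<le>n. \<Sum>i\<in>S. f $$ i * g $$ (T - i) * of_int (int_choose (e * i) a * int_choose (e * (T - i)) (n - a)))"
  proof (rule sum.cong[OF refl])
    fix a assume "a \<in> {..n}"
    hence a: "int (n - a) = int n - int a" by auto
    have "(fls_hyperderiv e a f * fls_hyperderiv e (n - a) g) $$ N =
        (\<Sum>j\<in>(\<lambda>i. i - e * int a) ` S. fls_hyperderiv e a f $$ j * fls_hyperderiv e (n - a) g $$ (N - j))"
    proof (rule fls_times_nth_support)
      show "finite ((\<lambda>i. i - e * int a) ` S)" by (simp add: S_def)
      show "{j. fls_hyperderiv e a f $$ j \<noteq> 0 \<and> fls_hyperderiv e (n - a) g $$ (N - j) \<noteq> 0}
          \<subseteq> (\<lambda>i. i - e * int a) ` S"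
      proof
        fix j assume "j \<in> {j. fls_hyperderiv e a f $$ j \<noteq> 0 \<and> fls_hyperderiv e (n - a) g $$ (N - j) \<noteq> 0}"
        hence "f $$ (j + e * int a) \<noteq> 0" "g $$ (T - (j + e * int a)) \<noteq> 0"
          by (auto simp: fls_hyperderiv_nth T_def a algebra_simps)
        hence "j + e * int a \<in> S"
          unfolding S_def by (force simp: not_less[symmetric])
        thus "j \<in> (\<lambda>i. i - e * int a) ` S" by (rule rev_image_eqI) simp
      qed
    qed
    also have "\<dots> = (\<Sum>i\<in>S. fls_hyperderiv e a f $$ (i - e * int a) * fls_hyperderiv e (n - a) g $$ (N - (i - e * int a)))"
      by (subst sum.reindex) (auto simp: inj_on_def)
    also have "\<dots> = (\<Sum>i\<in>S. f $$ i * g $$ (T - i) * of_int (int_choose (e * i) a * int_choose (e * (T - i)) (n - a)))"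
    proof (rule sum.cong[OF refl])
      fix i
      have "N - (i - e * int a) + e * int (n - a) = T - i"
        by (simp add: T_def a algebra_simps)
      thus "fls_hyperderiv e a f $$ (i - e * int a) * fls_hyperderiv e (n - a) g $$ (N - (i - e * int a)) =
          f $$ i * g $$ (T - i) * of_int (int_choose (e * i) a * int_choose (e * (T - i)) (n - a))"
        by (simp only: fls_hyperderiv_nth) (simp add: mult_ac)
    qed
    finally show "(fls_hyperderiv e a f * fls_hyperderiv e (n - a) g) $$ N =
        (\<Sum>i\<in>S. f $$ i * g $$ (T - i) * of_int (int_choose (e * i) a * int_choose (e * (T - i)) (n - a)))" .
  qed
  also have "\<dots> = (\<Sum>i\<in>S. f $$ i * g $$ (T - i) * of_int (\<Sum>a\<le>n. int_choose (e * i) a * int_choose (e * (T - i)) (n - a)))"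
    by (subst sum.swap) (simp add: sum_distrib_left)
  also have "\<dots> = (\<Sum>i\<in>S. f $$ i * g $$ (T - i) * of_int (int_choose (e * T) n))"
    by (simp only: int_choose_Vandermonde) (simp add: algebra_simps)
  also have "\<dots> = of_int (int_choose (e * T) n) * (f * g) $$ T"
    by (simp add: fls_times_nth(2) S_def sum_distrib_left mult_ac)
  also have "\<dots> = fls_hyperderiv e n (f * g) $$ N"
    by (simp add: fls_hyperderiv_nth T_def)
  finally show "fls_hyperderiv e n (f * g) $$ N =
      (\<Sum>a\<le>n. fls_hyperderiv e a f * fls_hyperderiv e (n - a) g) $$ N" ..
qed

lemma in_range_fps_to_fls_iff: "f \<in> range fps_to_fls \<longleftrightarrow> (\<forall>i<0. f $$ i = 0)"
proof
  assume "\<forall>i<0. f $$ i = 0"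
  hence "f = fps_to_fls (fls_regpart f)" by (intro fls_eqI) auto
  thus "f \<in> range fps_to_fls" by blast
qed auto

text \<open>
  With respect to \<open>t\<close>, hyperderivatives raise the order in \<open>1/t\<close>.
\<close>

lemma fls_hyperderiv_integral:
  assumes "f \<in> range fps_to_fls"
  shows "fls_hyperderiv (-1) n f \<in> range fps_to_fls"
  using assms unfolding in_range_fps_to_fls_iff by (simp add: fls_hyperderiv_nth)

text \<open>
  Here \<open>fls_X_inv ^ u\<close> is \<open>t\<^sup>u\<close>, and \<open>\<partial>\<^sup>(\<^sup>n\<^sup>)(t\<^sup>u) = t\<^sup>u \<cdot> (u choose n) t\<^bsup>-n\<^esup>\<close>.
\<close>

lemma fls_hyperderiv_X_inv_power:
  "\<exists>c\<in>range fps_to_fls. fls_hyperderiv (-1) n (fls_X_inv ^ u :: 'a::field fls) = fls_X_inv ^ u * c"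
proof
  let ?d = "fls_hyperderiv (-1) n (fls_X_inv ^ u :: 'a fls)"
  show "?d = fls_X_inv ^ u * (fls_X ^ u * ?d)"
    by (simp add: fls_X_inv_power_times_conv_shift fls_X_power_times_conv_shift)
  show "fls_X ^ u * ?d \<in> range fps_to_fls"
    by (auto simp: in_range_fps_to_fls_iff fls_X_power_times_conv_shift fls_hyperderiv_nth
        fls_X_inv_power_conv_shift_1)
qed

definition fps_hyperderiv :: "nat \<Rightarrow> 'a::field fps \<Rightarrow> 'a fps" where
  "fps_hyperderiv n f = Abs_fps (\<lambda>i. of_nat ((i + n) choose n) * fps_nth f (i + n))"

text \<open>
  Truncation of negative exponents does no harm: \<open>(m choose n) = 0\<close> for \<open>m < n\<close>.
\<close>

lemma fps_to_fls_hyperderiv: "fps_to_fls (fps_hyperderiv n f) = fls_hyperderiv 1 n (fps_to_fls f)"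
proof (rule fls_eqI)
  fix N :: int
  show "fps_to_fls (fps_hyperderiv n f) $$ N = fls_hyperderiv 1 n (fps_to_fls f) $$ N"
  proof (cases "N < 0")
    case False
    then obtain i where N: "N = int i" by (metis nonneg_int_cases not_less)
    have "int_choose (int i + int n) n = int ((i + n) choose n)"
      using int_choose_of_nat[of "i + n" n] by simp
    thus ?thesis by (simp add: N fls_hyperderiv_nth fps_hyperderiv_def nat_add_distrib)
  next
    case True
    show ?thesis
    proof (cases "N + int n < 0")
      case False
      define m where "m = nat (N + int n)"
      have m: "N + int n = int m" "m < n" using False True by (auto simp: m_def)
      have "int_choose (int m) n = 0" using m by (simp add: int_choose_of_nat)
      thus ?thesis using True m by (simp add: fls_hyperderiv_nth)
    qed (use True in \<open>simp add: fls_hyperderiv_nth\<close>)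
  qed
qed

lemma fps_to_fls_sum: "fps_to_fls (sum f A) = (\<Sum>i\<in>A. fps_to_fls (f i))"
  by (induction A rule: infinite_finite_induct) auto

lemma fps_hyperderiv_mult:
  "fps_hyperderiv n (f * g) = (\<Sum>a\<le>n. fps_hyperderiv a f * fps_hyperderiv (n - a) g)"
proof -
  have "fps_to_fls (fps_hyperderiv n (f * g)) =
      fps_to_fls (\<Sum>a\<le>n. fps_hyperderiv a f * fps_hyperderiv (n - a) g)"
    by (simp add: fps_to_fls_hyperderiv fps_to_fls_sum fls_times_fps_to_fls fls_hyperderiv_mult)
  thus ?thesis by (simp only: fps_to_fls_eq_iff)
qed

lemma fps_hyperderiv_sum: "fps_hyperderiv n (sum f A) = (\<Sum>i\<in>A. fps_hyperderiv n (f i))"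
  by (rule fps_ext) (simp add: fps_hyperderiv_def fps_sum_nth sum_distrib_left)

lemma fps_hyperderiv_0 [simp]: "fps_hyperderiv 0 f = f"
  by (rule fps_ext) (simp add: fps_hyperderiv_def)

lemma fps_hyperderiv_const: "fps_hyperderiv n (fps_const c) = (if n = 0 then fps_const c else 0)"
  by (rule fps_ext) (auto simp: fps_hyperderiv_def)

lemma coeff_hyperderiv: "coeff (hyperderiv n a) m = of_nat ((m + n) choose n) * coeff a (m + n)"
proof -
  have "coeff (hyperderiv n a) m =
      (\<Sum>i\<le>degree a. if i - n = m then of_nat (i choose n) * coeff a i else 0)"
    by (simp add: hyperderiv_def coeff_sum)
  also have "\<dots> = (\<Sum>i\<le>degree a. if i = m + n then of_nat (i choose n) * coeff a i else 0)"
  proof (rule sum.cong[OF refl])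
    fix i
    show "(if i - n = m then of_nat (i choose n) * coeff a i else 0) =
        (if i = m + n then of_nat (i choose n) * coeff a i else 0)"
      by (cases "i < n") (auto simp: binomial_eq_0)
  qed
  also have "\<dots> = of_nat ((m + n) choose n) * coeff a (m + n)"
    by (auto simp: coeff_eq_0)
  finally show ?thesis .
qed

lemma fps_of_poly_hyperderiv: "fps_of_poly (hyperderiv n a) = fps_hyperderiv n (fps_of_poly a)"
  by (rule fps_ext) (simp add: coeff_hyperderiv fps_hyperderiv_def)

lemma hyperderiv_0 [simp]: "hyperderiv 0 a = a"
  by (rule poly_eqI) (simp add: coeff_hyperderiv)

lemma hyperderiv_add: "hyperderiv n (a + b) = hyperderiv n a + hyperderiv n b"
  by (rule poly_eqI) (simp add: coeff_hyperderiv algebra_simps)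

lemma hyperderiv_mult:
  "hyperderiv n (a * b) = (\<Sum>i\<le>n. hyperderiv i a * hyperderiv (n - i) b)"
proof -
  have "fps_of_poly (hyperderiv n (a * b)) =
      fps_of_poly (\<Sum>i\<le>n. hyperderiv i a * hyperderiv (n - i) b)"
    by (simp add: fps_of_poly_hyperderiv fps_of_poly_mult fps_of_poly_sum fps_hyperderiv_mult)
  thus ?thesis by (simp only: fps_of_poly_eq_iff)
qed

lemma hyperderiv_1: "hyperderiv n 1 = (if n = 0 then 1 else 0)"
  by (rule poly_eqI) (auto simp: coeff_hyperderiv)

lemma map_poly_hyperderiv:
  assumes "field_hom j"
  shows "map_poly j (hyperderiv n a) = hyperderiv n (map_poly j a)"
proof -
  interpret j: field_hom j by fact
  show ?thesis by (rule poly_eqI) (simp add: coeff_map_poly coeff_hyperderiv j.hom_mult j.hom_of_nat)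
qed

text \<open>
  Substituting \<open>t = X\<^sup>-\<^sup>1\<close> reverses the order of the coefficients.
\<close>

lemma poly_at_infinity_nth: "poly_at_infinity a $$ m = (if m \<le> 0 then coeff a (nat (- m)) else 0)"
proof (induction a arbitrary: m)
  case 0
  thus ?case by (simp add: poly_at_infinity_def)
next
  case (pCons c a)
  have "poly_at_infinity (pCons c a) = fls_const c + fls_X_inv * poly_at_infinity a"
    by (cases "c = 0 \<and> a = 0") (auto simp: poly_at_infinity_def map_poly_pCons)
  moreover have "coeff (pCons c a) (nat (- m)) = coeff a (nat (- m - 1))" if "m < 0"
  proof -
    have "nat (- m) = Suc (nat (- m - 1))" using that by simp
    thus ?thesis by simp
  qed
  moreover have "(fls_X_inv * poly_at_infinity a) $$ m = poly_at_infinity a $$ (m + 1)"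
    by (simp add: fls_X_inv_times_conv_shift)
  ultimately show ?case
    using pCons.IH[of "m + 1"] by (auto simp: not_le)
qed

lemma poly_at_infinity_1: "poly_at_infinity 1 = 1"
  by (rule fls_eqI) (auto simp: poly_at_infinity_nth)

lemma poly_at_infinity_0: "poly_at_infinity 0 = 0"
  by (rule fls_eqI) (auto simp: poly_at_infinity_nth)

lemma poly_at_infinity_hyperderiv:
  "poly_at_infinity (hyperderiv n a) = fls_hyperderiv (-1) n (poly_at_infinity a)"
proof (rule fls_eqI)
  fix m :: int
  show "poly_at_infinity (hyperderiv n a) $$ m = fls_hyperderiv (-1) n (poly_at_infinity a) $$ m"
  proof (cases "m \<le> 0")
    case True
    then obtain i where m: "m = - int i" by (metis nonpos_int_cases)
    have "int_choose (int i + int n) n = int ((i + n) choose n)"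
      using int_choose_of_nat[of "i + n" n] by simp
    thus ?thesis
      by (simp add: m fls_hyperderiv_nth poly_at_infinity_nth coeff_hyperderiv nat_add_distrib add.commute)
  next
    case False
    show ?thesis
    proof (cases "m - int n \<le> 0")
      case True
      define i where "i = nat (int n - m)"
      have i: "m - int n = - int i" "i < n" using True False by (auto simp: i_def)
      have "int_choose (int i) n = 0" using i by (simp add: int_choose_of_nat)
      thus ?thesis using False i by (simp add: fls_hyperderiv_nth poly_at_infinity_nth)
    qed (use False in \<open>simp add: fls_hyperderiv_nth poly_at_infinity_nth\<close>)
  qed
qed

lemma fls_hyperderiv_one: "fls_hyperderiv (-1) n 1 = (if n = 0 then 1 else 0)"
  using poly_at_infinity_hyperderiv[of n 1] by (simp add: hyperderiv_1 poly_at_infinity_1 poly_at_infinity_0 split: if_splits)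

context frobenius_power
begin

lemma fls_twist_add: "fls_twist q (f + g) = fls_twist q f + fls_twist q (g :: 'a fls)"
  by (rule fls_eqI) (simp add: fls_twist_nth add_power)

lemma fls_twist_mult: "fls_twist q (f * g) = fls_twist q f * fls_twist q (g :: 'a fls)"
proof (rule fls_eqI)
  fix N
  have "(fls_twist q f * fls_twist q g) $$ N =
      (\<Sum>i\<in>{fls_subdegree f..N - fls_subdegree g}. fls_twist q f $$ i * fls_twist q g $$ (N - i))"
    by (rule fls_times_nth_support)
       (use q_pos in \<open>force simp: not_less[symmetric] fls_twist_nth\<close>)+
  thus "fls_twist q (f * g) $$ N = (fls_twist q f * fls_twist q g) $$ N"
    by (simp add: fls_twist_nth fls_times_nth(2) sum_power power_mult_distrib)
qed

lemma fls_twist_1: "fls_twist q (1 :: 'a fls) = 1"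
  by (rule fls_eqI) (use q_pos in \<open>auto simp: fls_twist_nth\<close>)

lemma fls_twist_hyperderiv:
  "fls_twist q (fls_hyperderiv e n f) = fls_hyperderiv e n (fls_twist q (f :: 'a fls))"
  by (rule fls_eqI) (simp add: fls_twist_nth fls_hyperderiv_nth power_mult_distrib of_int_power)

lemma fls_twist_integral:
  "f \<in> range fps_to_fls \<Longrightarrow> fls_twist q (f :: 'a fls) \<in> range fps_to_fls"
  using q_pos by (simp add: in_range_fps_to_fls_iff fls_twist_nth)

lemma poly_twist_hyperderiv:
  "poly_twist q (hyperderiv n a) = hyperderiv n (poly_twist q (a :: 'a poly))"
  by (rule poly_eqI) (simp add: poly_twist_coeff coeff_hyperderiv power_mult_distrib of_nat_power)

lemma fls_twist_poly_at_infinity: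
  "fls_twist q (poly_at_infinity (a :: 'a poly)) = poly_at_infinity (poly_twist q a)"
  by (rule fls_eqI) (use q_pos in \<open>simp add: fls_twist_nth poly_at_infinity_nth poly_twist_coeff\<close>)

lemma fps_twist_hyperderiv:
  "fps_twist q (fps_hyperderiv n f) = fps_hyperderiv n (fps_twist q (f :: 'a fps))"
  by (rule fps_ext) (simp add: fps_twist_def fps_hyperderiv_def power_mult_distrib of_nat_power)

end

unbundle no fps_syntax
notation index_mat (infixl "$$" 100)


section \<open>Modules given by generators and relations\<close>

lemma type_ring_simps [simp]:
  "carrier type_ring = UNIV" "x \<otimes>\<^bsub>type_ring\<^esub> y = x * y" "x \<oplus>\<^bsub>type_ring\<^esub> y = x + y"
  "\<one>\<^bsub>type_ring\<^esub> = 1" "\<zero>\<^bsub>type_ring\<^esub> = 0"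
  by (simp_all add: ring_of_type_algebra_def)

text \<open>
  The carrier is one of the intersected submodules, so the intersection is not over the empty family.
\<close>

lemma module_span_submodule:
  assumes "module R V" "S \<subseteq> carrier V"
  shows "submodule (module_span R V S) R V"
proof -
  interpret module R V by fact
  have car: "carrier V \<in> {N. submodule N R V \<and> S \<subseteq> N}"
    using assms carrier_is_submodule by auto
  show ?thesis
    unfolding module_span_def
  proof (rule submoduleI)
    show "\<Inter> {N. submodule N R V \<and> S \<subseteq> N} \<subseteq> carrier V" using car by blast
    show "\<zero>\<^bsub>V\<^esub> \<in> \<Inter> {N. submodule N R V \<and> S \<subseteq> N}"
      using subgroup.one_closed[OF submodule.axioms(1)] by fastforce
  qed (auto intro: submoduleE)
qed

lemma module_span_superset: "S \<subseteq> module_span R V S"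
  by (auto simp: module_span_def)

lemma module_span_mem: "x \<in> S \<Longrightarrow> x \<in> module_span R V S"
  by (rule subsetD[OF module_span_superset])

lemma module_span_least: "submodule N R V \<Longrightarrow> S \<subseteq> N \<Longrightarrow> module_span R V S \<subseteq> N"
  by (auto simp: module_span_def)

lemma (in module) submodule_zero: "submodule N R M \<Longrightarrow> \<zero>\<^bsub>M\<^esub> \<in> N"
  using subgroup.one_closed[OF submodule.axioms(1)] by fastforce

lemma (in module) submodule_finsum:
  assumes "submodule N R M" "finite A" "\<And>i. i \<in> A \<Longrightarrow> f i \<in> N"
  shows "(\<Oplus>\<^bsub>M\<^esub>i\<in>A. f i) \<in> N"
  using assms(2,3)
proof (induction A rule: finite_induct)
  case empty
  thus ?case using submodule_zero[OF assms(1)] by simp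
next
  case (insert i A)
  note sub = submoduleE(1)[OF assms(1)]
  have "f \<in> A \<rightarrow> carrier M" "f i \<in> carrier M" using insert.prems sub by auto
  hence "(\<Oplus>\<^bsub>M\<^esub>i\<in>insert i A. f i) = f i \<oplus>\<^bsub>M\<^esub> (\<Oplus>\<^bsub>M\<^esub>i\<in>A. f i)"
    using insert.hyps by (simp add: M.finsum_insert)
  thus ?case using insert submoduleE(5)[OF assms(1)] by simp
qed

definition scale :: "'a::comm_ring_1 \<Rightarrow> ('g \<Rightarrow>\<^sub>0 'a) \<Rightarrow> ('g \<Rightarrow>\<^sub>0 'a)" where
  "scale a = Poly_Mapping.map (\<lambda>x. a * x)"

lemma lookup_scale: "Poly_Mapping.lookup (scale a f) g = a * Poly_Mapping.lookup f g"
  by (simp add: scale_def Poly_Mapping.map.rep_eq when_def)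

lemma scale_add: "scale a (f + g) = scale a f + scale a g"
  by (rule poly_mapping_eqI) (simp add: lookup_scale lookup_add algebra_simps)

lemma scale_single: "scale a (Poly_Mapping.single g b) = Poly_Mapping.single g (a * b)"
  by (rule poly_mapping_eqI) (simp add: lookup_scale lookup_single when_def)

lemma scale_0_right [simp]: "scale a 0 = 0"
  by (rule poly_mapping_eqI) (simp add: lookup_scale)

lemma scale_sum: "scale a (\<Sum>i\<in>A. f i) = (\<Sum>i\<in>A. scale a (f i))"
  by (induction A rule: infinite_finite_induct) (auto simp: scale_add)

lemma single_sum: "Poly_Mapping.single g (\<Sum>i\<in>A. f i) = (\<Sum>i\<in>A. Poly_Mapping.single g (f i))"
  by (induction A rule: infinite_finite_induct) (auto simp: single_add)

lemma keys_scale: "Poly_Mapping.keys (scale a f) \<subseteq> Poly_Mapping.keys f"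
  by (auto simp: in_keys_iff lookup_scale)

lemma keys_add_subset:
  "Poly_Mapping.keys f \<subseteq> G \<Longrightarrow> Poly_Mapping.keys g \<subseteq> G \<Longrightarrow> Poly_Mapping.keys (f + g) \<subseteq> G"
  using Poly_Mapping.keys_add[of f g] by blast

lemma keys_single_subset: "g \<in> G \<Longrightarrow> Poly_Mapping.keys (Poly_Mapping.single g a) \<subseteq> G"
  by simp

lemma keys_sum_subset:
  "(\<And>i. i \<in> A \<Longrightarrow> Poly_Mapping.keys (f i) \<subseteq> G) \<Longrightarrow> Poly_Mapping.keys (sum f A) \<subseteq> G"
  by (induction A rule: infinite_finite_induct) (simp_all add: keys_add_subset)

lemma keys_uminus_subset:
  "Poly_Mapping.keys (f :: _ \<Rightarrow>\<^sub>0 'a::ab_group_add) \<subseteq> G \<Longrightarrow> Poly_Mapping.keys (- f) \<subseteq> G"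
  by (auto simp: in_keys_iff)

lemma keys_diff_subset:
  "Poly_Mapping.keys f \<subseteq> G \<Longrightarrow> Poly_Mapping.keys g \<subseteq> G \<Longrightarrow>
    Poly_Mapping.keys (f - g :: _ \<Rightarrow>\<^sub>0 'a::ab_group_add) \<subseteq> G"
  using keys_add_subset[of f G "- g"] keys_uminus_subset[of g G] by simp

text \<open>
  An element of the free module is a finite sum of multiples of generators.
\<close>

lemma free_module_induct [consumes 1, case_names zero single add]:
  fixes f :: "'g \<Rightarrow>\<^sub>0 'a::comm_monoid_add"
  assumes "Poly_Mapping.keys f \<subseteq> G"
    and "P 0"
    and "\<And>g a. g \<in> G \<Longrightarrow> P (Poly_Mapping.single g a)"
    and "\<And>f1 f2. Poly_Mapping.keys f1 \<subseteq> G \<Longrightarrow> Poly_Mapping.keys f2 \<subseteq> G \<Longrightarrow> P f1 \<Longrightarrow> P f2 \<Longrightarrow> P (f1 + f2)"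
  shows "P f"
proof -
  have f: "f = (\<Sum>g\<in>Poly_Mapping.keys f. Poly_Mapping.single g (Poly_Mapping.lookup f g))"
    by (rule poly_mapping_eqI) (auto simp: lookup_sum lookup_single when_def in_keys_iff sum.If_cases sum.delta')
  have "finite A \<Longrightarrow> A \<subseteq> G \<Longrightarrow> P (\<Sum>g\<in>A. Poly_Mapping.single g (Poly_Mapping.lookup f g))" for A
    by (induction A rule: finite_induct)
       (auto intro!: assms(2-4) keys_sum_subset simp: subset_iff split: if_splits)
  from this[OF finite_keys assms(1)] f show ?thesis by simp
qed

text \<open>
  The additive extension to the free module of a family of additive maps on the coefficients. The maps
  \<open>free_semilinear\<close>, the maps \<open>D\<^sub>i\<close> over \<open>K((1/t))\<close> and the coordinate functionals are all of this form.
\<close>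

definition free_extend :: "('g \<Rightarrow> 'a \<Rightarrow> 'b) \<Rightarrow> ('g \<Rightarrow>\<^sub>0 'a::zero) \<Rightarrow> 'b::comm_monoid_add" where
  "free_extend h f = (\<Sum>g\<in>Poly_Mapping.keys f. h g (Poly_Mapping.lookup f g))"

locale additive_family =
  fixes h :: "'g \<Rightarrow> 'a::ab_group_add \<Rightarrow> 'b::ab_group_add"
  assumes h_add: "h g (a + b) = h g a + h g b"
begin

lemma h_0 [simp]: "h g 0 = 0"
  using h_add[of g 0 0] by simp

lemma free_extend_superset:
  assumes "finite A" "Poly_Mapping.keys f \<subseteq> A"
  shows "free_extend h f = (\<Sum>g\<in>A. h g (Poly_Mapping.lookup f g))"
  unfolding free_extend_def
  by (rule sum.mono_neutral_left) (use assms in \<open>auto simp: in_keys_iff\<close>)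

lemma free_extend_add: "free_extend h (f1 + f2) = free_extend h f1 + free_extend h f2"
proof -
  let ?A = "Poly_Mapping.keys f1 \<union> Poly_Mapping.keys f2"
  have "free_extend h f = (\<Sum>g\<in>?A. h g (Poly_Mapping.lookup f g))"
    if "Poly_Mapping.keys f \<subseteq> ?A" for f
    by (rule free_extend_superset) (use that in auto)
  thus ?thesis
    using keys_add_subset[of f1 ?A f2] by (simp add: lookup_add h_add sum.distrib)
qed

lemma free_extend_0 [simp]: "free_extend h 0 = 0"
  by (simp add: free_extend_def)

lemma free_extend_single [simp]: "free_extend h (Poly_Mapping.single g a) = h g a"
  by (simp add: free_extend_def)

lemma free_extend_uminus: "free_extend h (- f) = - free_extend h f"
  using free_extend_add[of f "- f"] by (simp add: eq_neg_iff_add_eq_0 add.commute)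

lemma free_extend_diff: "free_extend h (f1 - f2) = free_extend h f1 - free_extend h f2"
  using free_extend_add[of f1 "- f2"] by (simp add: free_extend_uminus)

lemma free_extend_sum: "free_extend h (\<Sum>i\<in>A. f i) = (\<Sum>i\<in>A. free_extend h (f i))"
  by (induction A rule: infinite_finite_induct) (auto simp: free_extend_add)

end

lemma free_semilinear_eq: "free_semilinear \<sigma> s = free_extend (\<lambda>g a. Poly_Mapping.single (s g) (\<sigma> a))"
  by (rule ext) (simp add: free_semilinear_def free_extend_def)

lemma free_module_simps [simp]:
  "carrier (free_module G) = {f. Poly_Mapping.keys f \<subseteq> G}"
  "\<zero>\<^bsub>free_module G\<^esub> = 0" "f \<oplus>\<^bsub>free_module G\<^esub> g = f + g" "a \<odot>\<^bsub>free_module G\<^esub> f = scale a f"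
  by (simp_all add: free_module_def scale_def)

lemma free_module_module: "module type_ring (free_module G :: ('a::comm_ring_1, 'g \<Rightarrow>\<^sub>0 'a) module)"
proof (rule moduleI)
  show "cring (type_ring :: 'a ring)" by (rule cring_from_type_algebra)
  show "abelian_group (free_module G :: ('a, 'g \<Rightarrow>\<^sub>0 'a) module)"
  proof (rule abelian_groupI)
    fix f assume "f \<in> carrier (free_module G :: ('a, 'g \<Rightarrow>\<^sub>0 'a) module)"
    thus "\<exists>g\<in>carrier (free_module G). g \<oplus>\<^bsub>free_module G\<^esub> f = \<zero>\<^bsub>free_module G\<^esub>"
      by (intro bexI[of _ "- f"]) (auto simp: keys_uminus_subset)
  qed (simp_all add: keys_add_subset algebra_simps)
next
  fix a :: 'a and x assume "x \<in> carrier (free_module G :: ('a, 'g \<Rightarrow>\<^sub>0 'a) module)"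
  thus "a \<odot>\<^bsub>free_module G\<^esub> x \<in> carrier (free_module G)" using keys_scale[of a x] by auto
qed (auto simp: lookup_scale lookup_add algebra_simps intro!: poly_mapping_eqI)

lemma free_module_uminus:
  assumes "Poly_Mapping.keys (f :: 'g \<Rightarrow>\<^sub>0 'a::comm_ring_1) \<subseteq> G"
  shows "\<ominus>\<^bsub>free_module G\<^esub> f = - f"
proof -
  interpret module type_ring "free_module G :: ('a, 'g \<Rightarrow>\<^sub>0 'a) module" by (rule free_module_module)
  show ?thesis
    by (rule M.minus_equality) (use assms in \<open>auto simp: keys_uminus_subset\<close>)
qed

locale free_submodule =
  fixes G :: "'g set" and N :: "('g \<Rightarrow>\<^sub>0 'a::comm_ring_1) set"
  assumes submod: "submodule N type_ring (free_module G)"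
begin

sublocale F: module type_ring "free_module G :: ('a, 'g \<Rightarrow>\<^sub>0 'a) module"
  by (rule free_module_module)

lemma N_keys: "x \<in> N \<Longrightarrow> Poly_Mapping.keys x \<subseteq> G"
  using F.submoduleE(1)[OF submod] by auto

lemma N_0: "0 \<in> N"
  using F.submodule_zero[OF submod] by simp

lemma N_add: "x \<in> N \<Longrightarrow> y \<in> N \<Longrightarrow> x + y \<in> N"
  using F.submoduleE(5)[OF submod, of x y] by simp

lemma N_uminus: "x \<in> N \<Longrightarrow> - x \<in> N"
  using F.submoduleE(3)[OF submod, of x] by (simp add: free_module_uminus N_keys)

lemma N_diff: "x \<in> N \<Longrightarrow> y \<in> N \<Longrightarrow> x - y \<in> N"
  using N_add[of x "- y"] by (simp add: N_uminus)

lemma N_scale: "x \<in> N \<Longrightarrow> scale a x \<in> N"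
  using F.submoduleE(4)[OF submod, of a x] by simp

lemma N_sum: "(\<And>i. i \<in> A \<Longrightarrow> f i \<in> N) \<Longrightarrow> (\<Sum>i\<in>A. f i) \<in> N"
  by (induction A rule: infinite_finite_induct) (auto intro: N_0 N_add)

abbreviation coset :: "('g \<Rightarrow>\<^sub>0 'a) \<Rightarrow> ('g \<Rightarrow>\<^sub>0 'a) set" where
  "coset x \<equiv> N +>\<^bsub>free_module G\<^esub> x"

lemma coset_eq: "coset x = (\<lambda>n. n + x) ` N"
  by (auto simp: a_r_coset_def')

lemma coset_eq_iff: "coset x = coset y \<longleftrightarrow> x - y \<in> N"
proof
  assume "coset x = coset y"
  moreover have "x \<in> coset x" unfolding coset_eq using N_0 by force
  ultimately obtain n where "n \<in> N" "x = n + y" unfolding coset_eq by auto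
  thus "x - y \<in> N" by simp
next
  assume d: "x - y \<in> N"
  show "coset x = coset y"
  proof (intro equalityI subsetI)
    fix z assume "z \<in> coset x"
    then obtain n where "n \<in> N" "z = (n + (x - y)) + y" unfolding coset_eq by auto
    thus "z \<in> coset y" unfolding coset_eq using N_add d by blast
  next
    fix z assume "z \<in> coset y"
    then obtain n where "n \<in> N" "z = (n - (x - y)) + x" unfolding coset_eq by auto
    thus "z \<in> coset x" unfolding coset_eq using N_diff d by blast
  qed
qed

lemma coset_add: "coset x <+>\<^bsub>free_module G\<^esub> coset y = coset (x + y)"
proof -
  have "coset x <+>\<^bsub>free_module G\<^esub> coset y = (\<Union>n\<in>N. \<Union>m\<in>N. {n + x + (m + y)})"
    by (auto simp: set_add_def' coset_eq)
  also have "\<dots> = coset (x + y)"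
  proof (intro equalityI subsetI)
    fix z assume "z \<in> (\<Union>n\<in>N. \<Union>m\<in>N. {n + x + (m + y)})"
    then obtain n m where "n \<in> N" "m \<in> N" "z = (n + m) + (x + y)" by (auto simp: algebra_simps)
    thus "z \<in> coset (x + y)" unfolding coset_eq using N_add by blast
  next
    fix z assume "z \<in> coset (x + y)"
    then obtain n where n: "n \<in> N" "z = n + x + (0 + y)" unfolding coset_eq by (auto simp: algebra_simps)
    thus "z \<in> (\<Union>n\<in>N. \<Union>m\<in>N. {n + x + (m + y)})" using N_0 by blast
  qed
  finally show ?thesis .
qed

end

text \<open>
  An additive map carrying \<open>N\<close> into \<open>N'\<close> descends to cosets. The union over representatives is the form
  in which scalar multiplication and \<open>\<tau>\<close> of a presented module are defined.
\<close>

lemma coset_image: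
  fixes f :: "('g \<Rightarrow>\<^sub>0 'a::comm_ring_1) \<Rightarrow> ('h \<Rightarrow>\<^sub>0 'b::comm_ring_1)"
  assumes "free_submodule G N" "free_submodule G' N'"
    and add: "\<And>x y. f (x + y) = f x + f y"
    and N: "\<And>n. n \<in> N \<Longrightarrow> f n \<in> N'"
  shows "(\<Union>y\<in>N +>\<^bsub>free_module G\<^esub> x. N' +>\<^bsub>free_module G'\<^esub> f y) = N' +>\<^bsub>free_module G'\<^esub> f x"
proof -
  interpret A: free_submodule G N by fact
  interpret B: free_submodule G' N' by fact
  have "B.coset (f (n + x)) = B.coset (f x)" if "n \<in> N" for n
    unfolding B.coset_eq_iff using that by (simp add: add N)
  thus ?thesis unfolding A.coset_eq using A.N_0 by (simp; blast)
qed

text \<open>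
  Left modules over a skew polynomial ring in \<open>\<tau>\<close>, for an arbitrary twist \<open>\<sigma>\<close> of the coefficients: this
  covers both \<open>K[t]\<close>-modules and their base changes to \<open>K((1/t))\<close>.
\<close>

locale semilinear_module = module type_ring V for V :: "('r::comm_ring_1, 'v) tau_module" +
  fixes \<sigma> :: "'r \<Rightarrow> 'r"
  assumes tau_closed: "x \<in> carrier V \<Longrightarrow> tau V x \<in> carrier V"
    and tau_add: "x \<in> carrier V \<Longrightarrow> y \<in> carrier V \<Longrightarrow> tau V (x \<oplus>\<^bsub>V\<^esub> y) = tau V x \<oplus>\<^bsub>V\<^esub> tau V y"
    and tau_smult: "x \<in> carrier V \<Longrightarrow> tau V (a \<odot>\<^bsub>V\<^esub> x) = \<sigma> a \<odot>\<^bsub>V\<^esub> tau V x"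

lemma skew_module_iff: "skew_module q M \<longleftrightarrow> semilinear_module M (poly_twist q)"
  by (auto simp: skew_module_def semilinear_module_def semilinear_module_axioms_def)

text \<open>
  A presented module is well behaved as soon as \<open>\<sigma>\<close> is multiplicative and additive, and \<open>\<tau>\<close> carries
  the relations into the submodule spanned by them.
\<close>

locale presentation =
  fixes G :: "'g set" and Rel :: "('g \<Rightarrow>\<^sub>0 'a::comm_ring_1) set" and \<sigma> :: "'a \<Rightarrow> 'a" and s :: "'g \<Rightarrow> 'g"
  assumes Rel_keys: "r \<in> Rel \<Longrightarrow> Poly_Mapping.keys r \<subseteq> G"
    and sigma_add: "\<sigma> (a + b) = \<sigma> a + \<sigma> b"
    and sigma_mult: "\<sigma> (a * b) = \<sigma> a * \<sigma> b"
    and s_closed: "g \<in> G \<Longrightarrow> s g \<in> G"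
    and tau_Rel: "r \<in> Rel \<Longrightarrow> free_semilinear \<sigma> s r \<in> module_span type_ring (free_module G) Rel"
begin

definition N where "N = module_span type_ring (free_module G) Rel"

abbreviation P where "P \<equiv> presented_module G Rel \<sigma> s"

sublocale free_submodule G N
  unfolding N_def free_submodule_def
  by (intro module_span_submodule free_module_module) (use Rel_keys in auto)

lemma Rel_N: "r \<in> Rel \<Longrightarrow> r \<in> N"
  using module_span_superset[of Rel] by (auto simp: N_def)

lemma P_carrier: "carrier P = coset ` {x. Poly_Mapping.keys x \<subseteq> G}"
  by (auto simp: presented_module_def Let_def N_def A_RCOSETS_def')

lemma coset_in_P: "Poly_Mapping.keys x \<subseteq> G \<Longrightarrow> coset x \<in> carrier P"
  by (auto simp: P_carrier)

lemma P_add: "coset x \<oplus>\<^bsub>P\<^esub> coset y = coset (x + y)"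
  using coset_add[of x y] by (simp add: presented_module_def Let_def N_def)

lemma P_zero: "\<zero>\<^bsub>P\<^esub> = coset 0"
  by (simp add: presented_module_def Let_def N_def[symmetric] coset_eq)

text \<open>
  Well-definedness of a map on the presented module is checked on the defining relations. The scalar may
  change in passing through \<open>f\<close>, so that semilinear maps such as \<open>\<tau>\<close> are covered.
\<close>

lemma N_extend:
  assumes "free_submodule G' N'"
    and "\<And>x y. f (x + y) = f x + f y" "\<And>a x. \<exists>b. f (scale a x) = scale b (f x)"
    and "\<And>r. r \<in> Rel \<Longrightarrow> f r \<in> N'"
    and "n \<in> N"
  shows "f n \<in> N'"
proof -
  interpret N': free_submodule G' N' by fact
  have f0: "f 0 = 0" using assms(2)[of 0 0] by simp
  have fu: "f (- x) = - f x" for x using assms(2)[of x "- x"] f0 by (simp add: eq_neg_iff_add_eq_0 add.commute)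
  have "submodule {x. Poly_Mapping.keys x \<subseteq> G \<and> f x \<in> N'} type_ring (free_module G)"
  proof (rule F.submoduleI)
    fix x assume "x \<in> {x. Poly_Mapping.keys x \<subseteq> G \<and> f x \<in> N'}"
    thus "\<ominus>\<^bsub>free_module G\<^esub> x \<in> {x. Poly_Mapping.keys x \<subseteq> G \<and> f x \<in> N'}"
      by (simp add: free_module_uminus keys_uminus_subset fu N'.N_uminus)
  next
    fix a :: 'a and x assume "x \<in> {x. Poly_Mapping.keys x \<subseteq> G \<and> f x \<in> N'}"
    moreover obtain b where "f (scale a x) = scale b (f x)" using assms(3) by blast
    ultimately show "a \<odot>\<^bsub>free_module G\<^esub> x \<in> {x. Poly_Mapping.keys x \<subseteq> G \<and> f x \<in> N'}"
      using keys_scale[of a x] by (auto simp: N'.N_scale)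
  qed (simp_all add: f0 N'.N_0 assms(2) N'.N_add keys_add_subset Collect_mono)
  hence "N \<subseteq> {x. Poly_Mapping.keys x \<subseteq> G \<and> f x \<in> N'}"
    unfolding N_def by (rule module_span_least) (use assms(4) Rel_keys in blast)
  thus ?thesis using assms(5) by blast
qed

lemma P_smult: "a \<odot>\<^bsub>P\<^esub> coset x = coset (scale a x)"
  using coset_image[OF free_submodule_axioms free_submodule_axioms, of "scale a" x] N_scale
  by (simp add: presented_module_def Let_def N_def scale_add)

sublocale s: additive_family "\<lambda>g a. Poly_Mapping.single (s g) (\<sigma> a)"
  by unfold_locales (simp add: sigma_add single_add)

lemma free_semilinear_scale:
  "free_semilinear \<sigma> s (scale a x) = scale (\<sigma> a) (free_semilinear \<sigma> s x)"
proof -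
  have "Poly_Mapping.keys x \<subseteq> UNIV" by simp
  thus ?thesis
    by (induction x rule: free_module_induct)
       (auto simp: free_semilinear_eq scale_add s.free_extend_add scale_single sigma_mult)
qed

lemma free_semilinear_add:
  "free_semilinear \<sigma> s (x + y) = free_semilinear \<sigma> s x + free_semilinear \<sigma> s y"
  by (simp add: free_semilinear_eq s.free_extend_add)

lemma P_tau: "tau P (coset x) = coset (free_semilinear \<sigma> s x)"
proof -
  have "free_semilinear \<sigma> s n \<in> N" if "n \<in> N" for n
    using free_submodule_axioms _ _ _ that
  proof (rule N_extend)
    fix r assume "r \<in> Rel" thus "free_semilinear \<sigma> s r \<in> N" using tau_Rel by (simp add: N_def)
  next
    fix a x show "\<exists>b. free_semilinear \<sigma> s (scale a x) = scale b (free_semilinear \<sigma> s x)"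
      using free_semilinear_scale by blast
  qed (simp add: free_semilinear_eq s.free_extend_add)
  thus ?thesis
    using coset_image[OF free_submodule_axioms free_submodule_axioms, of "free_semilinear \<sigma> s" x]
    by (simp add: presented_module_def Let_def N_def free_semilinear_eq s.free_extend_add)
qed

lemma keys_free_semilinear:
  "Poly_Mapping.keys x \<subseteq> G \<Longrightarrow> Poly_Mapping.keys (free_semilinear \<sigma> s x) \<subseteq> G"
  unfolding free_semilinear_def by (rule keys_sum_subset) (auto intro: s_closed split: if_splits)

lemma P_module: "module type_ring P"
proof (rule moduleI)
  show "cring (type_ring :: 'a ring)" by (rule cring_from_type_algebra)
  show "abelian_group P"
  proof (rule abelian_groupI)
    fix c assume "c \<in> carrier P"
    then obtain x where x: "c = coset x" "Poly_Mapping.keys x \<subseteq> G" by (auto simp: P_carrier)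
    thus "\<exists>d\<in>carrier P. d \<oplus>\<^bsub>P\<^esub> c = \<zero>\<^bsub>P\<^esub>"
      by (intro bexI[of _ "coset (- x)"]) (auto simp: P_add P_zero keys_uminus_subset coset_in_P)
  qed (auto simp: P_carrier P_add P_zero algebra_simps keys_add_subset intro!: imageI)
next
  fix a b :: 'a and c assume "c \<in> carrier P"
  then obtain x where x: "c = coset x" "Poly_Mapping.keys x \<subseteq> G" by (auto simp: P_carrier)
  show "a \<odot>\<^bsub>P\<^esub> c \<in> carrier P"
    using keys_scale[of a x] x(2) by (auto simp: x(1) P_smult intro: coset_in_P)
  have "scale (a + b) x = scale a x + scale b x" "scale (a * b) x = scale a (scale b x)" "scale 1 x = x"
    by (auto intro!: poly_mapping_eqI simp: lookup_scale lookup_add algebra_simps)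
  thus "(a \<oplus>\<^bsub>type_ring\<^esub> b) \<odot>\<^bsub>P\<^esub> c = a \<odot>\<^bsub>P\<^esub> c \<oplus>\<^bsub>P\<^esub> b \<odot>\<^bsub>P\<^esub> c"
    "(a \<otimes>\<^bsub>type_ring\<^esub> b) \<odot>\<^bsub>P\<^esub> c = a \<odot>\<^bsub>P\<^esub> (b \<odot>\<^bsub>P\<^esub> c)" "\<one>\<^bsub>type_ring\<^esub> \<odot>\<^bsub>P\<^esub> c = c"
    by (simp_all add: x P_smult P_add)
next
  fix a c d assume "c \<in> carrier P" "d \<in> carrier P"
  then obtain x y where "c = coset x" "d = coset y" by (auto simp: P_carrier)
  thus "a \<odot>\<^bsub>P\<^esub> (c \<oplus>\<^bsub>P\<^esub> d) = a \<odot>\<^bsub>P\<^esub> c \<oplus>\<^bsub>P\<^esub> a \<odot>\<^bsub>P\<^esub> d"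
    by (simp add: P_smult P_add scale_add)
qed

lemma P_semilinear: "semilinear_module P \<sigma>"
  by (intro semilinear_module.intro P_module semilinear_module_axioms.intro)
     (auto simp: P_carrier P_tau P_add P_smult keys_free_semilinear free_semilinear_scale
        free_semilinear_add)

text \<open>
  This serves as the induction principle for presented modules.
\<close>

lemma P_generated:
  assumes "submodule W type_ring P" and "\<And>g. g \<in> G \<Longrightarrow> coset (Poly_Mapping.single g 1) \<in> W"
  shows "W = carrier P"
proof
  interpret P: module type_ring P by (rule P_module)
  show "W \<subseteq> carrier P" by (rule P.submoduleE(1)[OF assms(1)])
  show "carrier P \<subseteq> W"
  proof
    fix c assume "c \<in> carrier P"
    then obtain x where x: "c = coset x" "Poly_Mapping.keys x \<subseteq> G" by (auto simp: P_carrier)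
    from x(2) have "coset x \<in> W"
    proof (induction x rule: free_module_induct)
      case zero
      show ?case using P.submodule_zero[OF assms(1)] by (simp add: P_zero)
    next
      case (single g a)
      have "a \<odot>\<^bsub>P\<^esub> coset (Poly_Mapping.single g 1) \<in> W"
        using P.submoduleE(4)[OF assms(1)] assms(2)[OF single] by simp
      thus ?case by (simp add: P_smult scale_single)
    next
      case (add x y)
      hence "coset x \<oplus>\<^bsub>P\<^esub> coset y \<in> W" using P.submoduleE(5)[OF assms(1)] by blast
      thus ?case by (simp add: P_add)
    qed
    thus "c \<in> W" by (simp add: x)
  qed
qed

lemma P_finsum:
  assumes "finite A" "\<And>i. i \<in> A \<Longrightarrow> Poly_Mapping.keys (f i) \<subseteq> G"
  shows "(\<Oplus>\<^bsub>P\<^esub>i\<in>A. coset (f i)) = coset (\<Sum>i\<in>A. f i)"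
  using assms
proof (induction A rule: finite_induct)
  interpret P: module type_ring P by (rule P_module)
  case empty
  thus ?case by (simp add: P_zero)
next
  interpret P: module type_ring P by (rule P_module)
  case (insert i A)
  have "(\<Oplus>\<^bsub>P\<^esub>i\<in>insert i A. coset (f i)) = coset (f i) \<oplus>\<^bsub>P\<^esub> (\<Oplus>\<^bsub>P\<^esub>i\<in>A. coset (f i))"
    using insert by (intro P.finsum_insert) (auto intro!: coset_in_P)
  thus ?case using insert by (simp add: P_add)
qed

end


section \<open>Families of hyperderivations and lattices\<close>

lemma (in module) submoduleI_smult:
  assumes "H \<subseteq> carrier M" "\<zero>\<^bsub>M\<^esub> \<in> H" "\<And>x y. x \<in> H \<Longrightarrow> y \<in> H \<Longrightarrow> x \<oplus>\<^bsub>M\<^esub> y \<in> H"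
    and smult: "\<And>a x. a \<in> carrier R \<Longrightarrow> x \<in> H \<Longrightarrow> a \<odot>\<^bsub>M\<^esub> x \<in> H"
  shows "submodule H R M"
proof (rule submoduleI)
  fix x assume x: "x \<in> H"
  have "\<ominus>\<^bsub>M\<^esub> x = (\<ominus> \<one>) \<odot>\<^bsub>M\<^esub> x"
    using x assms(1) by (subst smult_l_minus) auto
  thus "\<ominus>\<^bsub>M\<^esub> x \<in> H" using smult[of "\<ominus> \<one>" x] x by simp
qed (use assms in auto)

lemma type_ring_carrier_UNIV: "(type_ring :: 'a::comm_ring_1 ring)\<lparr>carrier := UNIV\<rparr> = type_ring"
  by (simp add: ring_of_type_algebra_def)

text \<open>
  This is used for the subring \<open>K[[1/t]]\<close> of \<open>K((1/t))\<close>.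
\<close>

lemma module_restrict_scalars:
  assumes V: "module (type_ring :: 'r::comm_ring_1 ring) V" and R: "cring (type_ring\<lparr>carrier := S\<rparr> :: 'r ring)"
  shows "module (type_ring\<lparr>carrier := S\<rparr>) V"
proof -
  interpret V: module type_ring V by fact
  show ?thesis
    by (rule moduleI[OF R])
       (use V.smult_l_distr V.smult_r_distr V.smult_assoc1 V.smult_one V.M.abelian_group_axioms in auto)
qed

lemma inverse_t_series_simps [simp]:
  "carrier inverse_t_series = range fps_to_fls"
  "x \<otimes>\<^bsub>inverse_t_series\<^esub> y = x * y" "x \<oplus>\<^bsub>inverse_t_series\<^esub> y = x + y"
  "\<one>\<^bsub>inverse_t_series\<^esub> = 1" "\<zero>\<^bsub>inverse_t_series\<^esub> = 0"
  by (simp_all add: inverse_t_series_def)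

lemma inverse_t_series_cring: "cring (inverse_t_series :: 'k::field fls ring)"
proof (rule cringI)
  show "abelian_group (inverse_t_series :: 'k fls ring)"
  proof (rule abelian_groupI)
    fix x assume "x \<in> carrier (inverse_t_series :: 'k fls ring)"
    thus "\<exists>y\<in>carrier inverse_t_series. y \<oplus>\<^bsub>inverse_t_series\<^esub> x = \<zero>\<^bsub>inverse_t_series\<^esub>"
      by (intro bexI[of _ "- x"]) (auto simp: in_range_fps_to_fls_iff simp del: rangeI)
  qed (auto simp: in_range_fps_to_fls_iff algebra_simps simp del: rangeI)
  show "comm_monoid (inverse_t_series :: 'k fls ring)"
  proof (rule comm_monoidI)
    fix x y assume "x \<in> carrier (inverse_t_series :: 'k fls ring)" "y \<in> carrier (inverse_t_series :: 'k fls ring)"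
    thus "x \<otimes>\<^bsub>inverse_t_series\<^esub> y \<in> carrier (inverse_t_series :: 'k fls ring)"
      by (auto simp: fls_times_fps_to_fls [symmetric])
  next
    show "\<one>\<^bsub>inverse_t_series\<^esub> \<in> carrier (inverse_t_series :: 'k fls ring)"
      by (simp add: range_eqI[of _ _ 1])
  qed (auto simp: algebra_simps)
qed (auto simp: algebra_simps)

text \<open>
  The scalar \<open>b\<close> may differ from \<open>a\<close>, so that semilinear maps such as powers of \<open>\<tau>\<close> are covered.
\<close>

lemma submodule_preimage:
  assumes "module R V" "module R W" "submodule N R W"
    and closed: "\<And>x. x \<in> carrier V \<Longrightarrow> g x \<in> carrier W"
    and add: "\<And>x y. x \<in> carrier V \<Longrightarrow> y \<in> carrier V \<Longrightarrow> g (x \<oplus>\<^bsub>V\<^esub> y) = g x \<oplus>\<^bsub>W\<^esub> g y"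
    and smult: "\<And>a x. a \<in> carrier R \<Longrightarrow> x \<in> carrier V \<Longrightarrow> \<exists>b\<in>carrier R. g (a \<odot>\<^bsub>V\<^esub> x) = b \<odot>\<^bsub>W\<^esub> g x"
  shows "submodule {x \<in> carrier V. g x \<in> N} R V"
proof -
  interpret V: module R V by fact
  interpret W: module R W by fact
  have g0: "g \<zero>\<^bsub>V\<^esub> = \<zero>\<^bsub>W\<^esub>"
    using add[of "\<zero>\<^bsub>V\<^esub>" "\<zero>\<^bsub>V\<^esub>"] closed[of "\<zero>\<^bsub>V\<^esub>"] by (metis V.M.l_zero V.M.zero_closed W.M.add.r_cancel_one')
  show ?thesis
  proof (rule V.submoduleI_smult)
    fix a x assume "a \<in> carrier R" "x \<in> {x \<in> carrier V. g x \<in> N}"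
    thus "a \<odot>\<^bsub>V\<^esub> x \<in> {x \<in> carrier V. g x \<in> N}"
      using smult[of a x] W.submoduleE(4)[OF assms(3)] by auto
  qed (use W.submodule_zero[OF assms(3)] W.submoduleE(5)[OF assms(3)] in \<open>auto simp: g0 add\<close>)
qed

context semilinear_module
begin

lemma tau_pow_closed: "x \<in> carrier V \<Longrightarrow> (tau V ^^ n) x \<in> carrier V"
  by (induction n) (auto intro: tau_closed)

lemma tau_pow_add:
  "x \<in> carrier V \<Longrightarrow> y \<in> carrier V \<Longrightarrow> (tau V ^^ n) (x \<oplus>\<^bsub>V\<^esub> y) = (tau V ^^ n) x \<oplus>\<^bsub>V\<^esub> (tau V ^^ n) y"
  by (induction n) (auto simp: tau_add tau_pow_closed)

lemma tau_pow_smult: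
  "x \<in> carrier V \<Longrightarrow> (tau V ^^ n) (a \<odot>\<^bsub>V\<^esub> x) = (\<sigma> ^^ n) a \<odot>\<^bsub>V\<^esub> (tau V ^^ n) x"
  by (induction n) (auto simp: tau_smult tau_pow_closed)

end

text \<open>
  The common pattern of the maps \<open>D\<^sub>i : M \<rightarrow> \<rho>\<^sub>k M\<close> over \<open>K[t]\<close> and of their extensions to \<open>K((1/t))\<close>: additive maps
  obeying a Leibniz rule with respect to given maps \<open>\<delta>\<^sub>n\<close> on the scalars.
\<close>

locale hyperderivation_family =
  V: module type_ring V + W: module type_ring W
  for V :: "('r::comm_ring_1, 'v) tau_module" and W :: "('r, 'w) tau_module" +
  fixes \<delta> :: "nat \<Rightarrow> 'r \<Rightarrow> 'r" and D :: "nat \<Rightarrow> 'v \<Rightarrow> 'w" and k :: nat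
  assumes delta_0: "\<delta> 0 a = a"
    and D_closed: "i \<le> k \<Longrightarrow> x \<in> carrier V \<Longrightarrow> D i x \<in> carrier W"
    and D_add: "i \<le> k \<Longrightarrow> x \<in> carrier V \<Longrightarrow> y \<in> carrier V \<Longrightarrow> D i (x \<oplus>\<^bsub>V\<^esub> y) = D i x \<oplus>\<^bsub>W\<^esub> D i y"
    and D_smult: "i \<le> k \<Longrightarrow> x \<in> carrier V \<Longrightarrow>
      D i (a \<odot>\<^bsub>V\<^esub> x) = (\<Oplus>\<^bsub>W\<^esub>n\<in>{..i}. \<delta> n a \<odot>\<^bsub>W\<^esub> D (i - n) x)"
begin

lemma D_zero: "i \<le> k \<Longrightarrow> D i \<zero>\<^bsub>V\<^esub> = \<zero>\<^bsub>W\<^esub>"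
  using D_add[of i "\<zero>\<^bsub>V\<^esub>" "\<zero>\<^bsub>V\<^esub>"] D_closed[of i "\<zero>\<^bsub>V\<^esub>"]
  by (metis V.M.l_zero V.M.zero_closed W.M.add.r_cancel_one')

text \<open>
  The single maps \<open>D\<^sub>i\<close> are not linear, but \<open>D\<^sub>i(a x)\<close> is a combination of the \<open>D\<^sub>s x\<close> with \<open>s \<le> i\<close>, so the
  conditions for all \<open>i\<close> together are stable under scalars. This reduces statements about the \<open>D\<^sub>i\<close> on a span
  to its generators.
\<close>

lemma D_submodule:
  assumes "cring (type_ring\<lparr>carrier := S\<rparr> :: 'r ring)"
    and S: "\<And>n a. a \<in> S \<Longrightarrow> \<delta> n a \<in> S"
    and N: "submodule N (type_ring\<lparr>carrier := S\<rparr>) W"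
  shows "submodule {x \<in> carrier V. \<forall>i\<le>k. D i x \<in> N} (type_ring\<lparr>carrier := S\<rparr>) V"
proof -
  interpret VS: module "type_ring\<lparr>carrier := S\<rparr>" V
    by (rule module_restrict_scalars[OF V.module_axioms assms(1)])
  interpret WS: module "type_ring\<lparr>carrier := S\<rparr>" W
    by (rule module_restrict_scalars[OF W.module_axioms assms(1)])
  note NE = WS.submoduleE[OF N]
  show ?thesis
  proof (rule VS.submoduleI_smult)
    fix a x assume a: "a \<in> carrier (type_ring\<lparr>carrier := S\<rparr>)" and x: "x \<in> {x \<in> carrier V. \<forall>i\<le>k. D i x \<in> N}"
    have "D i (a \<odot>\<^bsub>V\<^esub> x) \<in> N" if i: "i \<le> k" for i
    proof -
      have "(\<Oplus>\<^bsub>W\<^esub>n\<in>{..i}. \<delta> n a \<odot>\<^bsub>W\<^esub> D (i - n) x) \<in> N"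
        by (rule WS.submodule_finsum[OF N]) (use a x i in \<open>auto intro!: NE(4) S\<close>)
      thus ?thesis using i x by (simp add: D_smult)
    qed
    thus "a \<odot>\<^bsub>V\<^esub> x \<in> {x \<in> carrier V. \<forall>i\<le>k. D i x \<in> N}" using x by auto
  qed (use WS.submodule_zero[OF N] NE(5) in \<open>auto simp: D_zero D_add\<close>)
qed

end

text \<open>
  The situation of purity, with \<open>V = M \<otimes> K((1/t))\<close> and \<open>W = \<rho>\<^sub>k M \<otimes> K((1/t))\<close>, reduced to the properties of
  the maps \<open>D\<^sub>i : V \<rightarrow> W\<close> on which the argument rests.
\<close>

locale prolongation_at_infinity =
  hyperderivation_family V W "fls_hyperderiv (-1)" D k +
  V: semilinear_module V "fls_twist q" + W: semilinear_module W "fls_twist q" +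
  frobenius_power q "TYPE('k)"
  for V :: "('k::field fls, 'v) tau_module" and W :: "('k fls, 'w) tau_module"
    and D :: "nat \<Rightarrow> 'v \<Rightarrow> 'w" and k q :: nat +
  assumes D_tau: "i \<le> k \<Longrightarrow> x \<in> carrier V \<Longrightarrow> D i (tau V x) = tau W (D i x)"
    and D_generate: "module_span type_ring W (\<Union>i\<le>k. D i ` carrier V) = carrier W"
begin

lemma D_tau_pow: "i \<le> k \<Longrightarrow> x \<in> carrier V \<Longrightarrow> D i ((tau V ^^ n) x) = (tau W ^^ n) (D i x)"
  by (induction n) (auto simp: D_tau V.tau_pow_closed)

sublocale VO: module inverse_t_series V
  unfolding inverse_t_series_def
  by (rule module_restrict_scalars[OF V.module_axioms inverse_t_series_cring[unfolded inverse_t_series_def]])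

sublocale WO: module inverse_t_series W
  unfolding inverse_t_series_def
  by (rule module_restrict_scalars[OF W.module_axioms inverse_t_series_cring[unfolded inverse_t_series_def]])

lemma D_submodule_integral:
  assumes "submodule N inverse_t_series W"
  shows "submodule {x \<in> carrier V. \<forall>i\<le>k. D i x \<in> N} inverse_t_series V"
  unfolding inverse_t_series_def
proof (rule D_submodule)
  show "cring (type_ring\<lparr>carrier := range fps_to_fls\<rparr> :: 'k fls ring)"
    using inverse_t_series_cring by (simp only: inverse_t_series_def)
  show "submodule N (type_ring\<lparr>carrier := range fps_to_fls\<rparr>) W"
    using assms by (simp only: inverse_t_series_def)
qed (rule fls_hyperderiv_integral)

definition prolong where
  "prolong H = module_span inverse_t_series W (\<Union>i\<le>k. D i ` H)"

lemma prolong_submodule: "H \<subseteq> carrier V \<Longrightarrow> submodule (prolong H) inverse_t_series W"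
  unfolding prolong_def by (rule module_span_submodule[OF WO.module_axioms]) (auto intro: D_closed)

lemma D_prolong: "i \<le> k \<Longrightarrow> h \<in> H \<Longrightarrow> D i h \<in> prolong H"
  unfolding prolong_def by (intro module_span_mem UN_I[of i] imageI) simp_all

lemma prolong_least:
  "submodule N inverse_t_series W \<Longrightarrow> (\<And>i h. i \<le> k \<Longrightarrow> h \<in> H \<Longrightarrow> D i h \<in> N) \<Longrightarrow> prolong H \<subseteq> N"
  unfolding prolong_def by (rule module_span_least) auto

text \<open>
  So finitely many generators of \<open>H\<close> yield finitely many generators of the prolonged lattice.
\<close>

lemma prolong_span:
  assumes "S \<subseteq> carrier V"
  shows "prolong (module_span inverse_t_series V S) = prolong S"
proof
  have "module_span inverse_t_series V S \<subseteq> {x \<in> carrier V. \<forall>i\<le>k. D i x \<in> prolong S}"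
    by (intro module_span_least D_submodule_integral prolong_submodule)
       (use assms D_prolong in auto)
  thus "prolong (module_span inverse_t_series V S) \<subseteq> prolong S"
    by (intro prolong_least prolong_submodule assms) auto
  have "module_span inverse_t_series V S \<subseteq> carrier V"
    by (rule VO.submoduleE(1)[OF module_span_submodule[OF VO.module_axioms assms]])
  thus "prolong S \<subseteq> prolong (module_span inverse_t_series V S)"
    by (intro prolong_least prolong_submodule)
       (auto intro!: D_prolong module_span_mem)
qed

lemma prolong_lattice:
  assumes "is_lattice V H"
  shows "is_lattice W (prolong H)"
proof -
  have H: "submodule H inverse_t_series V" and gen: "module_span type_ring V H = carrier V"
    using assms by (auto simp: is_lattice_def)
  obtain S where S: "finite S" "S \<subseteq> H" "module_span inverse_t_series V S = H"
    using assms by (auto simp: is_lattice_def finitely_generated_def)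
  note Hc = VO.submoduleE(1)[OF H]
  have "prolong H = prolong S" using prolong_span[of S] S Hc by simp
  hence "finitely_generated inverse_t_series W (prolong H)"
    unfolding finitely_generated_def
    by (intro exI[of _ "\<Union>i\<le>k. D i ` S"]) (use S in \<open>auto simp: prolong_def[symmetric] intro: D_prolong\<close>)
  moreover have "module_span type_ring W (prolong H) = carrier W"
  proof
    let ?N = "module_span type_ring W (prolong H)"
    have sub: "prolong H \<subseteq> carrier W"
      by (rule WO.submoduleE(1)[OF prolong_submodule[OF Hc]])
    show "?N \<subseteq> carrier W" by (rule module_span_least[OF W.carrier_is_submodule sub])
    have N: "submodule ?N type_ring W" by (rule module_span_submodule[OF W.module_axioms sub])
    have "submodule {x \<in> carrier V. \<forall>i\<le>k. D i x \<in> ?N} type_ring V"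
      using D_submodule[of UNIV ?N] N cring_from_type_algebra by (simp add: type_ring_carrier_UNIV)
    moreover have "H \<subseteq> {x \<in> carrier V. \<forall>i\<le>k. D i x \<in> ?N}"
      using Hc by (auto intro!: module_span_mem D_prolong)
    ultimately have "module_span type_ring V H \<subseteq> {x \<in> carrier V. \<forall>i\<le>k. D i x \<in> ?N}"
      by (rule module_span_least)
    hence "(\<Union>i\<le>k. D i ` carrier V) \<subseteq> ?N" unfolding gen by auto
    thus "carrier W \<subseteq> ?N" using module_span_least[OF N] D_generate by blast
  qed
  ultimately show ?thesis
    using prolong_submodule[OF Hc] by (simp add: is_lattice_def)
qed

text \<open>
  Multiplication by \<open>t\<^sup>u\<close> is invertible, so an image under it is a preimage under \<open>t\<^bsup>-u\<^esup>\<close>, and preimages of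
  submodules are submodules.
\<close>

lemma mult_t_image_iff:
  assumes "N \<subseteq> carrier W"
  shows "x \<in> (\<lambda>h. fls_X_inv ^ u \<odot>\<^bsub>W\<^esub> h) ` N \<longleftrightarrow> x \<in> carrier W \<and> fls_X ^ u \<odot>\<^bsub>W\<^esub> x \<in> N"
proof -
  have inv: "fls_X ^ u * fls_X_inv ^ u = (1 :: 'k fls)" "fls_X_inv ^ u * fls_X ^ u = (1 :: 'k fls)"
    by (simp_all add: fls_X_times_conv_shift fls_X_inv_times_conv_shift flip: power_mult_distrib)
  have 1: "fls_X ^ u \<odot>\<^bsub>W\<^esub> (fls_X_inv ^ u \<odot>\<^bsub>W\<^esub> h) = h" "fls_X_inv ^ u \<odot>\<^bsub>W\<^esub> (fls_X ^ u \<odot>\<^bsub>W\<^esub> h) = h"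
    if "h \<in> carrier W" for h
    using that W.smult_assoc1[of "fls_X ^ u" "fls_X_inv ^ u" h] W.smult_assoc1[of "fls_X_inv ^ u" "fls_X ^ u" h]
      W.smult_one[of h] by (simp_all add: inv)
  show ?thesis
  proof
    assume "x \<in> (\<lambda>h. fls_X_inv ^ u \<odot>\<^bsub>W\<^esub> h) ` N"
    thus "x \<in> carrier W \<and> fls_X ^ u \<odot>\<^bsub>W\<^esub> x \<in> N" using assms 1 by auto
  next
    assume "x \<in> carrier W \<and> fls_X ^ u \<odot>\<^bsub>W\<^esub> x \<in> N"
    thus "x \<in> (\<lambda>h. fls_X_inv ^ u \<odot>\<^bsub>W\<^esub> h) ` N"
      by (intro image_eqI[of _ _ "fls_X ^ u \<odot>\<^bsub>W\<^esub> x"]) (simp_all add: 1)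
  qed
qed

lemma smult_commute:
  "x \<in> carrier W \<Longrightarrow> a \<odot>\<^bsub>W\<^esub> (b \<odot>\<^bsub>W\<^esub> x) = b \<odot>\<^bsub>W\<^esub> (a \<odot>\<^bsub>W\<^esub> x)"
  using W.smult_assoc1[of a b x] W.smult_assoc1[of b a x] by (simp add: mult.commute)

lemma mult_submodule_preimage:
  assumes "submodule N inverse_t_series W"
  shows "submodule {x \<in> carrier W. a \<odot>\<^bsub>W\<^esub> x \<in> N} inverse_t_series W"
  by (rule submodule_preimage[OF WO.module_axioms WO.module_axioms assms])
     (auto simp: W.smult_r_distr smult_commute[of _ a])

text \<open>
  Integral means in \<open>K[[1/t]]\<close>. If \<open>\<tau>\<^sup>v h = t\<^sup>u g\<close> then \<open>\<tau>\<^sup>v D\<^sub>i h = D\<^sub>i (t\<^sup>u g)\<close>, which by the Leibniz rule is \<open>t\<^sup>u\<close>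
  times an integral combination of the \<open>D\<^sub>s g\<close>. Conversely \<open>t\<^sup>u D\<^sub>i h\<close> equals \<open>D\<^sub>i (t\<^sup>u h)\<close> minus an
  integral combination of the \<open>t\<^sup>u D\<^sub>s h\<close> with \<open>s < i\<close>, so induction on \<open>i\<close> applies.
\<close>

lemma prolong_pure:
  fixes u v :: nat
  assumes H: "submodule H inverse_t_series V"
    and pure: "(\<lambda>h. fls_X_inv ^ u \<odot>\<^bsub>V\<^esub> h) ` H = module_span inverse_t_series V ((tau V ^^ v) ` H)"
  shows "(\<lambda>h. fls_X_inv ^ u \<odot>\<^bsub>W\<^esub> h) ` prolong H = module_span inverse_t_series W ((tau W ^^ v) ` prolong H)"
    (is "?t = ?T")
proof
  note Hc = VO.submoduleE(1)[OF H]
  note P = prolong_submodule[OF Hc] and Pc = WO.submoduleE(1)[OF prolong_submodule[OF Hc]]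
  have "\<forall>n. \<exists>c. c \<in> range fps_to_fls \<and>
      fls_hyperderiv (-1) n (fls_X_inv ^ u :: 'k fls) = fls_X_inv ^ u * c"
    using fls_hyperderiv_X_inv_power[of _ u, where ?'a = 'k] by blast
  from choice[OF this] obtain c where c_props: "\<forall>n. c n \<in> range fps_to_fls \<and>
      fls_hyperderiv (-1) n (fls_X_inv ^ u :: 'k fls) = fls_X_inv ^ u * c n" by (rule exE)
  have c: "c n \<in> range fps_to_fls"
    "fls_hyperderiv (-1) n (fls_X_inv ^ u :: 'k fls) = fls_X_inv ^ u * c n" for n
    using c_props by simp_all
  have "?t = {x \<in> carrier W. fls_X ^ u \<odot>\<^bsub>W\<^esub> x \<in> prolong H}"
    by (intro equalityI subsetI) (simp_all only: mult_t_image_iff[OF Pc] mem_Collect_eq)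
  hence tP: "submodule ?t inverse_t_series W"
    using mult_submodule_preimage[OF P] by simp
  have T: "submodule ?T inverse_t_series W"
    by (rule module_span_submodule[OF WO.module_axioms]) (use Pc W.tau_pow_closed in auto)
  have tau_D: "(tau W ^^ v) (D i h) \<in> ?t" if i: "i \<le> k" and h: "h \<in> H" for i h
  proof -
    have "(tau V ^^ v) h \<in> (\<lambda>h. fls_X_inv ^ u \<odot>\<^bsub>V\<^esub> h) ` H"
      unfolding pure using h by (intro module_span_mem) auto
    then obtain g where g: "g \<in> H" "(tau V ^^ v) h = fls_X_inv ^ u \<odot>\<^bsub>V\<^esub> g" by auto
    have "(tau W ^^ v) (D i h) = D i (fls_X_inv ^ u \<odot>\<^bsub>V\<^esub> g)"
      using D_tau_pow[of i h v] i h Hc g(2) by auto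
    also have "\<dots> = (\<Oplus>\<^bsub>W\<^esub>n\<in>{..i}. fls_hyperderiv (-1) n (fls_X_inv ^ u) \<odot>\<^bsub>W\<^esub> D (i - n) g)"
      using D_smult i g Hc by blast
    also have "\<dots> \<in> ?t"
    proof (rule WO.submodule_finsum[OF tP])
      fix n assume "n \<in> {..i}"
      hence n: "i - n \<le> k" using i by auto
      have "fls_hyperderiv (-1) n (fls_X_inv ^ u) \<odot>\<^bsub>W\<^esub> D (i - n) g =
          fls_X_inv ^ u \<odot>\<^bsub>W\<^esub> (c n \<odot>\<^bsub>W\<^esub> D (i - n) g)"
        unfolding c(2) using W.smult_assoc1[of "fls_X_inv ^ u" "c n"] D_closed[OF n] g Hc by auto
      moreover have "c n \<odot>\<^bsub>W\<^esub> D (i - n) g \<in> prolong H"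
        using WO.submoduleE(4)[OF P] c(1) D_prolong[OF n g(1)] by simp
      ultimately show "fls_hyperderiv (-1) n (fls_X_inv ^ u) \<odot>\<^bsub>W\<^esub> D (i - n) g \<in> ?t" by blast
    qed simp
    finally show ?thesis .
  qed
  have twist: "(fls_twist q ^^ v) a \<in> range fps_to_fls" if "a \<in> range fps_to_fls" for a :: "'k fls"
    using that by (induction v) (auto intro: fls_twist_integral simp del: rangeI)
  have "submodule {x \<in> carrier W. (tau W ^^ v) x \<in> ?t} inverse_t_series W"
  proof (rule submodule_preimage[OF WO.module_axioms WO.module_axioms tP])
    fix a x assume "a \<in> carrier (inverse_t_series :: 'k fls ring)" "x \<in> carrier W"
    thus "\<exists>b\<in>carrier inverse_t_series. (tau W ^^ v) (a \<odot>\<^bsub>W\<^esub> x) = b \<odot>\<^bsub>W\<^esub> (tau W ^^ v) x"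
      using twist[of a] W.tau_pow_smult by (intro bexI[of _ "(fls_twist q ^^ v) a"]) simp_all
  qed (simp_all add: W.tau_pow_closed W.tau_pow_add)
  hence "prolong H \<subseteq> {x \<in> carrier W. (tau W ^^ v) x \<in> ?t}"
    by (rule prolong_least) (use tau_D D_closed Hc in auto)
  thus "?T \<subseteq> ?t" by (intro module_span_least[OF tP]) auto

  \<comment> \<open>Conversely, the Leibniz expansion of \<open>D\<^sub>i (t\<^sup>u h)\<close> is solved for its term with \<open>n = 0\<close>.\<close>
  have t_D: "fls_X_inv ^ u \<odot>\<^bsub>W\<^esub> D i h \<in> ?T" if "i \<le> k" "h \<in> H" for i h
    using that(1)
  proof (induction i rule: less_induct)
    case (less i)
    let ?f = "\<lambda>n. fls_hyperderiv (-1) n (fls_X_inv ^ u) \<odot>\<^bsub>W\<^esub> D (i - n) h"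
    have hc: "h \<in> carrier V" using that Hc by auto
    have "submodule {x \<in> carrier V. \<forall>i\<le>k. D i x \<in> ?T} inverse_t_series V"
      by (rule D_submodule_integral[OF T])
    moreover have "(tau V ^^ v) ` H \<subseteq> {x \<in> carrier V. \<forall>i\<le>k. D i x \<in> ?T}"
      using Hc D_prolong
      by (auto simp: D_tau_pow V.tau_pow_closed intro!: module_span_mem imageI)
    ultimately have "module_span inverse_t_series V ((tau V ^^ v) ` H) \<subseteq> {x \<in> carrier V. \<forall>i\<le>k. D i x \<in> ?T}"
      by (rule module_span_least)
    hence Dt: "D i (fls_X_inv ^ u \<odot>\<^bsub>V\<^esub> h) \<in> ?T"
      unfolding pure[symmetric] using that less.prems by auto
    have f: "?f \<in> {..i} \<rightarrow> carrier W" using hc less.prems by (auto intro!: D_closed)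
    have "D i (fls_X_inv ^ u \<odot>\<^bsub>V\<^esub> h) = (\<Oplus>\<^bsub>W\<^esub>n\<in>{..i}. ?f n)"
      using D_smult less.prems hc by blast
    also have "{..i} = insert 0 {1..i}" by auto
    also have "(\<Oplus>\<^bsub>W\<^esub>n\<in>insert 0 {1..i}. ?f n) = ?f 0 \<oplus>\<^bsub>W\<^esub> (\<Oplus>\<^bsub>W\<^esub>n\<in>{1..i}. ?f n)"
      by (rule W.M.finsum_insert) (use f D_closed[of i h] hc less.prems in auto)
    finally have eq: "D i (fls_X_inv ^ u \<odot>\<^bsub>V\<^esub> h) =
        fls_X_inv ^ u \<odot>\<^bsub>W\<^esub> D i h \<oplus>\<^bsub>W\<^esub> (\<Oplus>\<^bsub>W\<^esub>n\<in>{1..i}. ?f n)" by simp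
    have rest: "(\<Oplus>\<^bsub>W\<^esub>n\<in>{1..i}. ?f n) \<in> ?T"
    proof (rule WO.submodule_finsum[OF T])
      fix n assume n: "n \<in> {1..i}"
      have "?f n = c n \<odot>\<^bsub>W\<^esub> (fls_X_inv ^ u \<odot>\<^bsub>W\<^esub> D (i - n) h)"
        unfolding c(2) using W.smult_assoc1[of "c n" "fls_X_inv ^ u" "D (i - n) h"] D_closed[of "i - n" h] hc less.prems
        by (simp add: mult.commute)
      thus "?f n \<in> ?T" using WO.submoduleE(4)[OF T] c(1) less.IH[of "i - n"] less.prems n by auto
    qed simp
    have "fls_X_inv ^ u \<odot>\<^bsub>W\<^esub> D i h =
        D i (fls_X_inv ^ u \<odot>\<^bsub>V\<^esub> h) \<oplus>\<^bsub>W\<^esub> (\<ominus>\<^bsub>W\<^esub> (\<Oplus>\<^bsub>W\<^esub>n\<in>{1..i}. ?f n))"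
      unfolding eq using rest WO.submoduleE(1)[OF T] D_closed[of i h] hc less.prems
      by (simp add: W.M.add.m_assoc W.M.r_neg subset_iff)
    thus ?case using Dt rest WO.submoduleE(3,5)[OF T] by simp
  qed
  have "prolong H \<subseteq> {x \<in> carrier W. fls_X_inv ^ u \<odot>\<^bsub>W\<^esub> x \<in> ?T}"
    by (rule prolong_least[OF mult_submodule_preimage[OF T]]) (use t_D D_closed Hc in auto)
  thus "?t \<subseteq> ?T" by auto
qed

end


section \<open>Base change, prolongation and purity\<close>

text \<open>
  Reindexing of a double Leibniz sum, as needed for \<open>D\<^sub>i((a b) x) = D\<^sub>i(a (b x))\<close>.
\<close>

lemma sum_triangle:
  fixes g :: "nat \<Rightarrow> nat \<Rightarrow> 'a::comm_monoid_add"
  shows "(\<Sum>n\<le>i. \<Sum>p\<le>n. g p (n - p)) = (\<Sum>p\<le>i. \<Sum>n\<le>i - p. g p n)"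
proof -
  have "(\<Sum>n\<le>i. \<Sum>p\<le>n. g p (n - p)) = (\<Sum>(p, n)\<in>{(p, n). p + n \<le> i}. g p n)"
    by (rule sum.triangle_reindex_eq [symmetric])
  also have "{(p, n). p + n \<le> i} = (SIGMA p:{..i}. {..i - p})" by auto
  also have "(\<Sum>(p, n)\<in>(SIGMA p:{..i}. {..i - p}). g p n) = (\<Sum>p\<le>i. \<Sum>n\<le>i - p. g p n)"
    by (rule sum.Sigma [symmetric]) auto
  finally show ?thesis .
qed

locale frobenius_module = semilinear_module M "poly_twist q" + frobenius_power q "TYPE('k)"
  for M :: "('k::field poly, 'm) tau_module" and q :: nat

context frobenius_module
begin

text \<open>
  The twist carries each relation of the base change to a relation of the same kind.
\<close>

lemma base_change_presentation:
  "presentation (carrier M) (base_change_relations M) (fls_twist q) (tau M)"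
proof
  interpret s: additive_family "\<lambda>m f. Poly_Mapping.single (tau M m) (fls_twist q f :: 'k fls)"
    by unfold_locales (simp add: fls_twist_add single_add)
  fix r assume r: "r \<in> base_change_relations M"
  show "Poly_Mapping.keys r \<subseteq> carrier M"
    using r unfolding base_change_relations_def
    by (elim UnE CollectE exE conjE; simp add: keys_diff_subset keys_add_subset keys_single_subset del: keys_single)
  have "free_semilinear (fls_twist q) (tau M) r \<in> base_change_relations M"
    using r unfolding base_change_relations_def free_semilinear_eq
    by (auto simp: s.free_extend_diff s.free_extend_add fls_twist_1 fls_twist_poly_at_infinity
        tau_add tau_smult tau_closed; blast intro: tau_closed)
  thus "free_semilinear (fls_twist q) (tau M) r
      \<in> module_span type_ring (free_module (carrier M)) (base_change_relations M)"
    by (rule module_span_mem)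
qed (auto simp: fls_twist_add fls_twist_mult tau_closed)

sublocale B: presentation "carrier M" "base_change_relations M" "fls_twist q" "tau M"
  rewrites "presented_module (carrier M) (base_change_relations M) (fls_twist q) (tau M) = base_change q M"
  by (rule base_change_presentation) (simp add: base_change_def)

text \<open>
  The element \<open>m \<otimes> 1\<close>.
\<close>

definition tensor :: "'m \<Rightarrow> ('m \<Rightarrow>\<^sub>0 'k fls) set" where
  "tensor m = B.coset (Poly_Mapping.single m 1)"

lemma tensor_closed: "m \<in> carrier M \<Longrightarrow> tensor m \<in> carrier (base_change q M)"
  unfolding tensor_def by (rule B.coset_in_P) simp

lemma tensor_add:
  assumes "x \<in> carrier M" "y \<in> carrier M"
  shows "tensor (x \<oplus>\<^bsub>M\<^esub> y) = tensor x \<oplus>\<^bsub>base_change q M\<^esub> tensor y"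
  unfolding tensor_def B.P_add B.coset_eq_iff
  by (rule B.Rel_N) (use assms in \<open>auto simp: base_change_relations_def\<close>)

lemma tensor_smult:
  assumes "x \<in> carrier M"
  shows "tensor (a \<odot>\<^bsub>M\<^esub> x) = poly_at_infinity a \<odot>\<^bsub>base_change q M\<^esub> tensor x"
  unfolding tensor_def B.P_smult B.coset_eq_iff
  by (rule B.Rel_N) (use assms in \<open>auto simp: base_change_relations_def scale_single\<close>)

lemma tensor_finsum:
  assumes "finite A" "\<And>i. i \<in> A \<Longrightarrow> y i \<in> carrier M"
  shows "tensor (\<Oplus>\<^bsub>M\<^esub>i\<in>A. a i \<odot>\<^bsub>M\<^esub> y i) = B.coset (\<Sum>i\<in>A. Poly_Mapping.single (y i) (poly_at_infinity (a i)))"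
  using assms
proof (induction A rule: finite_induct)
  case empty
  have "tensor \<zero>\<^bsub>M\<^esub> = tensor (0 \<odot>\<^bsub>M\<^esub> \<zero>\<^bsub>M\<^esub>)" by simp
  also have "\<dots> = B.coset 0"
    by (subst tensor_smult) (auto simp: tensor_def B.P_smult scale_single poly_at_infinity_0)
  finally show ?case by simp
next
  case (insert i A)
  have "(\<lambda>i. a i \<odot>\<^bsub>M\<^esub> y i) \<in> A \<rightarrow> carrier M" "a i \<odot>\<^bsub>M\<^esub> y i \<in> carrier M" using insert.prems by auto
  hence "tensor (\<Oplus>\<^bsub>M\<^esub>i\<in>insert i A. a i \<odot>\<^bsub>M\<^esub> y i) =
      tensor (a i \<odot>\<^bsub>M\<^esub> y i) \<oplus>\<^bsub>base_change q M\<^esub> tensor (\<Oplus>\<^bsub>M\<^esub>i\<in>A. a i \<odot>\<^bsub>M\<^esub> y i)"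
    using insert.hyps by (simp add: M.finsum_insert tensor_add)
  also have "tensor (a i \<odot>\<^bsub>M\<^esub> y i) = B.coset (Poly_Mapping.single (y i) (poly_at_infinity (a i)))"
    using insert.prems by (simp add: tensor_smult) (simp add: tensor_def B.P_smult scale_single)
  also have "tensor (\<Oplus>\<^bsub>M\<^esub>i\<in>A. a i \<odot>\<^bsub>M\<^esub> y i) = B.coset (\<Sum>i\<in>A. Poly_Mapping.single (y i) (poly_at_infinity (a i)))"
    by (rule insert.IH) (use insert.prems in auto)
  also have "B.coset (Poly_Mapping.single (y i) (poly_at_infinity (a i))) \<oplus>\<^bsub>base_change q M\<^esub>
        B.coset (\<Sum>i\<in>A. Poly_Mapping.single (y i) (poly_at_infinity (a i))) =
      B.coset (\<Sum>i\<in>insert i A. Poly_Mapping.single (y i) (poly_at_infinity (a i)))"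
    using insert.hyps by (simp add: B.P_add)
  finally show ?case .
qed

end

locale prolonged_module = frobenius_module M q for M :: "('k::field poly, 'm) tau_module" and q :: nat +
  fixes k :: nat
begin

lemma prolongation_sum:
  "(\<Sum>(i1, i2)\<in>{(i1, i2). i1 + i2 = i}. Poly_Mapping.single (i2, m) (hyperderiv i1 a)) =
    (\<Sum>n\<le>i. Poly_Mapping.single (i - n, m :: 'm) (hyperderiv n (a :: 'k poly)))"
  by (rule sum.reindex_bij_witness[of _ "\<lambda>n. (n, i - n)" fst]) auto

text \<open>
  Again \<open>\<tau>\<close> carries defining relations to defining relations; for the Leibniz relation this is the fact
  that twist and hyperderivatives commute.
\<close>

lemma prolongation_presentation:
  "presentation ({..k} \<times> carrier M) (prolongation_relations k M) (poly_twist q) (\<lambda>(i, m). (i, tau M m))"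
proof
  interpret s: additive_family "\<lambda>g a. Poly_Mapping.single ((\<lambda>(i, m). (i, tau M m)) g) (poly_twist q a :: 'k poly)"
    by unfold_locales (simp add: poly_twist_add single_add)
  fix r assume r: "r \<in> prolongation_relations k M"
  show "Poly_Mapping.keys r \<subseteq> {..k} \<times> carrier M"
    using r unfolding prolongation_relations_def prolongation_sum
    by (elim UnE CollectE exE conjE;
        simp add: keys_diff_subset keys_add_subset keys_sum_subset keys_single_subset del: keys_single)
  have "free_semilinear (poly_twist q) (\<lambda>(i, m). (i, tau M m)) r \<in> prolongation_relations k M"
    using r[unfolded prolongation_relations_def prolongation_sum]
  proof (elim UnE CollectE exE conjE)
    fix i m1 m2
    assume add: "i \<le> k" "m1 \<in> carrier M" "m2 \<in> carrier M"
      "r = Poly_Mapping.single (i, m1 \<oplus>\<^bsub>M\<^esub> m2) 1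
        - (Poly_Mapping.single (i, m1) 1 + Poly_Mapping.single (i, m2) 1)"
    have "free_semilinear (poly_twist q) (\<lambda>(i, m). (i, tau M m)) r =
        Poly_Mapping.single (i, tau M m1 \<oplus>\<^bsub>M\<^esub> tau M m2) 1
          - (Poly_Mapping.single (i, tau M m1) 1 + Poly_Mapping.single (i, tau M m2) 1)"
      using add by (simp add: free_semilinear_eq s.free_extend_diff s.free_extend_add poly_twist_1 tau_add)
    thus ?thesis unfolding prolongation_relations_def using add tau_closed by blast
  next
    fix i a m
    assume smult: "i \<le> k" "m \<in> carrier M"
      "r = Poly_Mapping.single (i, a \<odot>\<^bsub>M\<^esub> m) 1 - (\<Sum>n\<le>i. Poly_Mapping.single (i - n, m) (hyperderiv n a))"
    have "free_semilinear (poly_twist q) (\<lambda>(i, m). (i, tau M m)) r =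
        Poly_Mapping.single (i, poly_twist q a \<odot>\<^bsub>M\<^esub> tau M m) 1
          - (\<Sum>n\<le>i. Poly_Mapping.single (i - n, tau M m) (hyperderiv n (poly_twist q a)))"
      using smult by (simp add: free_semilinear_eq s.free_extend_diff s.free_extend_sum poly_twist_1
          tau_smult poly_twist_hyperderiv)
    thus ?thesis unfolding prolongation_relations_def prolongation_sum using smult tau_closed by blast
  qed
  thus "free_semilinear (poly_twist q) (\<lambda>(i, m). (i, tau M m)) r
      \<in> module_span type_ring (free_module ({..k} \<times> carrier M)) (prolongation_relations k M)"
    by (rule module_span_mem)
qed (auto simp: poly_twist_add poly_twist_mult tau_closed)

sublocale P: presentation "{..k} \<times> carrier M" "prolongation_relations k M" "poly_twist q" "\<lambda>(i, m). (i, tau M m)"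
  rewrites "presented_module ({..k} \<times> carrier M) (prolongation_relations k M) (poly_twist q) (\<lambda>(i, m). (i, tau M m)) =
    prolongation q k M"
  by (rule prolongation_presentation) (simp add: prolongation_def)

definition D :: "nat \<Rightarrow> 'm \<Rightarrow> ((nat \<times> 'm) \<Rightarrow>\<^sub>0 'k poly) set" where
  "D i m = P.coset (Poly_Mapping.single (i, m) 1)"

lemma D_smult_coset:
  assumes "i \<le> k" "m \<in> carrier M"
  shows "D i (a \<odot>\<^bsub>M\<^esub> m) = P.coset (\<Sum>n\<le>i. Poly_Mapping.single (i - n, m) (hyperderiv n a))"
  unfolding D_def P.coset_eq_iff
  by (rule P.Rel_N) (use assms in \<open>auto simp: prolongation_relations_def prolongation_sum\<close>)

sublocale H: hyperderivation_family M "prolongation q k M" hyperderiv D k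
proof (intro hyperderivation_family.intro hyperderivation_family_axioms.intro)
  show "module type_ring M" by (rule module_axioms)
  show "module type_ring (prolongation q k M)" by (rule P.P_module)
  fix i x y and a :: "'k poly" assume i: "i \<le> k" and x: "x \<in> carrier M"
  show "D i x \<in> carrier (prolongation q k M)"
    unfolding D_def by (rule P.coset_in_P) (use i x in auto)
  show "D i (x \<oplus>\<^bsub>M\<^esub> y) = D i x \<oplus>\<^bsub>prolongation q k M\<^esub> D i y" if "y \<in> carrier M"
    unfolding D_def P.P_add P.coset_eq_iff
    by (rule P.Rel_N) (use i x that in \<open>auto simp: prolongation_relations_def\<close>)
  have "D i (a \<odot>\<^bsub>M\<^esub> x) = P.coset (\<Sum>n\<le>i. Poly_Mapping.single (i - n, x) (hyperderiv n a))"
    by (rule D_smult_coset[OF i x])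
  also have "\<dots> = (\<Oplus>\<^bsub>prolongation q k M\<^esub>n\<in>{..i}. P.coset (Poly_Mapping.single (i - n, x) (hyperderiv n a)))"
    by (rule P.P_finsum [symmetric]) (use i x in \<open>simp_all add: keys_single_subset del: keys_single\<close>)
  also have "\<dots> = (\<Oplus>\<^bsub>prolongation q k M\<^esub>n\<in>{..i}. hyperderiv n a \<odot>\<^bsub>prolongation q k M\<^esub> D (i - n) x)"
    by (simp add: D_def P.P_smult scale_single)
  finally show "D i (a \<odot>\<^bsub>M\<^esub> x) =
      (\<Oplus>\<^bsub>prolongation q k M\<^esub>n\<in>{..i}. hyperderiv n a \<odot>\<^bsub>prolongation q k M\<^esub> D (i - n) x)" .
qed simp

lemma tau_D: "tau (prolongation q k M) (D i m) = D i (tau M m)"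
  by (simp add: D_def P.P_tau free_semilinear_eq P.s.free_extend_single poly_twist_1)

sublocale W: frobenius_module "prolongation q k M" q
  by (intro frobenius_module.intro P.P_semilinear frobenius_power_axioms)

text \<open>
  The map \<open>D\<^sub>i\<close> of \<open>K((1/t))\<close>-modules on representatives: \<open>m \<otimes> f \<mapsto> \<Sum>\<^sub>n D\<^bsub>i-n\<^esub> m \<otimes> \<partial>\<^sup>(\<^sup>n\<^sup>) f\<close>.
\<close>

definition free_ext :: "nat \<Rightarrow> ('m \<Rightarrow>\<^sub>0 'k fls) \<Rightarrow> (((nat \<times> 'm) \<Rightarrow>\<^sub>0 'k poly) set \<Rightarrow>\<^sub>0 'k fls)" where
  "free_ext i = free_extend (\<lambda>m f. \<Sum>n\<le>i. Poly_Mapping.single (D (i - n) m) (fls_hyperderiv (-1) n f))"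

sublocale E: additive_family "\<lambda>m f. \<Sum>n\<le>i. Poly_Mapping.single (D (i - n) m) (fls_hyperderiv (-1) n f)" for i
  by unfold_locales (simp add: fls_hyperderiv_add single_add sum.distrib)

lemma free_ext_single:
  "free_ext i (Poly_Mapping.single m f) =
    (\<Sum>n\<le>i. Poly_Mapping.single (D (i - n) m) (fls_hyperderiv (-1) n f))"
  by (simp add: free_ext_def)

lemma free_ext_add: "free_ext i (x + y) = free_ext i x + free_ext i y"
  by (simp add: free_ext_def E.free_extend_add)

lemma free_ext_0: "free_ext i 0 = 0"
  by (simp add: free_ext_def free_extend_def)

lemma free_ext_scale:
  "free_ext i (scale a x) = (\<Sum>p\<le>i. scale (fls_hyperderiv (-1) p a) (free_ext (i - p) x))"
proof -
  have "Poly_Mapping.keys x \<subseteq> UNIV" by simp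
  thus ?thesis
  proof (induction x rule: free_module_induct)
    case zero
    show ?case by (simp add: free_ext_0)
  next
    case (single m f)
    have "free_ext i (scale a (Poly_Mapping.single m f)) =
        (\<Sum>n\<le>i. \<Sum>p\<le>n. Poly_Mapping.single (D (i - n) m)
          (fls_hyperderiv (-1) p a * fls_hyperderiv (-1) (n - p) f))"
      by (simp add: free_ext_single scale_single fls_hyperderiv_mult single_sum)
    also have "\<dots> = (\<Sum>n\<le>i. \<Sum>p\<le>n. Poly_Mapping.single (D (i - p - (n - p)) m)
          (fls_hyperderiv (-1) p a * fls_hyperderiv (-1) (n - p) f))"
      by (intro sum.cong refl) simp
    also have "\<dots> = (\<Sum>p\<le>i. \<Sum>n\<le>i - p. Poly_Mapping.single (D (i - p - n) m)
          (fls_hyperderiv (-1) p a * fls_hyperderiv (-1) n f))"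
      by (rule sum_triangle)
    also have "\<dots> = (\<Sum>p\<le>i. scale (fls_hyperderiv (-1) p a) (free_ext (i - p) (Poly_Mapping.single m f)))"
      by (simp add: free_ext_single scale_sum scale_single)
    finally show ?case .
  next
    case (add x y)
    thus ?case by (simp add: free_ext_add scale_add sum.distrib)
  qed
qed

lemma free_ext_generator: "free_ext i (Poly_Mapping.single m 1) = Poly_Mapping.single (D i m) 1"
proof -
  have "free_ext i (Poly_Mapping.single m 1) =
      (\<Sum>n\<le>i. if n = 0 then Poly_Mapping.single (D i m) 1 else 0)"
    unfolding free_ext_def E.free_extend_single by (intro sum.cong) (auto simp: fls_hyperderiv_one)
  thus ?thesis by simp
qed

lemma keys_free_ext:
  assumes "i \<le> k" "Poly_Mapping.keys x \<subseteq> carrier M"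
  shows "Poly_Mapping.keys (free_ext i x) \<subseteq> carrier (prolongation q k M)"
  unfolding free_ext_def free_extend_def
  by (intro keys_sum_subset keys_single_subset H.D_closed) (use assms in auto)

text \<open>
  For the relation \<open>(a m) \<otimes> 1 = m \<otimes> a\<close> this is the Leibniz relation of the prolongation, moved across the
  tensor sign.
\<close>

lemma free_ext_relation:
  assumes "i \<le> k" "r \<in> base_change_relations M"
  shows "free_ext i r \<in> W.B.N"
  using assms(2)[unfolded base_change_relations_def]
proof (elim UnE CollectE exE conjE)
  fix m1 m2
  assume r: "m1 \<in> carrier M" "m2 \<in> carrier M"
    "r = Poly_Mapping.single (m1 \<oplus>\<^bsub>M\<^esub> m2) 1 - (Poly_Mapping.single m1 1 + Poly_Mapping.single m2 1)"
  have "free_ext i r = Poly_Mapping.single (D i (m1 \<oplus>\<^bsub>M\<^esub> m2)) 1 -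
      (Poly_Mapping.single (D i m1) 1 + Poly_Mapping.single (D i m2) 1)"
    unfolding r(3) free_ext_generator[symmetric]
    by (simp only: free_ext_def E.free_extend_diff E.free_extend_add)
  also have "W.B.coset (Poly_Mapping.single (D i (m1 \<oplus>\<^bsub>M\<^esub> m2)) 1) =
      W.B.coset (Poly_Mapping.single (D i m1) 1 + Poly_Mapping.single (D i m2) 1)"
    using W.tensor_add[of "D i m1" "D i m2"] assms(1) r H.D_add[of i m1 m2] H.D_closed[of i]
    by (simp add: W.tensor_def W.B.P_add)
  hence "Poly_Mapping.single (D i (m1 \<oplus>\<^bsub>M\<^esub> m2)) 1 -
      (Poly_Mapping.single (D i m1) 1 + Poly_Mapping.single (D i m2) 1) \<in> W.B.N"
    by (simp only: W.B.coset_eq_iff)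
  finally show ?thesis .
next
  fix a m
  assume r: "m \<in> carrier M"
    "r = Poly_Mapping.single (a \<odot>\<^bsub>M\<^esub> m) 1 - Poly_Mapping.single m (poly_at_infinity a)"
  have "free_ext i r = Poly_Mapping.single (D i (a \<odot>\<^bsub>M\<^esub> m)) 1 -
      (\<Sum>n\<le>i. Poly_Mapping.single (D (i - n) m) (poly_at_infinity (hyperderiv n a)))"
    unfolding r(2) free_ext_generator[symmetric]
    by (simp add: free_ext_def E.free_extend_diff poly_at_infinity_hyperderiv)
  moreover have "W.tensor (D i (a \<odot>\<^bsub>M\<^esub> m)) =
      W.B.coset (\<Sum>n\<le>i. Poly_Mapping.single (D (i - n) m) (poly_at_infinity (hyperderiv n a)))"
    unfolding H.D_smult[OF assms(1) r(1)]
    by (rule W.tensor_finsum) (use assms(1) r(1) H.D_closed in auto)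
  ultimately show ?thesis by (simp only: W.tensor_def W.B.coset_eq_iff)
qed

text \<open>
  The maps \<open>D\<^sub>0, \<dots>, D\<^sub>k\<close> are treated simultaneously, since the preimage of a submodule under a single
  one of them need not be closed under scalars.
\<close>

lemma free_ext_N:
  assumes "i \<le> k" "x \<in> B.N"
  shows "free_ext i x \<in> W.B.N"
proof -
  have "submodule {x. Poly_Mapping.keys x \<subseteq> carrier M \<and> (\<forall>i\<le>k. free_ext i x \<in> W.B.N)}
      type_ring (free_module (carrier M))"
  proof (rule B.F.submoduleI_smult)
    fix a :: "'k fls" and x
    assume x: "x \<in> {x. Poly_Mapping.keys x \<subseteq> carrier M \<and> (\<forall>i\<le>k. free_ext i x \<in> W.B.N)}"
    have "free_ext i (scale a x) \<in> W.B.N" if "i \<le> k" for i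
      unfolding free_ext_scale by (intro W.B.N_sum W.B.N_scale) (use x that in auto)
    thus "a \<odot>\<^bsub>free_module (carrier M)\<^esub> x \<in> {x. Poly_Mapping.keys x \<subseteq> carrier M \<and> (\<forall>i\<le>k. free_ext i x \<in> W.B.N)}"
      using x keys_scale[of a x] by auto
  qed (auto simp: free_ext_add keys_add_subset W.B.N_add, auto simp: free_ext_0 W.B.N_0)
  hence "B.N \<subseteq> {x. Poly_Mapping.keys x \<subseteq> carrier M \<and> (\<forall>i\<le>k. free_ext i x \<in> W.B.N)}"
    unfolding B.N_def
    by (rule module_span_least) (use B.Rel_keys free_ext_relation in auto)
  thus ?thesis using assms by auto
qed

definition D_inf :: "nat \<Rightarrow> ('m \<Rightarrow>\<^sub>0 'k fls) set \<Rightarrow> (((nat \<times> 'm) \<Rightarrow>\<^sub>0 'k poly) set \<Rightarrow>\<^sub>0 'k fls) set" where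
  "D_inf i C = (\<Union>x\<in>C. W.B.coset (free_ext i x))"

lemma D_inf_coset: "i \<le> k \<Longrightarrow> D_inf i (B.coset x) = W.B.coset (free_ext i x)"
  unfolding D_inf_def
  by (rule coset_image[OF B.free_submodule_axioms W.B.free_submodule_axioms free_ext_add free_ext_N])

lemma free_ext_tau:
  assumes "i \<le> k" "Poly_Mapping.keys x \<subseteq> carrier M"
  shows "free_ext i (free_semilinear (fls_twist q) (tau M) x) =
    free_semilinear (fls_twist q) (tau (prolongation q k M)) (free_ext i x)"
  using assms(2)
proof (induction x rule: free_module_induct)
  case zero
  show ?case by (simp add: free_ext_def free_semilinear_def)
next
  case (single m f)
  show ?case
    by (simp add: free_ext_def free_semilinear_eq W.B.s.free_extend_sum tau_D fls_twist_hyperderiv)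
next
  case (add x y)
  thus ?case by (simp only: free_ext_add B.free_semilinear_add W.B.free_semilinear_add)
qed

lemma D_inf_tensor: "i \<le> k \<Longrightarrow> D_inf i (tensor m) = W.tensor (D i m)"
  by (simp add: tensor_def W.tensor_def D_inf_coset free_ext_generator)

sublocale X: hyperderivation_family "base_change q M" "base_change q (prolongation q k M)"
    "fls_hyperderiv (-1)" D_inf k
proof (intro hyperderivation_family.intro hyperderivation_family_axioms.intro)
  show "module type_ring (base_change q M)" by (rule B.P_module)
  show "module type_ring (base_change q (prolongation q k M))" by (rule W.B.P_module)
  fix i a c d assume i: "i \<le> k" and c: "c \<in> carrier (base_change q M)"
  then obtain x where x: "c = B.coset x" "Poly_Mapping.keys x \<subseteq> carrier M"
    by (auto simp: B.P_carrier)
  show "D_inf i c \<in> carrier (base_change q (prolongation q k M))"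
    unfolding x(1) D_inf_coset[OF i] by (intro W.B.coset_in_P keys_free_ext i x(2))
  show "D_inf i (c \<oplus>\<^bsub>base_change q M\<^esub> d) =
      D_inf i c \<oplus>\<^bsub>base_change q (prolongation q k M)\<^esub> D_inf i d" if d: "d \<in> carrier (base_change q M)"
  proof -
    obtain y where y: "d = B.coset y" using d by (auto simp: B.P_carrier)
    show ?thesis by (simp add: x(1) y B.P_add D_inf_coset i free_ext_add W.B.P_add)
  qed
  interpret BW: module type_ring "base_change q (prolongation q k M)" by (rule W.B.P_module)
  have keys_p: "Poly_Mapping.keys (scale b (free_ext (i - p) x)) \<subseteq> carrier (prolongation q k M)" for b p
    using keys_scale[of b] keys_free_ext[OF _ x(2), of "i - p"] i by (meson diff_le_self le_trans subset_trans)
  have "D_inf i (a \<odot>\<^bsub>base_change q M\<^esub> c) =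
      W.B.coset (\<Sum>p\<le>i. scale (fls_hyperderiv (-1) p a) (free_ext (i - p) x))"
    by (simp add: x(1) B.P_smult D_inf_coset i free_ext_scale)
  also have "\<dots> = (\<Oplus>\<^bsub>base_change q (prolongation q k M)\<^esub>p\<in>{..i}.
      W.B.coset (scale (fls_hyperderiv (-1) p a) (free_ext (i - p) x)))"
    by (rule W.B.P_finsum [symmetric]) (use i in \<open>auto intro: keys_p[THEN subsetD]\<close>)
  also have "\<dots> = (\<Oplus>\<^bsub>base_change q (prolongation q k M)\<^esub>p\<in>{..i}.
      fls_hyperderiv (-1) p a \<odot>\<^bsub>base_change q (prolongation q k M)\<^esub> D_inf (i - p) c)"
  proof (rule BW.M.finsum_cong' [symmetric])
    show "fls_hyperderiv (-1) p a \<odot>\<^bsub>base_change q (prolongation q k M)\<^esub> D_inf (i - p) c =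
        W.B.coset (scale (fls_hyperderiv (-1) p a) (free_ext (i - p) x))" if "p \<in> {..i}" for p
      using i that by (simp add: x(1) D_inf_coset W.B.P_smult)
  qed (auto intro!: W.B.coset_in_P keys_p)
  finally show "D_inf i (a \<odot>\<^bsub>base_change q M\<^esub> c) =
    (\<Oplus>\<^bsub>base_change q (prolongation q k M)\<^esub>p\<in>{..i}.
      fls_hyperderiv (-1) p a \<odot>\<^bsub>base_change q (prolongation q k M)\<^esub> D_inf (i - p) c)" .
qed simp

text \<open>
  The elements \<open>y\<close> of \<open>\<rho>\<^sub>k M\<close> whose \<open>y \<otimes> 1\<close> lies in the span form a \<open>K[t]\<close>-submodule containing all
  \<open>D\<^sub>i m\<close>, because \<open>D\<^sub>i m \<otimes> 1 = D\<^sub>i (m \<otimes> 1)\<close>.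
\<close>

lemma D_inf_generate:
  "module_span type_ring (base_change q (prolongation q k M)) (\<Union>i\<le>k. D_inf i ` carrier (base_change q M)) =
    carrier (base_change q (prolongation q k M))" (is "?N = _")
proof -
  have N: "submodule ?N type_ring (base_change q (prolongation q k M))"
    by (rule module_span_submodule[OF W.B.P_module]) (auto intro: X.D_closed)
  have "submodule {y \<in> carrier (prolongation q k M). W.tensor y \<in> ?N} type_ring (prolongation q k M)"
  proof (rule H.W.submoduleI_smult)
    have "W.tensor \<zero>\<^bsub>prolongation q k M\<^esub> = W.tensor (0 \<odot>\<^bsub>prolongation q k M\<^esub> \<zero>\<^bsub>prolongation q k M\<^esub>)"
      by simp
    also have "\<dots> = 0 \<odot>\<^bsub>base_change q (prolongation q k M)\<^esub> W.tensor \<zero>\<^bsub>prolongation q k M\<^esub>"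
      by (subst W.tensor_smult) (simp_all add: poly_at_infinity_0)
    also have "\<dots> \<in> ?N"
      using X.W.submodule_zero[OF N] W.tensor_closed[of "\<zero>\<^bsub>prolongation q k M\<^esub>"] X.W.smult_l_null by simp
    finally show "\<zero>\<^bsub>prolongation q k M\<^esub> \<in> {y \<in> carrier (prolongation q k M). W.tensor y \<in> ?N}" by simp
  qed (use X.W.submoduleE(4,5)[OF N] in \<open>auto simp: W.tensor_add W.tensor_smult\<close>)
  moreover have "P.coset (Poly_Mapping.single g 1) \<in> {y \<in> carrier (prolongation q k M). W.tensor y \<in> ?N}"
    if g: "g \<in> {..k} \<times> carrier M" for g
  proof -
    obtain i m where im: "g = (i, m)" "i \<le> k" "m \<in> carrier M" using g by auto
    have "W.tensor (D i m) \<in> ?N"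
      unfolding D_inf_tensor[OF im(2), symmetric]
      using im tensor_closed by (intro module_span_mem UN_I[of i] imageI) simp_all
    thus ?thesis using im H.D_closed[of i m] by (simp add: D_def)
  qed
  ultimately have "{y \<in> carrier (prolongation q k M). W.tensor y \<in> ?N} = carrier (prolongation q k M)"
    by (rule P.P_generated)
  hence "W.tensor y \<in> ?N" if "y \<in> carrier (prolongation q k M)" for y using that by blast
  thus ?thesis
    by (intro W.B.P_generated[OF N]) (simp add: W.tensor_def)
qed

sublocale prolongation_at_infinity "base_change q M" "base_change q (prolongation q k M)" D_inf k q
proof (intro prolongation_at_infinity.intro prolongation_at_infinity_axioms.intro)
  fix i c assume i: "i \<le> k" and "c \<in> carrier (base_change q M)"
  then obtain x where "c = B.coset x" "Poly_Mapping.keys x \<subseteq> carrier M"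
    by (auto simp: B.P_carrier)
  thus "D_inf i (tau (base_change q M) c) = tau (base_change q (prolongation q k M)) (D_inf i c)"
    by (simp add: B.P_tau W.B.P_tau D_inf_coset i free_ext_tau)
qed (rule X.hyperderivation_family_axioms B.P_semilinear W.B.P_semilinear frobenius_power_axioms D_inf_generate)+

lemma prolongation_pure:
  assumes "pure_of_weight q M w"
  shows "pure_of_weight q (prolongation q k M) w"
proof -
  obtain H u v where H: "is_lattice (base_change q M) H" "u \<ge> 1" "v \<ge> 1"
      "(\<lambda>h. fls_X_inv ^ u \<odot>\<^bsub>base_change q M\<^esub> h) ` H =
        module_span inverse_t_series (base_change q M) ((tau (base_change q M) ^^ v) ` H)"
      "w = of_nat u / of_nat v"
    using assms by (auto simp: pure_of_weight_def Let_def)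
  moreover have "submodule H inverse_t_series (base_change q M)"
    using H(1) by (simp add: is_lattice_def)
  ultimately show ?thesis
    unfolding pure_of_weight_def Let_def
    using prolong_lattice[OF H(1)] prolong_pure[of H u v] by blast
qed

end


section \<open>Prolonging matrices\<close>

text \<open>
  Indices below \<open>n * r\<close> are read as pairs of a block \<open>p div r\<close> and a position \<open>p mod r\<close> in it.
\<close>

lemma sum_blocks:
  fixes f :: "nat \<Rightarrow> 'a::comm_monoid_add"
  shows "(\<Sum>p<n * r. f p) = (\<Sum>i<n. \<Sum>j<r. f (i * r + j))"
proof -
  have "(\<Sum>p<n * r. f p) = (\<Sum>i<n. \<Sum>p=i * r..<i * r + r. f p)"
    by (rule sum.nat_group [symmetric])
  also have "\<dots> = (\<Sum>i<n. \<Sum>j<r. f (i * r + j))"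
  proof (rule sum.cong[OF refl])
    fix i
    show "(\<Sum>p=i * r..<i * r + r. f p) = (\<Sum>j<r. f (i * r + j))"
      using sum.shift_bounds_nat_ivl[of f 0 "i * r" r] by (simp add: add.commute atLeast0LessThan)
  qed
  finally show ?thesis .
qed

lemma block_index:
  assumes "p < n * (r :: nat)"
  shows "p div r < n" "p mod r < r"
proof -
  have "0 < r" using assms by (cases r) auto
  thus "p div r < n" "p mod r < r" using assms by (auto simp: less_mult_imp_div_less)
qed

text \<open>
  The block upper triangular Toeplitz matrix with \<open>\<delta>\<^sub>n A\<close> on the \<open>n\<close>-th block diagonal, that is
  \<open>\<Sum>\<^sub>n \<delta>\<^sub>n(A) \<epsilon>\<^sup>n\<close> with \<open>\<epsilon>\<close> the nilpotent shift of \<open>k + 1\<close> blocks.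
\<close>

definition prolong_mat :: "(nat \<Rightarrow> 'x \<Rightarrow> 'x) \<Rightarrow> nat \<Rightarrow> nat \<Rightarrow> 'x::zero mat \<Rightarrow> 'x mat" where
  "prolong_mat \<delta> k r A = mat (Suc k * r) (Suc k * r)
     (\<lambda>(p, p'). if p div r \<le> p' div r then \<delta> (p' div r - p div r) (A $$ (p mod r, p' mod r)) else 0)"

lemma prolong_mat_carrier [simp]: "prolong_mat \<delta> k r A \<in> carrier_mat (Suc k * r) (Suc k * r)"
  by (simp add: prolong_mat_def)

text \<open>
  The Leibniz rule says that \<open>a \<mapsto> \<Sum>\<^sub>n \<delta>\<^sub>n(a) \<epsilon>\<^sup>n\<close> is multiplicative, hence so is the induced map on matrices.
\<close>

lemma prolong_mat_mult:
  fixes \<delta> :: "nat \<Rightarrow> 'x::comm_ring_1 \<Rightarrow> 'x"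
  assumes sum: "\<And>n f A. \<delta> n (\<Sum>i\<in>A. f i) = (\<Sum>i\<in>(A :: nat set). \<delta> n (f i))"
    and Leibniz: "\<And>n a b. \<delta> n (a * b) = (\<Sum>i\<le>n. \<delta> i a * \<delta> (n - i) b)"
    and A: "A \<in> carrier_mat r r" and B: "B \<in> carrier_mat r r"
  shows "prolong_mat \<delta> k r (A * B) = prolong_mat \<delta> k r A * prolong_mat \<delta> k r B"
proof (rule eq_matI)
  fix p p' assume "p < dim_row (prolong_mat \<delta> k r A * prolong_mat \<delta> k r B)"
    and "p' < dim_col (prolong_mat \<delta> k r A * prolong_mat \<delta> k r B)"
  hence p: "p < Suc k * r" "p' < Suc k * r" by (simp_all add: prolong_mat_def)
  define i j i' j' where ij: "i = p div r" "j = p mod r" "i' = p' div r" "j' = p' mod r"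
  have bounds: "i < Suc k" "j < r" "i' < Suc k" "j' < r"
    unfolding ij using block_index[OF p(1)] block_index[OF p(2)] by auto
  have "(prolong_mat \<delta> k r A * prolong_mat \<delta> k r B) $$ (p, p') =
      (\<Sum>t<Suc k * r. prolong_mat \<delta> k r A $$ (p, t) * prolong_mat \<delta> k r B $$ (t, p'))"
    using p by (simp add: scalar_prod_def prolong_mat_def lessThan_atLeast0)
  also have "\<dots> = (\<Sum>t<Suc k * r. (if i \<le> t div r then \<delta> (t div r - i) (A $$ (j, t mod r)) else 0) *
      (if t div r \<le> i' then \<delta> (i' - t div r) (B $$ (t mod r, j')) else 0))"
    using p by (intro sum.cong) (auto simp: prolong_mat_def ij)
  also have "\<dots> = (\<Sum>s<Suc k. \<Sum>h<r. (if i \<le> s then \<delta> (s - i) (A $$ (j, h)) else 0) *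
      (if s \<le> i' then \<delta> (i' - s) (B $$ (h, j')) else 0))"
    unfolding sum_blocks by (intro sum.cong refl) simp
  also have "\<dots> = (\<Sum>h<r. \<Sum>s<Suc k. (if i \<le> s then \<delta> (s - i) (A $$ (j, h)) else 0) *
      (if s \<le> i' then \<delta> (i' - s) (B $$ (h, j')) else 0))"
    by (rule sum.swap)
  also have "\<dots> = (\<Sum>h<r. if i \<le> i' then \<delta> (i' - i) (A $$ (j, h) * B $$ (h, j')) else 0)"
  proof (rule sum.cong[OF refl])
    fix h
    have "(\<Sum>s<Suc k. (if i \<le> s then \<delta> (s - i) (A $$ (j, h)) else 0) *
        (if s \<le> i' then \<delta> (i' - s) (B $$ (h, j')) else 0)) =
        (\<Sum>s\<in>{i..i'}. \<delta> (s - i) (A $$ (j, h)) * \<delta> (i' - s) (B $$ (h, j')))"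
      using bounds by (intro sum.mono_neutral_cong_right) auto
    also have "\<dots> = (if i \<le> i' then \<delta> (i' - i) (A $$ (j, h) * B $$ (h, j')) else 0)"
    proof (cases "i \<le> i'")
      case True
      have "(\<Sum>s\<in>{i..i'}. \<delta> (s - i) (A $$ (j, h)) * \<delta> (i' - s) (B $$ (h, j'))) =
          (\<Sum>n\<le>i' - i. \<delta> n (A $$ (j, h)) * \<delta> (i' - i - n) (B $$ (h, j')))"
        using True by (intro sum.reindex_bij_witness[of _ "\<lambda>n. n + i" "\<lambda>s. s - i"]) auto
      thus ?thesis using True by (simp add: Leibniz)
    qed simp
    finally show "(\<Sum>s<Suc k. (if i \<le> s then \<delta> (s - i) (A $$ (j, h)) else 0) *
        (if s \<le> i' then \<delta> (i' - s) (B $$ (h, j')) else 0)) =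
        (if i \<le> i' then \<delta> (i' - i) (A $$ (j, h) * B $$ (h, j')) else 0)" .
  qed
  also have "\<dots> = (if i \<le> i' then \<delta> (i' - i) ((A * B) $$ (j, j')) else 0)"
    using bounds A B by (simp add: scalar_prod_def sum lessThan_atLeast0)
  also have "\<dots> = prolong_mat \<delta> k r (A * B) $$ (p, p')"
    using p by (simp add: prolong_mat_def ij)
  finally show "prolong_mat \<delta> k r (A * B) $$ (p, p') = (prolong_mat \<delta> k r A * prolong_mat \<delta> k r B) $$ (p, p')" ..
qed (simp_all add: prolong_mat_def)

lemma map_mat_prolong_mat:
  assumes "A \<in> carrier_mat r r" "\<And>n a. g (\<delta> n a) = \<delta>' n (g a)" "g 0 = 0"
  shows "map_mat g (prolong_mat \<delta> k r A) = prolong_mat \<delta>' k r (map_mat g A)"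
proof (rule eq_matI)
  fix p p' assume "p < dim_row (prolong_mat \<delta>' k r (map_mat g A))" "p' < dim_col (prolong_mat \<delta>' k r (map_mat g A))"
  hence p: "p < Suc k * r" "p' < Suc k * r" by (simp_all add: prolong_mat_def)
  thus "map_mat g (prolong_mat \<delta> k r A) $$ (p, p') = prolong_mat \<delta>' k r (map_mat g A) $$ (p, p')"
    using assms block_index[OF p(1)] block_index[OF p(2)] by (simp add: prolong_mat_def)
qed (simp_all add: prolong_mat_def)

lemma prolong_mat_one: "prolong_mat fps_hyperderiv k r (1\<^sub>m r) = (1\<^sub>m (Suc k * r) :: 'a::field fps mat)"
proof (rule eq_matI)
  fix p p' assume "p < dim_row (1\<^sub>m (Suc k * r) :: 'a fps mat)" "p' < dim_col (1\<^sub>m (Suc k * r) :: 'a fps mat)"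
  hence p: "p < Suc k * r" "p' < Suc k * r" by simp_all
  have "p = p' \<longleftrightarrow> p div r = p' div r \<and> p mod r = p' mod r"
    by (metis div_mult_mod_eq)
  moreover have "fps_hyperderiv n (if b then 1 else 0) = (if n = 0 \<and> b then 1 else (0 :: 'a fps))" for n b
    using fps_hyperderiv_const[of n "1 :: 'a"] fps_hyperderiv_const[of n "0 :: 'a"] by auto
  ultimately show "prolong_mat fps_hyperderiv k r (1\<^sub>m r) $$ (p, p') = (1\<^sub>m (Suc k * r) :: 'a fps mat) $$ (p, p')"
    using p block_index[OF p(1)] block_index[OF p(2)] by (auto simp: prolong_mat_def)
qed (simp_all add: prolong_mat_def)


section \<open>A basis of the prolongation\<close>

context prolonged_module
begin

lemma D_finsum:
  assumes "i \<le> k" "finite A" "\<And>j. j \<in> A \<Longrightarrow> e j \<in> carrier M"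
  shows "D i (\<Oplus>\<^bsub>M\<^esub>j\<in>A. c j \<odot>\<^bsub>M\<^esub> e j) =
    P.coset (\<Sum>j\<in>A. \<Sum>n\<le>i. Poly_Mapping.single (i - n, e j) (hyperderiv n (c j)))"
  using assms(2,3)
proof (induction A rule: finite_induct)
  case empty
  show ?case using H.D_zero[OF assms(1)] by (simp add: P.P_zero)
next
  case (insert j A)
  have "(\<lambda>j. c j \<odot>\<^bsub>M\<^esub> e j) \<in> A \<rightarrow> carrier M" "c j \<odot>\<^bsub>M\<^esub> e j \<in> carrier M" using insert.prems by auto
  hence "D i (\<Oplus>\<^bsub>M\<^esub>j\<in>insert j A. c j \<odot>\<^bsub>M\<^esub> e j) =
      D i (c j \<odot>\<^bsub>M\<^esub> e j) \<oplus>\<^bsub>prolongation q k M\<^esub> D i (\<Oplus>\<^bsub>M\<^esub>j\<in>A. c j \<odot>\<^bsub>M\<^esub> e j)"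
    using insert.hyps assms(1) by (simp add: M.finsum_insert H.D_add)
  also have "D i (c j \<odot>\<^bsub>M\<^esub> e j) = P.coset (\<Sum>n\<le>i. Poly_Mapping.single (i - n, e j) (hyperderiv n (c j)))"
    using D_smult_coset assms(1) insert.prems by simp
  also have "D i (\<Oplus>\<^bsub>M\<^esub>j\<in>A. c j \<odot>\<^bsub>M\<^esub> e j) =
      P.coset (\<Sum>j\<in>A. \<Sum>n\<le>i. Poly_Mapping.single (i - n, e j) (hyperderiv n (c j)))"
    using insert by simp
  finally show ?case using insert.hyps by (simp add: P.P_add)
qed

end

locale prolonged_basis = prolonged_module M q k for M :: "('k::field poly, 'm) tau_module" and q k :: nat +
  fixes r :: nat and e :: "nat \<Rightarrow> 'm"
  assumes basis: "module_basis type_ring M r e"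
begin

lemma e_closed: "j < r \<Longrightarrow> e j \<in> carrier M"
  using basis by (auto simp: module_basis_def)

lemma basis_unique:
  assumes "(\<Oplus>\<^bsub>M\<^esub>j\<in>{..<r}. c j \<odot>\<^bsub>M\<^esub> e j) = (\<Oplus>\<^bsub>M\<^esub>j\<in>{..<r}. d j \<odot>\<^bsub>M\<^esub> e j)" "j < r"
  shows "c j = d j"
proof -
  let ?m = "\<Oplus>\<^bsub>M\<^esub>j\<in>{..<r}. c j \<odot>\<^bsub>M\<^esub> e j"
  have m: "?m \<in> carrier M" using e_closed by (intro M.finsum_closed) auto
  have restr: "(\<Oplus>\<^bsub>M\<^esub>j\<in>{..<r}. restrict f {..<r} j \<odot>\<^bsub>M\<^esub> e j) = (\<Oplus>\<^bsub>M\<^esub>j\<in>{..<r}. f j \<odot>\<^bsub>M\<^esub> e j)" for f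
    using e_closed by (intro M.finsum_cong') auto
  have unique: "\<exists>!c. c \<in> {..<r} \<rightarrow>\<^sub>E UNIV \<and> ?m = (\<Oplus>\<^bsub>M\<^esub>j\<in>{..<r}. c j \<odot>\<^bsub>M\<^esub> e j)"
    using basis m by (auto simp: module_basis_def)
  have c: "restrict c {..<r} \<in> {..<r} \<rightarrow>\<^sub>E UNIV \<and> ?m = (\<Oplus>\<^bsub>M\<^esub>j\<in>{..<r}. restrict c {..<r} j \<odot>\<^bsub>M\<^esub> e j)"
    unfolding restr by simp
  have d: "restrict d {..<r} \<in> {..<r} \<rightarrow>\<^sub>E UNIV \<and> ?m = (\<Oplus>\<^bsub>M\<^esub>j\<in>{..<r}. restrict d {..<r} j \<odot>\<^bsub>M\<^esub> e j)"
    unfolding restr using assms(1) by simp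
  from unique have "restrict c {..<r} = restrict d {..<r}" by (rule ex1E) (metis c d)
  thus ?thesis using assms(2) by (metis lessThan_iff restrict_apply')
qed

text \<open>
  Coordinates with respect to the basis \<open>e\<close>; only the indices below \<open>r\<close> are meaningful.
\<close>

definition coord :: "'m \<Rightarrow> nat \<Rightarrow> 'k poly" where
  "coord m = (SOME c. m = (\<Oplus>\<^bsub>M\<^esub>j\<in>{..<r}. c j \<odot>\<^bsub>M\<^esub> e j))"

lemma coord_expansion:
  assumes "m \<in> carrier M"
  shows "(\<Oplus>\<^bsub>M\<^esub>j\<in>{..<r}. coord m j \<odot>\<^bsub>M\<^esub> e j) = m"
proof -
  have "\<exists>c. m = (\<Oplus>\<^bsub>M\<^esub>j\<in>{..<r}. c j \<odot>\<^bsub>M\<^esub> e j)"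
    using basis assms unfolding module_basis_def by blast
  from someI_ex[OF this] show ?thesis by (simp add: coord_def)
qed

lemma coord_add:
  assumes "x \<in> carrier M" "y \<in> carrier M" "j < r"
  shows "coord (x \<oplus>\<^bsub>M\<^esub> y) j = coord x j + coord y j"
proof (rule basis_unique[OF _ assms(3)])
  have "(\<Oplus>\<^bsub>M\<^esub>j\<in>{..<r}. (coord x j + coord y j) \<odot>\<^bsub>M\<^esub> e j) =
      (\<Oplus>\<^bsub>M\<^esub>j\<in>{..<r}. coord x j \<odot>\<^bsub>M\<^esub> e j \<oplus>\<^bsub>M\<^esub> coord y j \<odot>\<^bsub>M\<^esub> e j)"
    using e_closed smult_l_distr by (intro M.finsum_cong') auto
  also have "\<dots> = x \<oplus>\<^bsub>M\<^esub> y"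
    using e_closed coord_expansion assms by (subst M.finsum_addf) auto
  finally show "(\<Oplus>\<^bsub>M\<^esub>j\<in>{..<r}. coord (x \<oplus>\<^bsub>M\<^esub> y) j \<odot>\<^bsub>M\<^esub> e j) =
      (\<Oplus>\<^bsub>M\<^esub>j\<in>{..<r}. (coord x j + coord y j) \<odot>\<^bsub>M\<^esub> e j)"
    using coord_expansion assms by simp
qed

lemma coord_smult:
  assumes "x \<in> carrier M" "j < r"
  shows "coord (a \<odot>\<^bsub>M\<^esub> x) j = a * coord x j"
proof (rule basis_unique[OF _ assms(2)])
  have "(\<Oplus>\<^bsub>M\<^esub>j\<in>{..<r}. (a * coord x j) \<odot>\<^bsub>M\<^esub> e j) =
      (\<Oplus>\<^bsub>M\<^esub>j\<in>{..<r}. a \<odot>\<^bsub>M\<^esub> (coord x j \<odot>\<^bsub>M\<^esub> e j))"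
    using e_closed smult_assoc1 by (intro M.finsum_cong') auto
  also have "\<dots> = a \<odot>\<^bsub>M\<^esub> (\<Oplus>\<^bsub>M\<^esub>j\<in>{..<r}. coord x j \<odot>\<^bsub>M\<^esub> e j)"
    using e_closed by (intro finsum_smult_ldistr [symmetric]) auto
  finally show "(\<Oplus>\<^bsub>M\<^esub>j\<in>{..<r}. coord (a \<odot>\<^bsub>M\<^esub> x) j \<odot>\<^bsub>M\<^esub> e j) =
      (\<Oplus>\<^bsub>M\<^esub>j\<in>{..<r}. (a * coord x j) \<odot>\<^bsub>M\<^esub> e j)"
    using coord_expansion assms by simp
qed

lemma coord_basis:
  assumes "l < r" "j < r"
  shows "coord (e l) j = (if j = l then 1 else 0)"
proof (rule basis_unique[OF _ assms(2)])
  have "(\<Oplus>\<^bsub>M\<^esub>j\<in>{..<r}. (if j = l then 1 else 0) \<odot>\<^bsub>M\<^esub> e j) =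
      (\<Oplus>\<^bsub>M\<^esub>j\<in>{..<r}. if l = j then e j else \<zero>\<^bsub>M\<^esub>)"
    using e_closed smult_one smult_l_null by (intro M.finsum_cong') auto
  also have "\<dots> = e l"
    using e_closed assms(1) by (intro M.add.finprod_singleton) auto
  finally show "(\<Oplus>\<^bsub>M\<^esub>j\<in>{..<r}. coord (e l) j \<odot>\<^bsub>M\<^esub> e j) =
      (\<Oplus>\<^bsub>M\<^esub>j\<in>{..<r}. (if j = l then 1 else 0) \<odot>\<^bsub>M\<^esub> e j)"
    using coord_expansion e_closed assms by simp
qed

text \<open>
  The linear form on the free module on the symbols \<open>D\<^sub>i m\<close> that gives the coefficient at \<open>D\<^bsub>i'\<^esub> e\<^sub>j\<close>:
  expanding \<open>m\<close> in the basis, the Leibniz rule shows that it is \<open>\<partial>\<^bsup>(i - i')\<^esup>\<close> of the \<open>j\<close>-th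
  coordinate of \<open>m\<close>.
\<close>

definition dual_coord :: "nat \<Rightarrow> nat \<Rightarrow> ((nat \<times> 'm) \<Rightarrow>\<^sub>0 'k poly) \<Rightarrow> 'k poly" where
  "dual_coord i' j = free_extend (\<lambda>g a. if i' \<le> fst g then a * hyperderiv (fst g - i') (coord (snd g) j) else 0)"

sublocale L: additive_family "\<lambda>g a. if i' \<le> fst g then a * hyperderiv (fst g - i') (coord (snd g) j) else 0" for i' j
  by unfold_locales (simp add: algebra_simps)

lemma dual_coord_scale: "dual_coord i' j (scale a x) = a * dual_coord i' j x"
proof -
  have "Poly_Mapping.keys x \<subseteq> UNIV" by simp
  thus ?thesis
    by (induction x rule: free_module_induct)
       (auto simp: dual_coord_def L.free_extend_add scale_add scale_single algebra_simps)
qed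

text \<open>
  On the Leibniz relation this is the Leibniz rule for \<open>a\<close> times the coordinate.
\<close>

lemma dual_coord_relation:
  assumes "j < r" "x \<in> prolongation_relations k M"
  shows "dual_coord i' j x = 0"
  using assms(2)[unfolded prolongation_relations_def prolongation_sum]
proof (elim UnE CollectE exE conjE)
  fix i m1 m2
  assume "i \<le> k" "m1 \<in> carrier M" "m2 \<in> carrier M"
    "x = Poly_Mapping.single (i, m1 \<oplus>\<^bsub>M\<^esub> m2) 1
      - (Poly_Mapping.single (i, m1) 1 + Poly_Mapping.single (i, m2) 1)"
  thus ?thesis using assms(1)
    by (simp add: dual_coord_def L.free_extend_diff L.free_extend_add coord_add hyperderiv_add)
next
  fix i a m
  assume x: "i \<le> k" "m \<in> carrier M"
    "x = Poly_Mapping.single (i, a \<odot>\<^bsub>M\<^esub> m) 1 - (\<Sum>n\<le>i. Poly_Mapping.single (i - n, m) (hyperderiv n a))"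
  have Leibniz: "(\<Sum>n\<le>i. if i' \<le> i - n then hyperderiv n a * hyperderiv (i - n - i') (coord m j) else 0) =
      (if i' \<le> i then hyperderiv (i - i') (a * coord m j) else 0)"
  proof (cases "i' \<le> i")
    case True
    have "(\<Sum>n\<le>i. if i' \<le> i - n then hyperderiv n a * hyperderiv (i - n - i') (coord m j) else 0) =
        (\<Sum>n\<le>i - i'. hyperderiv n a * hyperderiv (i - i' - n) (coord m j))"
      using True by (intro sum.mono_neutral_cong_right) (auto simp: add.commute)
    thus ?thesis using True by (simp add: hyperderiv_mult)
  qed (auto intro!: sum.neutral)
  have "dual_coord i' j x = (if i' \<le> i then hyperderiv (i - i') (a * coord m j) else 0) -
      (\<Sum>n\<le>i. if i' \<le> i - n then hyperderiv n a * hyperderiv (i - n - i') (coord m j) else 0)"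
    unfolding x(3) dual_coord_def L.free_extend_diff L.free_extend_sum L.free_extend_single
    using x(2) assms(1) by (simp add: coord_smult cong: if_cong)
  thus ?thesis unfolding Leibniz by simp
qed

lemma dual_coord_N:
  assumes "j < r" "x \<in> P.N"
  shows "dual_coord i' j x = 0"
proof -
  have "submodule {x. Poly_Mapping.keys x \<subseteq> {..k} \<times> carrier M \<and> dual_coord i' j x = 0}
      type_ring (free_module ({..k} \<times> carrier M))"
  proof (rule P.F.submoduleI_smult)
    fix a :: "'k poly" and x assume "x \<in> {x. Poly_Mapping.keys x \<subseteq> {..k} \<times> carrier M \<and> dual_coord i' j x = 0}"
    thus "a \<odot>\<^bsub>free_module ({..k} \<times> carrier M)\<^esub> x \<in> {x. Poly_Mapping.keys x \<subseteq> {..k} \<times> carrier M \<and> dual_coord i' j x = 0}"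
      using keys_scale[of a x] by (auto simp: dual_coord_scale)
  qed (simp_all add: dual_coord_def L.free_extend_add keys_add_subset Collect_mono)
  hence "P.N \<subseteq> {x. Poly_Mapping.keys x \<subseteq> {..k} \<times> carrier M \<and> dual_coord i' j x = 0}"
    unfolding P.N_def
    by (rule module_span_least) (use P.Rel_keys dual_coord_relation assms(1) in auto)
  thus ?thesis using assms by auto
qed

definition prolonged_e :: "nat \<Rightarrow> ((nat \<times> 'm) \<Rightarrow>\<^sub>0 'k poly) set" where
  "prolonged_e p = D (p div r) (e (p mod r))"

lemma prolonged_e_closed: "p < Suc k * r \<Longrightarrow> prolonged_e p \<in> carrier (prolongation q k M)"
  using block_index[of p "Suc k" r] by (auto simp: prolonged_e_def intro!: H.D_closed e_closed)

lemma combination_coset: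
  "(\<Oplus>\<^bsub>prolongation q k M\<^esub>p\<in>{..<Suc k * r}. c p \<odot>\<^bsub>prolongation q k M\<^esub> prolonged_e p) =
    P.coset (\<Sum>p<Suc k * r. Poly_Mapping.single (p div r, e (p mod r)) (c p))"
proof -
  have "P.coset (\<Sum>p<Suc k * r. Poly_Mapping.single (p div r, e (p mod r)) (c p)) =
      (\<Oplus>\<^bsub>prolongation q k M\<^esub>p\<in>{..<Suc k * r}. P.coset (Poly_Mapping.single (p div r, e (p mod r)) (c p)))"
    by (rule P.P_finsum [symmetric])
       (use block_index[of _ "Suc k" r] e_closed in \<open>auto intro!: keys_single_subset simp: less_Suc_eq_le simp del: keys_single mult_Suc\<close>)
  thus ?thesis by (simp add: prolonged_e_def D_def P.P_smult scale_single)
qed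

text \<open>
  The Leibniz rule in terms of coordinates. It gives both the generation of \<open>\<rho>\<^sub>k M\<close> and the matrix of \<open>\<tau>\<close>.
\<close>

lemma D_combination:
  assumes "i \<le> k"
  shows "D i (\<Oplus>\<^bsub>M\<^esub>j\<in>{..<r}. c j \<odot>\<^bsub>M\<^esub> e j) =
    (\<Oplus>\<^bsub>prolongation q k M\<^esub>p\<in>{..<Suc k * r}.
      (if p div r \<le> i then hyperderiv (i - p div r) (c (p mod r)) else 0) \<odot>\<^bsub>prolongation q k M\<^esub> prolonged_e p)"
proof -
  have "(\<Sum>p<Suc k * r. Poly_Mapping.single (p div r, e (p mod r))
        (if p div r \<le> i then hyperderiv (i - p div r) (c (p mod r)) else 0)) =
      (\<Sum>s<Suc k. \<Sum>j<r. Poly_Mapping.single (s, e j) (if s \<le> i then hyperderiv (i - s) (c j) else 0))"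
    unfolding sum_blocks by (intro sum.cong refl) simp
  also have "\<dots> = (\<Sum>j<r. \<Sum>s<Suc k. Poly_Mapping.single (s, e j) (if s \<le> i then hyperderiv (i - s) (c j) else 0))"
    by (rule sum.swap)
  also have "\<dots> = (\<Sum>j<r. \<Sum>n\<le>i. Poly_Mapping.single (i - n, e j) (hyperderiv n (c j)))"
  proof (rule sum.cong[OF refl])
    fix j
    have "(\<Sum>s<Suc k. Poly_Mapping.single (s, e j) (if s \<le> i then hyperderiv (i - s) (c j) else 0)) =
        (\<Sum>s\<le>i. Poly_Mapping.single (s, e j) (hyperderiv (i - s) (c j)))"
      using assms by (intro sum.mono_neutral_cong_right) auto
    also have "\<dots> = (\<Sum>n\<le>i. Poly_Mapping.single (i - n, e j) (hyperderiv n (c j)))"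
      by (rule sum.reindex_bij_witness[of _ "\<lambda>n. i - n" "\<lambda>n. i - n"]) auto
    finally show "(\<Sum>s<Suc k. Poly_Mapping.single (s, e j) (if s \<le> i then hyperderiv (i - s) (c j) else 0)) =
        (\<Sum>n\<le>i. Poly_Mapping.single (i - n, e j) (hyperderiv n (c j)))" .
  qed
  finally show ?thesis
    unfolding combination_coset using D_finsum[OF assms, of "{..<r}" e c] e_closed by simp
qed

text \<open>
  Linear combinations of the \<open>D\<^sub>i e\<^sub>j\<close> form a submodule containing every \<open>D\<^sub>i m\<close>, and the linear forms
  \<open>dual_coord\<close> recover their coefficients.
\<close>

lemma prolonged_e_basis: "module_basis type_ring (prolongation q k M) (Suc k * r) prolonged_e"
  unfolding module_basis_def
proof (intro conjI ballI)
  show "prolonged_e \<in> {..<Suc k * r} \<rightarrow> carrier (prolongation q k M)"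
    using prolonged_e_closed by (auto simp del: mult_Suc)
  let ?comb = "\<lambda>c. \<Oplus>\<^bsub>prolongation q k M\<^esub>p\<in>{..<Suc k * r}. c p \<odot>\<^bsub>prolongation q k M\<^esub> prolonged_e p"
  let ?sum = "\<lambda>c. \<Sum>p<Suc k * r. Poly_Mapping.single (p div r, e (p mod r)) (c p)"
  fix m assume m: "m \<in> carrier (prolongation q k M)"
  have "submodule (range ?comb) type_ring (prolongation q k M)"
  proof (rule H.W.submoduleI_smult)
    show "range ?comb \<subseteq> carrier (prolongation q k M)"
      using prolonged_e_closed by (auto intro!: H.W.M.finsum_closed simp del: mult_Suc)
    have "\<zero>\<^bsub>prolongation q k M\<^esub> = ?comb (\<lambda>_. 0)"
      unfolding combination_coset by (simp add: P.P_zero)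
    thus "\<zero>\<^bsub>prolongation q k M\<^esub> \<in> range ?comb" by (rule range_eqI[of _ ?comb "\<lambda>_. 0"])
  next
    fix x y assume "x \<in> range ?comb" "y \<in> range ?comb"
    then obtain c d where cd: "x = ?comb c" "y = ?comb d" by blast
    have "x \<oplus>\<^bsub>prolongation q k M\<^esub> y = ?comb (\<lambda>p. c p + d p)"
      unfolding cd combination_coset P.P_add by (simp add: single_add sum.distrib del: mult_Suc)
    thus "x \<oplus>\<^bsub>prolongation q k M\<^esub> y \<in> range ?comb" by (rule range_eqI[of _ ?comb "\<lambda>p. c p + d p"])
  next
    fix a x assume "x \<in> range ?comb"
    then obtain c where c: "x = ?comb c" by blast
    have "a \<odot>\<^bsub>prolongation q k M\<^esub> x = ?comb (\<lambda>p. a * c p)"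
      unfolding c combination_coset P.P_smult by (simp add: scale_sum scale_single del: mult_Suc)
    thus "a \<odot>\<^bsub>prolongation q k M\<^esub> x \<in> range ?comb" by (rule range_eqI[of _ ?comb "\<lambda>p. a * c p"])
  qed
  moreover have "P.coset (Poly_Mapping.single g 1) \<in> range ?comb" if g: "g \<in> {..k} \<times> carrier M" for g
  proof -
    obtain i x where im: "g = (i, x)" "i \<le> k" "x \<in> carrier M" using g by auto
    have "P.coset (Poly_Mapping.single g 1) = D i (\<Oplus>\<^bsub>M\<^esub>j\<in>{..<r}. coord x j \<odot>\<^bsub>M\<^esub> e j)"
      using im by (simp add: D_def coord_expansion)
    also have "\<dots> \<in> range ?comb" unfolding D_combination[OF im(2)] by (rule rangeI)
    finally show ?thesis .
  qed
  ultimately have "range ?comb = carrier (prolongation q k M)" by (rule P.P_generated)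
  then obtain c where c: "m = ?comb c" using m by blast
  show "\<exists>!c. c \<in> {..<Suc k * r} \<rightarrow>\<^sub>E carrier type_ring \<and> m = ?comb c"
  proof (rule ex_ex1I)
    have "?comb (restrict c {..<Suc k * r}) = ?comb c"
      unfolding combination_coset by (intro arg_cong[of _ _ P.coset] sum.cong) (auto simp del: mult_Suc)
    thus "\<exists>c. c \<in> {..<Suc k * r} \<rightarrow>\<^sub>E carrier type_ring \<and> m = ?comb c"
      by (intro exI[of _ "restrict c {..<Suc k * r}"]) (simp add: c del: mult_Suc)
  next
    fix c d
    assume c: "c \<in> {..<Suc k * r} \<rightarrow>\<^sub>E carrier type_ring \<and> m = ?comb c"
      and d: "d \<in> {..<Suc k * r} \<rightarrow>\<^sub>E carrier type_ring \<and> m = ?comb d"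
    have "?comb c = ?comb d" using c d by metis
    hence N: "?sum c - ?sum d \<in> P.N"
      unfolding combination_coset P.coset_eq_iff .
    show "c = d"
    proof (rule PiE_ext)
      show "c \<in> {..<Suc k * r} \<rightarrow>\<^sub>E UNIV" "d \<in> {..<Suc k * r} \<rightarrow>\<^sub>E UNIV" using c d by auto
      fix t assume "t \<in> {..<Suc k * r}"
      hence t: "t < Suc k * r" by simp
      \<comment> \<open>The linear form for the index \<open>t\<close> picks out the \<open>t\<close>-th coefficient.\<close>
      have coeff: "dual_coord (t div r) (t mod r) (?sum f) = f t" for f
      proof -
        have "dual_coord (t div r) (t mod r) (?sum f) =
            (\<Sum>p<Suc k * r. dual_coord (t div r) (t mod r) (Poly_Mapping.single (p div r, e (p mod r)) (f p)))"
          by (simp only: dual_coord_def L.free_extend_sum)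
        also have "\<dots> = (\<Sum>p<Suc k * r. if p = t then f p else 0)"
        proof (rule sum.cong[OF refl])
          fix p assume "p \<in> {..<Suc k * r}"
          hence p: "p < Suc k * r" by simp
          have "p = t \<longleftrightarrow> p div r = t div r \<and> p mod r = t mod r" by (metis div_mult_mod_eq)
          moreover have "hyperderiv n (if b then 1 else 0) = (if n = 0 \<and> b then 1 else (0 :: 'k poly))" for n b
            using hyperderiv_1[of n, where ?'a = 'k] by (auto intro: poly_eqI simp: coeff_hyperderiv)
          ultimately show "dual_coord (t div r) (t mod r) (Poly_Mapping.single (p div r, e (p mod r)) (f p)) =
              (if p = t then f p else 0)"
            using block_index[OF p] block_index[OF t] by (auto simp: dual_coord_def coord_basis)
        qed
        also have "\<dots> = f t" using t by (simp del: mult_Suc)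
        finally show ?thesis .
      qed
      have "dual_coord (t div r) (t mod r) (?sum c - ?sum d) = 0"
        using dual_coord_N[OF _ N] block_index[OF t] by blast
      hence "dual_coord (t div r) (t mod r) (?sum c) - dual_coord (t div r) (t mod r) (?sum d) = 0"
        by (simp only: dual_coord_def L.free_extend_diff)
      thus "c t = d t" unfolding coeff by simp
    qed
  qed
qed

text \<open>
  As \<open>\<tau> D\<^sub>i e\<^sub>l = D\<^sub>i (\<tau> e\<^sub>l)\<close>, this is the Leibniz rule applied to \<open>\<tau> e\<^sub>l = \<Sum>\<^sub>h \<Theta>\<^sub>h\<^sub>l e\<^sub>h\<close>.
\<close>

lemma tau_prolonged_e:
  assumes "\<And>l. l < r \<Longrightarrow> tau M (e l) = (\<Oplus>\<^bsub>M\<^esub>h\<in>{..<r}. (\<Theta> $$ (h, l)) \<odot>\<^bsub>M\<^esub> e h)" "p < Suc k * r"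
  shows "tau (prolongation q k M) (prolonged_e p) =
    (\<Oplus>\<^bsub>prolongation q k M\<^esub>t\<in>{..<Suc k * r}.
      (prolong_mat hyperderiv k r \<Theta> $$ (t, p)) \<odot>\<^bsub>prolongation q k M\<^esub> prolonged_e t)"
proof -
  note p = block_index[OF assms(2)]
  have "tau (prolongation q k M) (prolonged_e p) =
      D (p div r) (\<Oplus>\<^bsub>M\<^esub>h\<in>{..<r}. (\<Theta> $$ (h, p mod r)) \<odot>\<^bsub>M\<^esub> e h)"
    by (simp add: prolonged_e_def tau_D assms(1) p)
  also have "\<dots> = (\<Oplus>\<^bsub>prolongation q k M\<^esub>t\<in>{..<Suc k * r}.
      (if t div r \<le> p div r then hyperderiv (p div r - t div r) (\<Theta> $$ (t mod r, p mod r)) else 0)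
        \<odot>\<^bsub>prolongation q k M\<^esub> prolonged_e t)"
    by (rule D_combination) (use p in simp)
  also have "\<dots> = (\<Oplus>\<^bsub>prolongation q k M\<^esub>t\<in>{..<Suc k * r}.
      (prolong_mat hyperderiv k r \<Theta> $$ (t, p)) \<odot>\<^bsub>prolongation q k M\<^esub> prolonged_e t)"
    unfolding combination_coset
    by (intro arg_cong[of _ _ P.coset] sum.cong) (use assms(2) in \<open>auto simp: prolong_mat_def\<close>)
  finally show ?thesis .
qed

end


section \<open>The Tate algebra and rigid analytic triviality\<close>

locale complete_frobenius_field = frobenius_power q "TYPE('c)"
  for q :: nat and v :: "'c::field \<Rightarrow> real" +
  assumes q_gt_1: "1 < q" and abs_v: "absolute_value v" and complete_v: "Metric_space.mcomplete UNIV (dist_of v)"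
begin

lemma v_nonneg: "0 \<le> v x" and v_0_iff: "v x = 0 \<longleftrightarrow> x = 0"
  and v_mult: "v (x * y) = v x * v y" and v_triangle: "v (x + y) \<le> v x + v y"
  using abs_v by (auto simp: absolute_value_def)

lemma v_1: "v 1 = 1"
  using v_mult[of 1 1] v_0_iff[of 1] by simp

lemma v_power: "v (x ^ n) = v x ^ n"
  by (induction n) (auto simp: v_1 v_mult)

lemma v_minus: "v (- x) = v x"
proof -
  have "v (- 1) * v (- 1) = 1" using v_mult[of "- 1" "- 1"] v_1 by simp
  hence "v (- 1) = 1" using v_nonneg[of "- 1"] by (simp add: square_eq_1_iff)
  thus ?thesis using v_mult[of "- 1" x] by simp
qed

text \<open>
  Since the Frobenius is additive, the triangle inequality for \<open>x\<^bsup>N\<^esup>\<close> and \<open>y\<^bsup>N\<^esup>\<close> with \<open>N = q\<^sup>n\<close> gives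
  \<open>v(x + y)\<^bsup>N\<^esup> \<le> 2 max(v x, v y)\<^bsup>N\<^esup>\<close>. Taking \<open>N\<close>-th roots removes the factor 2 in the limit.
\<close>

lemma v_ultrametric: "v (x + y) \<le> max (v x) (v y)"
proof (rule ccontr)
  define m where "m = max (v x) (v y)"
  assume "\<not> v (x + y) \<le> max (v x) (v y)"
  hence less: "m < v (x + y)" by (simp add: m_def not_le)
  have m0: "0 \<le> m" by (simp add: m_def v_nonneg le_max_iff_disj)
  have iter: "(x + y) ^ (q ^ n) = x ^ (q ^ n) + y ^ (q ^ n)" for n
    by (induction n) (simp_all add: power_mult mult.commute[of q] add_power)
  have bound: "v (x + y) ^ (q ^ n) \<le> 2 * m ^ (q ^ n)" for n
  proof -
    have "v (x + y) ^ (q ^ n) = v (x ^ (q ^ n) + y ^ (q ^ n))"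
      by (simp add: v_power [symmetric] iter)
    also have "\<dots> \<le> v x ^ (q ^ n) + v y ^ (q ^ n)"
      using v_triangle[of "x ^ (q ^ n)" "y ^ (q ^ n)"] by (simp add: v_power)
    also have "\<dots> \<le> m ^ (q ^ n) + m ^ (q ^ n)"
      by (intro add_mono power_mono) (auto simp: m_def v_nonneg)
    finally show ?thesis by simp
  qed
  have "m \<noteq> 0" using bound[of 0] less by (auto simp: v_nonneg)
  hence m: "0 < m" using m0 by simp
  \<comment> \<open>The powers of \<open>c\<close> would be bounded by 2.\<close>
  define c where "c = v (x + y) / m"
  have "1 < c" using less m by (simp add: c_def)
  then obtain n where n: "2 < c ^ n" using real_arch_pow by blast
  have "n \<le> q ^ n" using power_gt_expt[of q n] q_gt_1 by simp
  hence "c ^ n \<le> c ^ (q ^ n)" using \<open>1 < c\<close> by (intro power_increasing) auto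
  also have "\<dots> \<le> 2" using bound[of n] m by (simp add: c_def power_divide divide_le_eq)
  finally show False using n by simp
qed

lemma v_of_nat: "v (of_nat n) \<le> 1"
proof (induction n)
  case (Suc n)
  thus ?case using v_ultrametric[of 1 "of_nat n"] v_1 by simp
qed (simp add: v_0_iff[THEN iffD2])

lemma v_sum_le:
  assumes "0 \<le> \<epsilon>" "\<And>i. i \<in> A \<Longrightarrow> v (f i) \<le> \<epsilon>"
  shows "v (\<Sum>i\<in>A. f i) \<le> \<epsilon>"
  using assms(2)
proof (induction A rule: infinite_finite_induct)
  case (insert i A)
  thus ?case using v_ultrametric[of "f i" "sum f A"] by fastforce
qed (use assms(1) in \<open>simp_all add: v_0_iff[THEN iffD2]\<close>)

sublocale metric: Metric_space UNIV "dist_of v"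
proof
  show "v (x - y) = v (y - x)" for x y using v_minus[of "x - y"] by simp
  show "v (x - z) \<le> v (x - y) + v (y - z)" for x y z using v_triangle[of "x - y" "y - z"] by simp
qed (auto simp: v_nonneg v_0_iff)

text \<open>
  Convergence at \<open>z = 1\<close> forces the coefficients to tend to zero. Conversely, by the ultrametric
  inequality partial sums of a series with terms tending to zero form a Cauchy sequence.
\<close>

lemma tate_algebra_iff: "f \<in> tate_algebra v \<longleftrightarrow> (\<forall>\<epsilon>>0. \<exists>N. \<forall>i\<ge>N. v (fps_nth f i) < \<epsilon>)"
proof
  assume "f \<in> tate_algebra v"
  hence "v 1 \<le> 1 \<longrightarrow> (\<exists>s. limitin (valuation_topology v) (\<lambda>n. \<Sum>i<n. fps_nth f i * 1 ^ i) s sequentially)"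
    unfolding tate_algebra_def mem_Collect_eq by (rule spec)
  then obtain s where "limitin (valuation_topology v) (\<lambda>n. \<Sum>i<n. fps_nth f i) s sequentially"
    by (auto simp: v_1)
  hence lim: "\<forall>\<epsilon>>0. \<exists>N. \<forall>n\<ge>N. v ((\<Sum>i<n. fps_nth f i) - s) < \<epsilon>"
    by (simp add: metric.limitin_metric eventually_sequentially)
  show "\<forall>\<epsilon>>0. \<exists>N. \<forall>i\<ge>N. v (fps_nth f i) < \<epsilon>"
  proof (intro allI impI)
    fix \<epsilon> :: real assume "0 < \<epsilon>"
    then obtain N where N: "\<And>n. n \<ge> N \<Longrightarrow> v ((\<Sum>i<n. fps_nth f i) - s) < \<epsilon>" using lim by blast
    have "v (fps_nth f i) < \<epsilon>" if "i \<ge> N" for i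
    proof -
      define a b where "a = (\<Sum>i<Suc i. fps_nth f i) - s" and "b = (\<Sum>i<i. fps_nth f i) - s"
      have "v a < \<epsilon>" "v b < \<epsilon>" unfolding a_def b_def by (rule N, use that in simp)+
      moreover have "fps_nth f i = a + - b" by (simp add: a_def b_def)
      ultimately show ?thesis using v_ultrametric[of a "- b"] by (simp add: v_minus)
    qed
    thus "\<exists>N. \<forall>i\<ge>N. v (fps_nth f i) < \<epsilon>" by blast
  qed
next
  assume small: "\<forall>\<epsilon>>0. \<exists>N. \<forall>i\<ge>N. v (fps_nth f i) < \<epsilon>"
  show "f \<in> tate_algebra v"
    unfolding tate_algebra_def
  proof (intro CollectI allI impI)
    fix z assume z: "v z \<le> 1"
    let ?S = "\<lambda>n. \<Sum>i<n. fps_nth f i * z ^ i"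
    have "metric.MCauchy ?S"
      unfolding metric.MCauchy_def
    proof (intro conjI allI impI)
      fix \<epsilon> :: real assume \<epsilon>: "0 < \<epsilon>"
      then obtain N where N: "\<And>i. i \<ge> N \<Longrightarrow> v (fps_nth f i) < \<epsilon> / 2" using small by (meson half_gt_zero)
      have le: "v (?S n - ?S m) \<le> \<epsilon> / 2" if "N \<le> m" "m \<le> n" for m n
      proof -
        have "?S n - ?S m = (\<Sum>i\<in>{m..<n}. fps_nth f i * z ^ i)"
          using sum_diff_nat_ivl[of 0 m n "\<lambda>i. fps_nth f i * z ^ i"] that by (simp add: lessThan_atLeast0)
        moreover have "v (fps_nth f i * z ^ i) \<le> \<epsilon> / 2" if "i \<in> {m..<n}" for i
        proof -
          have "v (fps_nth f i) * v z ^ i \<le> v (fps_nth f i) * 1"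
            by (intro mult_left_mono power_le_one z v_nonneg)
          thus ?thesis using N[of i] that \<open>N \<le> m\<close> by (simp add: v_mult v_power)
        qed
        ultimately show ?thesis using \<epsilon> v_sum_le[of "\<epsilon> / 2" "{m..<n}"] by simp
      qed
      have "v (?S n - ?S m) < \<epsilon>" if "N \<le> n" "N \<le> m" for n m
      proof (cases "m \<le> n")
        case True
        thus ?thesis using le[of m n] that \<epsilon> by linarith
      next
        case False
        hence "v (?S m - ?S n) \<le> \<epsilon> / 2" using le[of n m] that by linarith
        moreover have "v (?S n - ?S m) = v (?S m - ?S n)" by (rule metric.commute)
        ultimately show ?thesis using \<epsilon> by linarith
      qed
      thus "\<exists>N. \<forall>n n'. N \<le> n \<longrightarrow> N \<le> n' \<longrightarrow> v (?S n - ?S n') < \<epsilon>" by blast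
    qed simp
    thus "\<exists>s. limitin (valuation_topology v) ?S s sequentially"
      using complete_v by (simp add: metric.mcomplete_def)
  qed
qed

lemma tate_algebra_0: "0 \<in> tate_algebra v"
  by (auto simp: tate_algebra_iff v_0_iff[THEN iffD2])

lemma tate_algebra_hyperderiv:
  assumes "f \<in> tate_algebra v"
  shows "fps_hyperderiv n f \<in> tate_algebra v"
  unfolding tate_algebra_iff
proof (intro allI impI)
  fix \<epsilon> :: real assume "0 < \<epsilon>"
  then obtain N where N: "\<And>i. i \<ge> N \<Longrightarrow> v (fps_nth f i) < \<epsilon>"
    using assms unfolding tate_algebra_iff by blast
  have "v (fps_nth (fps_hyperderiv n f) i) < \<epsilon>" if "i \<ge> N" for i
  proof -
    have "v (fps_nth (fps_hyperderiv n f) i) \<le> 1 * v (fps_nth f (i + n))"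
      unfolding fps_hyperderiv_def fps_nth_Abs_fps v_mult by (intro mult_right_mono v_of_nat v_nonneg)
    thus ?thesis using N[of "i + n"] that by simp
  qed
  thus "\<exists>N. \<forall>i\<ge>N. v (fps_nth (fps_hyperderiv n f) i) < \<epsilon>" by blast
qed

lemma prolong_mat_fps_mult:
  fixes A B :: "'c fps mat"
  shows "A \<in> carrier_mat r r \<Longrightarrow> B \<in> carrier_mat r r \<Longrightarrow>
    prolong_mat fps_hyperderiv k r (A * B) = prolong_mat fps_hyperderiv k r A * prolong_mat fps_hyperderiv k r B"
  by (rule prolong_mat_mult[OF fps_hyperderiv_sum fps_hyperderiv_mult])

lemma prolong_mat_tate:
  assumes "U \<in> carrier_mat r r" "elements_mat U \<subseteq> tate_algebra v"
  shows "elements_mat (prolong_mat fps_hyperderiv k r U) \<subseteq> tate_algebra v"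
proof
  fix a assume "a \<in> elements_mat (prolong_mat fps_hyperderiv k r U)"
  then obtain p p' where p: "p < Suc k * r" "p' < Suc k * r" "a = prolong_mat fps_hyperderiv k r U $$ (p, p')"
    by (auto simp: elements_mat_def prolong_mat_def)
  have "U $$ (p mod r, p' mod r) \<in> tate_algebra v"
    using assms(2) elements_matI[OF assms(1) block_index(2)[OF p(1)] block_index(2)[OF p(2)] refl] by blast
  thus "a \<in> tate_algebra v"
    using p by (simp add: prolong_mat_def tate_algebra_hyperderiv tate_algebra_0)
qed

lemma prolong_mat_GL_tate:
  assumes "U \<in> GL_tate v r"
  shows "prolong_mat fps_hyperderiv k r U \<in> GL_tate v (Suc k * r)"
proof -
  obtain W where U: "U \<in> carrier_mat r r" "elements_mat U \<subseteq> tate_algebra v"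
    and W: "W \<in> carrier_mat r r" "elements_mat W \<subseteq> tate_algebra v" and inv: "U * W = 1\<^sub>m r" "W * U = 1\<^sub>m r"
    using assms by (auto simp: GL_tate_def)
  have "prolong_mat fps_hyperderiv k r U * prolong_mat fps_hyperderiv k r W = 1\<^sub>m (Suc k * r)"
    "prolong_mat fps_hyperderiv k r W * prolong_mat fps_hyperderiv k r U = 1\<^sub>m (Suc k * r)"
    using U W inv by (simp_all add: prolong_mat_fps_mult [symmetric] prolong_mat_one del: mult_Suc)
  thus ?thesis
    unfolding GL_tate_def mem_Collect_eq
    by (intro conjI bexI[of _ "prolong_mat fps_hyperderiv k r W"] prolong_mat_carrier
        prolong_mat_tate[OF U] prolong_mat_tate[OF W])
qed

end

lemma (in prolonged_module) prolongation_rigid: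
  fixes j :: "'k \<Rightarrow> 'c::field" and v :: "'c \<Rightarrow> real"
  assumes j: "field_hom j" and v: "complete_frobenius_field q v"
    and rigid: "rigid_analytically_trivial q j v M"
  shows "rigid_analytically_trivial q j v (prolongation q k M)"
proof -
  interpret j: field_hom j by fact
  interpret v: complete_frobenius_field q v by fact
  obtain r e \<Theta> \<Upsilon> where basis: "module_basis type_ring M r e" and \<Theta>: "\<Theta> \<in> carrier_mat r r"
    and tau_e: "\<And>l. l < r \<Longrightarrow> tau M (e l) = (\<Oplus>\<^bsub>M\<^esub>h\<in>{..<r}. (\<Theta> $$ (h, l)) \<odot>\<^bsub>M\<^esub> e h)"
    and \<Upsilon>: "\<Upsilon> \<in> GL_tate v r"
    and eq: "map_mat (\<lambda>a. fps_of_poly (map_poly j a)) \<Theta> * map_mat (fps_twist q) \<Upsilon> = \<Upsilon>"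
    using rigid by (auto simp: rigid_analytically_trivial_def)
  interpret prolonged_basis M q k r e by unfold_locales (rule basis)
  have \<Upsilon>_carrier: "\<Upsilon> \<in> carrier_mat r r" using \<Upsilon> by (simp add: GL_tate_def)
  have twist_0: "fps_twist q 0 = (0 :: 'c fps)"
    using v.q_pos by (intro fps_ext) (simp add: fps_twist_def)
  have "map_mat (\<lambda>a. fps_of_poly (map_poly j a)) (prolong_mat hyperderiv k r \<Theta>) *
      map_mat (fps_twist q) (prolong_mat fps_hyperderiv k r \<Upsilon>) =
      prolong_mat fps_hyperderiv k r (map_mat (\<lambda>a. fps_of_poly (map_poly j a)) \<Theta>) *
      prolong_mat fps_hyperderiv k r (map_mat (fps_twist q) \<Upsilon>)"
    using \<Theta> \<Upsilon>_carrier
    by (simp add: map_mat_prolong_mat[where \<delta>' = fps_hyperderiv] fps_of_poly_hyperderiv map_poly_hyperderiv[OF j]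
        v.fps_twist_hyperderiv twist_0)
  also have "\<dots> = prolong_mat fps_hyperderiv k r \<Upsilon>"
    using \<Theta> \<Upsilon>_carrier by (simp add: v.prolong_mat_fps_mult [symmetric] eq)
  finally show ?thesis
    unfolding rigid_analytically_trivial_def
    using prolonged_e_basis tau_prolonged_e[OF tau_e] v.prolong_mat_GL_tate[OF \<Upsilon>]
    by (intro exI[of _ "Suc k * r"] exI[of _ prolonged_e] exI[of _ "prolong_mat hyperderiv k r \<Theta>"]
        exI[of _ "prolong_mat fps_hyperderiv k r \<Upsilon>"]) (simp del: mult_Suc)
qed

theorem theorem3p6:
  fixes \<iota> :: "'f::finite_field poly fract \<Rightarrow> 'k::field"
    and vK :: "'k \<Rightarrow> real"
    and vL :: "'l::field \<Rightarrow> real"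
    and vA :: "'a::alg_closed_field \<Rightarrow> real"
    and vC :: "'c::field \<Rightarrow> real"
    and iL :: "'k \<Rightarrow> 'l" and iA :: "'l \<Rightarrow> 'a" and iC :: "'a \<Rightarrow> 'c"
    and \<theta> :: 'k and q k :: nat
    and M :: "('k poly, 'm) tau_module"
  assumes "finite_extension \<iota>"
    and "q = CARD('f)"
    and "\<theta> = \<iota> (Fract [:0, 1:] 1)"
    and "extends_infinite_place \<iota> vK"
    and "is_completion vK vL iL"
    and "is_valued_algebraic_closure vL vA iA"
    and "is_completion vA vC iC"
    and "abelian_t_motive q \<theta> M"
  shows "(rigid_analytically_trivial q (iC \<circ> iA \<circ> iL) vC M \<longrightarrow>
            rigid_analytically_trivial q (iC \<circ> iA \<circ> iL) vC (prolongation q k M)) \<and>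
         (\<forall>w. pure_of_weight q M w \<longrightarrow> pure_of_weight q (prolongation q k M) w)"
proof -
  have \<iota>: "field_hom \<iota>" using assms(1) by (simp add: finite_extension_def)
  have hom_comp: "field_hom (g \<circ> f)" if "field_hom f" "field_hom g"
    for f :: "'x::field \<Rightarrow> 'y::field" and g :: "'y \<Rightarrow> 'z::field"
  proof -
    interpret f: field_hom f by fact
    interpret g: field_hom g by fact
    show ?thesis by unfold_locales (simp_all add: f.hom_add g.hom_add f.hom_mult g.hom_mult)
  qed
  have j: "field_hom (iC \<circ> iA \<circ> iL)"
    using assms(5-7) by (simp add: is_completion_def is_valued_algebraic_closure_def hom_comp)
  have frob_K: "frobenius_power TYPE('k) q"
    unfolding assms(2) by (rule frobenius_power_CARD[OF \<iota>])
  have frob_C: "frobenius_power TYPE('c) q"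
    unfolding assms(2) by (rule frobenius_power_CARD[OF hom_comp[OF \<iota> j]])
  have "1 < q"
    using card_mono[of "UNIV :: 'f set" "{0, 1}"] by (simp add: assms(2))
  hence C: "complete_frobenius_field q vC"
    using frob_C assms(7)
    by (simp add: complete_frobenius_field_def complete_frobenius_field_axioms_def is_completion_def)
  have "skew_module q M" using assms(8) by (simp add: abelian_t_motive_def t_motive_def)
  hence "prolonged_module M q"
    using frob_K by (simp add: prolonged_module_def frobenius_module_def skew_module_iff)
  then interpret prolonged_module M q k .
  show ?thesis using prolongation_rigid[OF j C] prolongation_pure by blast
qed

end
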